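(* Let $R$ be an ergodic equivalence relation of type $\mathrm{II}_1$ with cost $C(R)=1$. Then $h(R)=0$, where $h(R)$ is the uniform isoperimetric constant of $R$.
   Context: Let $(X,\mu)$ be a standard non-atomic probability space. A measured equivalence relation $R$ on $(X,\mu)$ is an equivalence relation on $X$ with countable classes, Borel as a subset of $X\times X$, such that saturations of $\mu$-null sets are $\mu$-null. It is ergodic if every saturated measurable set has measure $0$ or $1$. A partial automorphism of $R$ is a bimeasurable bijection between measurable subsets of $X$ whose graph lies in $R$; $[R]$ is the group of (full) automorphisms of $R$, i.e. those with domain and image $X$. $R$ is of type $\mathrm{II}_1$ if $\mu$ is invariant under every partial automorphism of $R$. Put $R^x=\{(x,y)\in R\}$ and $\mathfrak h(E)=\int_X|E\cap R^x|\,d\mu(x)$ for measurable $E\subset R$. A graphing of $R$ is a countable family $\Phi=\{\varphi_i\}$ of partial automorphisms of $R$ such that for almost every $(x,y)\in R$ one has $y=\psi_n\cdots\psi_1(x)$ for some $\psi_1,\dots,\psi_n\in\Phi\cup\Phi^{-1}$; equivalently, it is described by a measurable subset $K\subset R$ generating $R$ up to null sets. It is finite if it can be partitioned into finitely many partial automorphisms; $R$ is finitely generated if it has a finite graphing (equivalently, finite cost). Cost: $C(\Phi)=\sum_i\mu(\mathrm{dom}\,\varphi_i)$, and $C(R)=\inf_\Phi C(\Phi)$ over all graphings $\Phi$ of $R$. Isoperimetric constant: for a finite graphing $K\subset R$, the Cayley graph $\Sigma=\Sigma_K=\coprod_{x\in X}\Sigma^x$ is the measurable field of graphs where $\Sigma^x$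 has vertex set $R^x$ and edges the pairs $((x,y),(x,z))\in R^x\times R^x$ with $(y,z)\in K$. Let $\Sigma^{(1)}$ be its set of edges and $\nu^{(1)}(E)=\int_X|E\cap\Sigma^x|\,d\mu(x)$ for measurable $E\subset\Sigma^{(1)}$. A symmetric vertex of $\Sigma$ is the graph $\{(x,\varphi(x)):x\in X\}\subset R$ of an element $\varphi\in[R]$; two are disjoint if their intersection is $\mathfrak h$-null. For a finite set $A$ of symmetric vertices, $\partial_K A\subset\Sigma^{(1)}$ is the set of edges of $\Sigma$ with one vertex in (the union of) $A$ and the other outside. Then $h_K(R)=\inf_A\nu^{(1)}(\partial_KA)/|A|$ over non-empty finite sets $A$ of pairwise disjoint symmetric vertices of $\Sigma_K$, and $h(R)=\inf_K h_K(R)$ over all finite graphings $K$ of $R$. *)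

theory Defs
  imports "HOL-Probability.Probability" "HOL-Library.Disjoint_Sets"
begin

definition standard_borel :: "'a measure \<Rightarrow> bool" where
  "standard_borel M \<longleftrightarrow>
     (\<exists>T. topspace T = space M \<and> completely_metrizable_space T \<and> separable_space T \<and>
          sets M = sigma_sets (space M) {U. openin T U})"

definition nonatomic :: "'a measure \<Rightarrow> bool" where
  "nonatomic M \<longleftrightarrow>
     (\<forall>A\<in>sets M. emeasure M A > 0 \<longrightarrow>
        (\<exists>B\<in>sets M. B \<subseteq> A \<and> 0 < emeasure M B \<and> emeasure M B < emeasure M A))"

definition standard_nonatomic_prob_space :: "'a measure \<Rightarrow> bool" where
  "standard_nonatomic_prob_space M \<longleftrightarrow> prob_space M \<and> standard_borel M \<and> nonatomic M"

text \<open>The image \<open>R `` A\<close> is the saturation of \<open>A\<close>, and \<open>R `` {x}\<close> is the class of \<open>x\<close>.\<close>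

definition measured_equivalence_relation :: "'a measure \<Rightarrow> 'a rel \<Rightarrow> bool" where
  "measured_equivalence_relation M R \<longleftrightarrow>
     equiv (space M) R \<and>
     (\<forall>x\<in>space M. countable (R `` {x})) \<and>
     R \<in> sets (M \<Otimes>\<^sub>M M) \<and>
     (\<forall>N\<in>null_sets M. R `` N \<in> null_sets M)"

definition ergodic :: "'a measure \<Rightarrow> 'a rel \<Rightarrow> bool" where
  "ergodic M R \<longleftrightarrow>
     (\<forall>A\<in>sets M. R `` A = A \<longrightarrow> emeasure M A = 0 \<or> emeasure M A = 1)"

text \<open>A partial automorphism \<open>f : A \<rightarrow> B\<close> is represented by its graph \<open>{(x, f x) | x \<in> A}\<close>;
  thus its domain, image and inverse are \<open>Domain\<close>, \<open>Range\<close> and converse of the graph.\<close>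

definition partial_automorphism :: "'a measure \<Rightarrow> 'a rel \<Rightarrow> 'a rel \<Rightarrow> bool" where
  "partial_automorphism M R \<phi> \<longleftrightarrow>
     (\<exists>A\<in>sets M. \<exists>B\<in>sets M. \<exists>f.
        bij_betw f A B \<and>
        f \<in> restrict_space M A \<rightarrow>\<^sub>M restrict_space M B \<and>
        the_inv_into A f \<in> restrict_space M B \<rightarrow>\<^sub>M restrict_space M A \<and>
        \<phi> = (\<lambda>x. (x, f x)) ` A \<and> \<phi> \<subseteq> R)"

definition full_group :: "'a measure \<Rightarrow> 'a rel \<Rightarrow> 'a rel set" where
  "full_group M R =
     {\<phi>. partial_automorphism M R \<phi> \<and> Domain \<phi> = space M \<and> Range \<phi> = space M}"

definition type_II1 :: "'a measure \<Rightarrow> 'a rel \<Rightarrow> bool" where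
  "type_II1 M R \<longleftrightarrow>
     (\<forall>\<phi>. partial_automorphism M R \<phi> \<longrightarrow>
        (\<forall>E\<in>sets M. E \<subseteq> Domain \<phi> \<longrightarrow> emeasure M (\<phi> `` E) = emeasure M E))"

definition fibre :: "'a rel \<Rightarrow> 'a \<Rightarrow> 'a rel" where
  "fibre R x = {p \<in> R. fst p = x}"

text \<open>Cardinalities are taken in \<open>ennreal\<close>, as counting measure, so that infinite sets have
  cardinality \<open>\<infinity>\<close>.\<close>

definition h_measure :: "'a measure \<Rightarrow> 'a rel \<Rightarrow> 'a rel \<Rightarrow> ennreal" where
  "h_measure M R E = (\<integral>\<^sup>+x. emeasure (count_space UNIV) (E \<inter> fibre R x) \<partial>M)"

definition h_null :: "'a measure \<Rightarrow> 'a rel \<Rightarrow> 'a rel \<Rightarrow> bool" where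
  "h_null M R E \<longleftrightarrow>
     (\<exists>N\<in>sets (M \<Otimes>\<^sub>M M). E \<subseteq> N \<and> N \<subseteq> R \<and> h_measure M R N = 0)"

text \<open>Almost every \<open>(x, y) \<in> R\<close> is joined by a finite word in \<open>K\<close> and its inverse; the empty
  word is allowed. For \<open>K = \<Union>\<Phi>\<close>, a step in \<open>K \<union> K\<inverse>\<close> is the application of an element of
  \<open>\<Phi> \<union> \<Phi>\<inverse>\<close>.\<close>

definition generates :: "'a measure \<Rightarrow> 'a rel \<Rightarrow> 'a rel \<Rightarrow> bool" where
  "generates M R K \<longleftrightarrow> h_null M R {p \<in> R. p \<notin> (K \<union> K\<inverse>)\<^sup>*}"

definition graphing :: "'a measure \<Rightarrow> 'a rel \<Rightarrow> 'a rel set \<Rightarrow> bool" where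
  "graphing M R \<Phi> \<longleftrightarrow>
     countable \<Phi> \<and> (\<forall>\<phi>\<in>\<Phi>. partial_automorphism M R \<phi>) \<and> generates M R (\<Union>\<Phi>)"

definition graphing_cost :: "'a measure \<Rightarrow> 'a rel set \<Rightarrow> ennreal" where
  "graphing_cost M \<Phi> = (\<Sum>\<^sub>\<infinity>\<phi>\<in>\<Phi>. emeasure M (Domain \<phi>))"

definition cost :: "'a measure \<Rightarrow> 'a rel \<Rightarrow> ennreal" where
  "cost M R = (INF \<Phi>\<in>{\<Phi>. graphing M R \<Phi>}. graphing_cost M \<Phi>)"

definition finite_graphing :: "'a measure \<Rightarrow> 'a rel \<Rightarrow> 'a rel \<Rightarrow> bool" where
  "finite_graphing M R K \<longleftrightarrow>
     K \<in> sets (M \<Otimes>\<^sub>M M) \<and> K \<subseteq> R \<and> generates M R K \<and>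
     (\<exists>\<P>. finite \<P> \<and> partition_on K \<P> \<and> (\<forall>\<phi>\<in>\<P>. partial_automorphism M R \<phi>))"

text \<open>The edges of \<open>\<Sigma>\<^sup>x\<close> are ordered pairs of vertices, and \<open>K\<close> need not be symmetric.\<close>

definition cayley_edges_at :: "'a rel \<Rightarrow> 'a rel \<Rightarrow> 'a \<Rightarrow> ('a \<times> 'a) rel" where
  "cayley_edges_at R K x = {(p, q). p \<in> fibre R x \<and> q \<in> fibre R x \<and> (snd p, snd q) \<in> K}"

definition cayley_edges :: "'a measure \<Rightarrow> 'a rel \<Rightarrow> 'a rel \<Rightarrow> ('a \<times> 'a) rel" where
  "cayley_edges M R K = (\<Union>x\<in>space M. cayley_edges_at R K x)"

definition edge_measure ::
  "'a measure \<Rightarrow> 'a rel \<Rightarrow> 'a rel \<Rightarrow> ('a \<times> 'a) rel \<Rightarrow> ennreal" where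
  "edge_measure M R K E =
     (\<integral>\<^sup>+x. emeasure (count_space UNIV) (E \<inter> cayley_edges_at R K x) \<partial>M)"

text \<open>Since elements of the full group are represented by their graphs, symmetric vertices
  are exactly the elements of \<open>full_group M R\<close>.\<close>

definition disjoint_symmetric_vertices ::
  "'a measure \<Rightarrow> 'a rel \<Rightarrow> 'a rel set \<Rightarrow> bool" where
  "disjoint_symmetric_vertices M R A \<longleftrightarrow>
     A \<subseteq> full_group M R \<and> pairwise (\<lambda>V W. h_null M R (V \<inter> W)) A"

definition edge_boundary ::
  "'a measure \<Rightarrow> 'a rel \<Rightarrow> 'a rel \<Rightarrow> 'a rel set \<Rightarrow> ('a \<times> 'a) rel" where
  "edge_boundary M R K A =
     {(p, q) \<in> cayley_edges M R K. (p \<in> \<Union>A) \<noteq> (q \<in> \<Union>A)}"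

definition isoperimetric_constant :: "'a measure \<Rightarrow> 'a rel \<Rightarrow> 'a rel \<Rightarrow> ennreal" where
  "isoperimetric_constant M R K =
     (INF A\<in>{A. finite A \<and> A \<noteq> {} \<and> disjoint_symmetric_vertices M R A}.
        edge_measure M R K (edge_boundary M R K A) / of_nat (card A))"

definition uniform_isoperimetric_constant :: "'a measure \<Rightarrow> 'a rel \<Rightarrow> ennreal" where
  "uniform_isoperimetric_constant M R =
     (INF K\<in>{K. finite_graphing M R K}. isoperimetric_constant M R K)"

end

theory Submission
  imports Defs
begin

text \<open>Take a graphing \<open>E\<close> of cost at most \<open>1 + d\<close>. By ergodicity, sets of equal measure are matched by
  partial automorphisms, so there is a subrelation \<open>S\<close> all of whose classes have \<open>n\<close> points, and whose
  classes are transversed by a set \<open>Y\<close> of measure \<open>1 / n\<close>. Leading every point to \<open>Y\<close> along a forest in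
  \<open>E\<close> uses up cost \<open>1 - 1 / n\<close>; collapsing the forest shows that \<open>S\<close> together with edges of total
  measure of order \<open>d + 1 / n\<close> generates \<open>R\<close>, and spreading the ends of these edges over
  distinct points turns them into three partial automorphisms. The cyclic rotations of the classes of
  \<open>S\<close> are \<open>n\<close> disjoint symmetric vertices whose union is \<open>S\<close>. Edges inside \<open>S\<close> do not meet
  its boundary, and the remaining ones are counted at most \<open>2 n\<close> times, so the isoperimetric ratio
  is of order \<open>d + 1 / n\<close>.\<close>

subsection \<open>Suslin sets and measurable projections\<close>

text \<open>The graphing generates \<open>R\<close> only off a set of pairs whose section counts
  have lower integral 0. To pass to a null set of points, the projection of that set has to be
  measurable modulo a null set; hence the Suslin operation. Deleting the saturation of the null set
  leaves a conull invariant set on which the words in the graphing enumerate every class. This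
  enumeration by countably many measurable maps takes the place of a uniformization theorem:
  afterwards an existential quantifier over a class is a countable union. The second obstacle is
  that \<open>finite_graphing\<close> asks for finitely many partial automorphisms, whereas small
  mass bounds only the average degree, and contracting a forest may pile up arbitrarily many edges
  at one point. Hence the detour through distinct copies of the endpoints. The size of the classes
  drops out of the final ratio: a larger n increases the number of boundary edges and the number of
  symmetric vertices in the same proportion, while the uncollapsed part shrinks with 1 / n.\<close>

text \<open>The Suslin operation, where \<open>A n s\<close> may depend on any finite set \<open>D n\<close> of coordinates of \<open>s\<close>
  instead of the first \<open>n\<close> of them; this spares all coding of finite sequences.\<close>

definition suslin :: "'b set set \<Rightarrow> 'b set \<Rightarrow> bool" where
  "suslin \<E> N \<longleftrightarrow> (\<exists>(A :: nat \<Rightarrow> (nat \<Rightarrow> nat) \<Rightarrow> 'b set) D.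
     (\<forall>n s. A n s \<in> \<E>) \<and> (\<forall>n. finite (D n)) \<and>
     (\<forall>n s s'. (\<forall>i\<in>D n. s i = s' i) \<longrightarrow> A n s = A n s') \<and>
     N = {z. \<exists>s. \<forall>n. z \<in> A n s})"

lemma suslin_basic: "N \<in> \<E> \<Longrightarrow> suslin \<E> N"
  unfolding suslin_def
  by (rule exI[of _ "\<lambda>_ _. N"], rule exI[of _ "\<lambda>_. {}"]) auto

lemma suslin_schemes:
  fixes N :: "'i \<Rightarrow> 'b set"
  assumes "\<And>i. suslin \<E> (N i)"
  shows "\<exists>(A :: 'i \<Rightarrow> nat \<Rightarrow> (nat \<Rightarrow> nat) \<Rightarrow> 'b set) D.
     (\<forall>i n s. A i n s \<in> \<E>) \<and> (\<forall>i n. finite (D i n)) \<and>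
     (\<forall>i n s s'. (\<forall>j\<in>D i n. s j = s' j) \<longrightarrow> A i n s = A i n s') \<and>
     (\<forall>i. N i = {z. \<exists>s. \<forall>n. z \<in> A i n s})"
proof -
  let ?P = "\<lambda>N (A :: nat \<Rightarrow> (nat \<Rightarrow> nat) \<Rightarrow> 'b set) D.
     (\<forall>n s. A n s \<in> \<E>) \<and> (\<forall>n. finite (D n)) \<and>
     (\<forall>n s s'. (\<forall>i\<in>D n. s i = s' i) \<longrightarrow> A n s = A n s') \<and>
     N = {z. \<exists>s. \<forall>n. z \<in> A n s}"
  have "\<forall>i. \<exists>AD. ?P (N i) (fst AD) (snd AD)"
    using assms unfolding suslin_def by simp
  from this[THEN choice] obtain AD where AD: "\<forall>i. ?P (N i) (fst (AD i)) (snd (AD i))" ..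
  show ?thesis
    by (rule exI[of _ "\<lambda>i. fst (AD i)"], rule exI[of _ "\<lambda>i. snd (AD i)"]) (use AD in meson)
qed

text \<open>One sequence codes a sequence of sequences through \<open>prod_encode\<close>, and the
  conditions are enumerated by pairs as well. The finite set of relevant coordinates is merely
  transported by the pairing.\<close>

lemma suslin_INT:
  assumes "\<And>i::nat. suslin \<E> (N i)"
  shows "suslin \<E> (\<Inter>i. N i)"
proof -
  obtain A :: "nat \<Rightarrow> nat \<Rightarrow> (nat \<Rightarrow> nat) \<Rightarrow> 'a set" and D where
      AE: "\<And>i n s. A i n s \<in> \<E>" and fin: "\<And>i n. finite (D i n)"
      and dep: "\<And>i n s s'. (\<forall>j\<in>D i n. s j = s' j) \<Longrightarrow> A i n s = A i n s'"
      and N: "\<And>i. N i = {z. \<exists>s. \<forall>n. z \<in> A i n s}"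
    using suslin_schemes[of \<E> N, OF assms] by (elim exE conjE) blast
  define A' where "A' m s = A (fst (prod_decode m)) (snd (prod_decode m))
      (\<lambda>j. s (prod_encode (fst (prod_decode m), j)))" for m :: nat and s :: "nat \<Rightarrow> nat"
  define D' where "D' m = (\<lambda>j. prod_encode (fst (prod_decode m), j)) `
      D (fst (prod_decode m)) (snd (prod_decode m))" for m
  have "(\<Inter>i. N i) = {z. \<exists>s. \<forall>m. z \<in> A' m s}" (is "?L = ?R")
  proof
    show "?R \<subseteq> ?L"
    proof (clarify, unfold N, clarify)
      fix z s i assume "\<forall>m. z \<in> A' m s"
      then have "z \<in> A i n (\<lambda>j. s (prod_encode (i, j)))" for n
        by (auto simp: A'_def dest: spec[of _ "prod_encode (i, n)"])
      then show "\<exists>s. \<forall>n. z \<in> A i n s" by blast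
    qed
    show "?L \<subseteq> ?R"
    proof
      fix z assume "z \<in> ?L"
      then have "\<forall>i. \<exists>s. \<forall>n. z \<in> A i n s" using N by auto
      from this[THEN choice] obtain s where s: "\<And>i n. z \<in> A i n (s i)" by blast
      have "z \<in> A' m (\<lambda>k. s (fst (prod_decode k)) (snd (prod_decode k)))" for m
        using s by (simp add: A'_def)
      then show "z \<in> ?R" by blast
    qed
  qed
  moreover have "\<forall>m s. A' m s \<in> \<E>" "\<forall>m. finite (D' m)"
    by (auto simp: A'_def D'_def AE fin)
  moreover have "A' m s = A' m s'" if "\<forall>i\<in>D' m. s i = s' i" for m s s'
    unfolding A'_def by (rule dep) (use that in \<open>auto simp: D'_def\<close>)
  ultimately show ?thesis unfolding suslin_def by blast
qed

text \<open>Coordinate 0 of the coding sequence names the member of the union, and the remaining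
  coordinates witness membership in it. Conditions that belong to other members are replaced by the
  vacuous condition \<open>\<Omega>\<close>.\<close>

lemma suslin_UN:
  assumes sus: "\<And>i::nat. suslin \<E> (N i)" and \<Omega>: "\<Omega> \<in> \<E>" "\<And>i. N i \<subseteq> \<Omega>"
  shows "suslin \<E> (\<Union>i. N i)"
proof -
  obtain A :: "nat \<Rightarrow> nat \<Rightarrow> (nat \<Rightarrow> nat) \<Rightarrow> 'a set" and D where
      AE: "\<And>i n s. A i n s \<in> \<E>" and fin: "\<And>i n. finite (D i n)"
      and dep: "\<And>i n s s'. (\<forall>j\<in>D i n. s j = s' j) \<Longrightarrow> A i n s = A i n s'"
      and N: "\<And>i. N i = {z. \<exists>s. \<forall>n. z \<in> A i n s}"
    using suslin_schemes[of \<E> N, OF sus] by (elim exE conjE) blast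
  define A' where "A' m s = (if fst (prod_decode m) = s 0
      then A (s 0) (snd (prod_decode m)) (\<lambda>j. s (Suc j)) else \<Omega>)"
    for m :: nat and s :: "nat \<Rightarrow> nat"
  define D' where "D' m = insert 0 (Suc ` D (fst (prod_decode m)) (snd (prod_decode m)))" for m
  have "(\<Union>i. N i) = {z. \<exists>s. \<forall>m. z \<in> A' m s}" (is "?L = ?R")
  proof
    show "?R \<subseteq> ?L"
    proof
      fix z assume "z \<in> ?R"
      then obtain s where s: "\<And>m. z \<in> A' m s" by blast
      have "z \<in> A (s 0) n (\<lambda>j. s (Suc j))" for n
        using s[of "prod_encode (s 0, n)"] by (simp add: A'_def)
      then have "z \<in> N (s 0)" unfolding N by blast
      then show "z \<in> ?L" by blast
    qed
    show "?L \<subseteq> ?R"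
    proof
      fix z assume "z \<in> ?L"
      then obtain i s where s: "\<And>n. z \<in> A i n s" and "z \<in> N i" using N by auto
      have "z \<in> A' m (case_nat i s)" for m
        using s \<open>z \<in> N i\<close> \<Omega> by (auto simp: A'_def)
      then show "z \<in> ?R" by blast
    qed
  qed
  moreover have "\<forall>m s. A' m s \<in> \<E>" "\<forall>m. finite (D' m)"
    by (auto simp: A'_def D'_def AE fin \<Omega>)
  moreover have "A' m s = A' m s'" if "\<forall>i\<in>D' m. s i = s' i" for m s s'
  proof -
    have "s 0 = s' 0" using that by (simp add: D'_def)
    moreover have "A (s' 0) (snd (prod_decode m)) (\<lambda>j. s (Suc j)) = A (s' 0) (snd (prod_decode m)) (\<lambda>j. s' (Suc j))"
      if "fst (prod_decode m) = s' 0"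
      by (rule dep) (use that \<open>\<forall>i\<in>D' m. s i = s' i\<close> in \<open>auto simp: D'_def\<close>)
    ultimately show ?thesis by (auto simp: A'_def)
  qed
  ultimately show ?thesis unfolding suslin_def by blast
qed

lemma suslin_Un:
  assumes "suslin \<E> N" "suslin \<E> N'" "\<Omega> \<in> \<E>" "N \<subseteq> \<Omega>" "N' \<subseteq> \<Omega>"
  shows "suslin \<E> (N \<union> N')"
proof -
  have "suslin \<E> (\<Union>i::nat. if i = 0 then N else N')"
    by (rule suslin_UN[OF _ assms(3)]) (use assms in auto)
  moreover have "(\<Union>i::nat. if i = 0 then N else N') = N \<union> N'"
    by (auto split: if_splits)
  ultimately show ?thesis by simp
qed

section \<open>Capacitability and measurability of Suslin sets\<close>

text \<open>Infinite index sets are thinned so that one more coordinate becomes constant at each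
  stage. The limit \<open>s\<close> is used only as a cluster point: each of its initial segments
  occurs in arbitrarily late \<open>t N\<close>.\<close>

lemma bounded_sequences_compact:
  fixes k :: "nat \<Rightarrow> nat" and t :: "nat \<Rightarrow> nat \<Rightarrow> nat"
  assumes bd: "\<And>N i. t N i \<le> k i"
  shows "\<exists>s. (\<forall>i. s i \<le> k i) \<and> (\<forall>n m. \<exists>N\<ge>m. \<forall>i<n. t N i = s i)"
proof -
  have "\<exists>I. \<forall>n::nat. infinite (I n) \<and> (I (Suc n) \<subseteq> I n \<and> (\<exists>c. \<forall>N\<in>I (Suc n). t N n = c))"
  proof (rule dependent_nat_choice)
    show "\<exists>x::nat set. infinite x" by blast
  next
    fix x :: "nat set" and n assume x: "infinite x"
    have "finite ((\<lambda>N. t N n) ` x)"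
      by (rule finite_subset[of _ "{..k n}"]) (use bd in auto)
    from pigeonhole_infinite[OF x this] obtain a where "infinite {N\<in>x. t N n = t a n}" by blast
    then show "\<exists>y. infinite y \<and> y \<subseteq> x \<and> (\<exists>c. \<forall>N\<in>y. t N n = c)"
      by (intro exI[of _ "{N\<in>x. t N n = t a n}"]) auto
  qed
  then obtain I where I: "\<And>n. infinite (I n)" "\<And>n. I (Suc n) \<subseteq> I n"
      "\<And>n. \<exists>c. \<forall>N\<in>I (Suc n). t N n = c" by blast
  from I(3) have "\<forall>n. \<exists>c. \<forall>N\<in>I (Suc n). t N n = c" by blast
  from this[THEN choice] obtain s where s: "\<And>n N. N \<in> I (Suc n) \<Longrightarrow> t N n = s n" by blast
  have dec: "I n \<subseteq> I m" if "m \<le> n" for m n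
    using lift_Suc_antimono_le[of I, OF I(2) that] .
  show ?thesis
  proof (intro exI[of _ s] conjI allI)
    fix i show "s i \<le> k i"
      using s[of _ i] I(1)[of "Suc i"] bd by (metis finite.emptyI equals0I)
  next
    fix n m
    obtain N where "N \<in> I n" "N \<ge> m"
      using I(1)[of n] by (meson finite_nat_set_iff_bounded_le nat_le_linear)
    then show "\<exists>N\<ge>m. \<forall>i<n. t N i = s i"
      using s dec by (metis Suc_leI subsetD)
  qed
qed

text \<open>Choquet's capacitability argument. A bound \<open>k\<close> on the coding sequences is
  chosen one coordinate at a time, at a small loss of outer measure. For bounded sequences the
  finite stages \<open>B n\<close> are measurable, and compactness places their intersection inside
  \<open>S\<close>.\<close>

lemma suslin_approx:
  assumes "prob_space M" and sus: "suslin (sets M) S" and e: "e > 0"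
  shows "\<exists>B\<in>sets M. B \<subseteq> S \<and> outer_measure_of M S \<le> emeasure M B + ennreal e"
proof -
  interpret prob_space M by fact
  obtain A :: "nat \<Rightarrow> (nat \<Rightarrow> nat) \<Rightarrow> 'a set" and D where
      AM: "\<And>n s. A n s \<in> sets M" and fin: "\<And>n. finite (D n)"
      and dep: "\<And>n s s'. (\<forall>j\<in>D n. s j = s' j) \<Longrightarrow> A n s = A n s'"
      and S: "S = {z. \<exists>s. \<forall>n. z \<in> A n s}" using sus unfolding suslin_def by blast
  define Sk where "Sk n k = {z. \<exists>s. (\<forall>i<n. s i \<le> k i) \<and> (\<forall>m. z \<in> A m s)}"
    for n :: nat and k :: "nat \<Rightarrow> nat"
  let ?\<mu> = "outer_measure_of M"
  have SM: "S \<subseteq> space M" using AM[THEN sets.sets_into_space] by (auto simp: S)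
  have om_fin: "?\<mu> T < \<infinity>" if "T \<subseteq> S" for T
  proof -
    have "?\<mu> T \<le> 1"
      using outer_measure_of_mono[of T "space M" M] that SM by (simp add: emeasure_space_1)
    then show ?thesis by (rule le_less_trans) simp
  qed
  have step: "\<exists>c. ?\<mu> (Sk n k) \<le> ?\<mu> (Sk (Suc n) (k(n := c))) + ennreal d" if "d > 0" for n k d
  proof -
    have eq: "Sk n k = (\<Union>c. Sk (Suc n) (k(n := c)))"
    proof
      show "Sk n k \<subseteq> (\<Union>c. Sk (Suc n) (k(n := c)))"
      proof
        fix z assume "z \<in> Sk n k"
        then obtain s where "\<forall>i<n. s i \<le> k i" "\<forall>m. z \<in> A m s" by (auto simp: Sk_def)
        then have "z \<in> Sk (Suc n) (k(n := s n))" by (auto simp: Sk_def less_Suc_eq)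
        then show "z \<in> (\<Union>c. Sk (Suc n) (k(n := c)))" by blast
      qed
      show "(\<Union>c. Sk (Suc n) (k(n := c))) \<subseteq> Sk n k"
      proof
        fix z assume "z \<in> (\<Union>c. Sk (Suc n) (k(n := c)))"
        then obtain c s where "\<forall>i<Suc n. s i \<le> (k(n := c)) i" "\<forall>m. z \<in> A m s"
          by (auto simp: Sk_def)
        moreover from this(1) have "\<forall>i<n. s i \<le> k i"
          by (metis fun_upd_other less_SucI less_irrefl)
        ultimately show "z \<in> Sk n k" unfolding Sk_def by blast
      qed
    qed
    have inc: "incseq (\<lambda>c. Sk (Suc n) (k(n := c)))"
    proof (rule incseq_SucI)
      fix c
      have "s i \<le> (k(n := Suc c)) i" if "s i \<le> (k(n := c)) i" for s :: "nat \<Rightarrow> nat" and i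
        using that by (cases "i = n") auto
      then show "Sk (Suc n) (k(n := c)) \<subseteq> Sk (Suc n) (k(n := Suc c))"
        unfolding Sk_def by blast
    qed
    have sub: "Sk (Suc n) (k(n := c)) \<subseteq> space M" for c
      using SM by (auto simp: Sk_def S)
    \<comment> \<open>Outer measure is continuous along increasing sequences of arbitrary sets; this
      is why some finite bound on the next coordinate suffices.\<close>
    have sup: "(SUP c. ?\<mu> (Sk (Suc n) (k(n := c)))) = ?\<mu> (Sk n k)"
      unfolding eq by (rule SUP_outer_measure_of_incseq[OF sub inc])
    show ?thesis
    proof (rule ccontr)
      assume "\<not> ?thesis"
      then have "?\<mu> (Sk (Suc n) (k(n := c))) + ennreal d \<le> ?\<mu> (Sk n k)" for c
        by (meson linorder_not_le order_less_imp_le)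
      then have "(SUP c. ?\<mu> (Sk (Suc n) (k(n := c))) + ennreal d) \<le> ?\<mu> (Sk n k)"
        by (intro SUP_least)
      then have "?\<mu> (Sk n k) + ennreal d \<le> ?\<mu> (Sk n k)"
        using sup by (simp add: ennreal_SUP_add_left)
      moreover have "?\<mu> (Sk n k) < \<infinity>" by (rule om_fin) (auto simp: Sk_def S)
      ultimately show False using that
        by (cases "?\<mu> (Sk n k)") (auto simp: ennreal_plus[symmetric] simp del: ennreal_plus)
    qed
  qed
  \<comment> \<open>Bounding coordinate n may cost \<open>e * (1/2)^Suc n\<close>; the loss before
    coordinate n is the partial geometric sum.\<close>
  define P where "P n k \<longleftrightarrow> ?\<mu> S \<le> ?\<mu> (Sk n k) + ennreal (e * (1 - (1/2)^n))" for n k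
  have "\<exists>K. \<forall>n. P n (K n) \<and> (\<forall>i<n. K (Suc n) i = K n i)"
  proof (rule dependent_nat_choice)
    show "\<exists>x. P 0 x" by (auto simp: P_def Sk_def S)
  next
    fix k n assume p: "P n k"
    have dd: "e * (1/2)^Suc n > 0" using e by simp
    from step[OF dd] obtain c where
      c: "?\<mu> (Sk n k) \<le> ?\<mu> (Sk (Suc n) (k(n := c))) + ennreal (e * (1/2)^Suc n)" by blast
    have "?\<mu> S \<le> ?\<mu> (Sk (Suc n) (k(n := c))) + ennreal (e * (1/2)^Suc n) + ennreal (e * (1 - (1/2)^n))"
      using p[unfolded P_def] c by (meson add_mono order_refl order_trans)
    also have "\<dots> = ?\<mu> (Sk (Suc n) (k(n := c))) + ennreal (e * (1 - (1/2)^Suc n))"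
      using e by (simp add: add.assoc ennreal_plus[symmetric] power_le_one algebra_simps del: ennreal_plus)
    finally have "P (Suc n) (k(n := c))" by (simp add: P_def)
    then show "\<exists>y. P (Suc n) y \<and> (\<forall>i<n. y i = k i)" by (intro exI[of _ "k(n := c)"]) auto
  qed
  then obtain K where K: "\<And>n. P n (K n)" "\<And>n i. i < n \<Longrightarrow> K (Suc n) i = K n i" by blast
  define k where "k i = K (Suc i) i" for i
  have Kk: "K n i = k i" if "i < n" for n i
    using that K(2) unfolding k_def by (induction n) (auto simp: less_Suc_eq)
  have Pk: "?\<mu> S \<le> ?\<mu> (Sk n k) + ennreal e" for n
  proof -
    have "Sk n (K n) = Sk n k" using Kk by (auto simp: Sk_def)
    then have "?\<mu> S \<le> ?\<mu> (Sk n k) + ennreal (e * (1 - (1/2)^n))" using K(1)[of n] by (simp add: P_def)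
    also have "\<dots> \<le> ?\<mu> (Sk n k) + ennreal e"
      using e by (intro add_left_mono ennreal_leI) (simp add: algebra_simps)
    finally show ?thesis .
  qed
  define B where "B n = {z. \<exists>s. (\<forall>i. s i \<le> k i) \<and> (\<forall>m\<le>n. z \<in> A m s)}" for n
  define DD where "DD n = (\<Union>m\<le>n. D m)" for n
  have finDD: "finite (DD n)" for n by (simp add: DD_def fin)
  \<comment> \<open>Coordinates outside \<open>DD n\<close> can be reset to 0, which respects every
    bound. Only finitely many bounded sequences then remain, so \<open>B n\<close> is a finite union
    of finite intersections.\<close>
  have depDD: "A m s = A m (\<lambda>i. if i \<in> DD n then s i else 0)" if "m \<le> n" for m n s
    by (rule dep) (use that in \<open>auto simp: DD_def\<close>)
  have BM: "B n \<in> sets M" for n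
  proof -
    define F where "F = {s. (\<forall>i. s i \<le> k i) \<and> (\<forall>i. i \<notin> DD n \<longrightarrow> s i = 0)}"
    have "F \<subseteq> {f. \<forall>x. (x \<in> DD n \<longrightarrow> f x \<in> {..Max (k ` DD n)}) \<and> (x \<notin> DD n \<longrightarrow> f x = 0)}"
      using finDD[of n] unfolding F_def by (auto intro: order_trans[OF _ Max_ge])
    then have "finite F"
      by (rule finite_subset) (intro finite_set_of_finite_funs finDD, simp)
    moreover have "B n = (\<Union>s\<in>F. \<Inter>m\<in>{..n}. A m s)"
    proof
      show "B n \<subseteq> (\<Union>s\<in>F. \<Inter>m\<in>{..n}. A m s)"
      proof
        fix z assume "z \<in> B n"
        then obtain s where s: "\<forall>i. s i \<le> k i" "\<forall>m\<le>n. z \<in> A m s" by (auto simp: B_def)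
        let ?s = "\<lambda>i. if i \<in> DD n then s i else 0"
        have "?s \<in> F" "\<forall>m\<le>n. z \<in> A m ?s" using s depDD[of _ n s] by (auto simp: F_def)
        then show "z \<in> (\<Union>s\<in>F. \<Inter>m\<in>{..n}. A m s)" by blast
      qed
      show "(\<Union>s\<in>F. \<Inter>m\<in>{..n}. A m s) \<subseteq> B n" by (auto simp: B_def F_def)
    qed
    ultimately show ?thesis using AM by (auto intro!: sets.finite_UN sets.finite_INT)
  qed
  \<comment> \<open>Outer measure need not be continuous along decreasing sequences, so the estimate
    is transferred from \<open>Sk d k\<close> to the measurable set \<open>B n\<close> before any
    intersection is taken; \<open>d\<close> exceeds all coordinates that stage n reads.\<close>
  have BS: "?\<mu> S \<le> emeasure M (B n) + ennreal e" for n
  proof -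
    obtain d where d: "\<And>i. i \<in> DD n \<Longrightarrow> i < d" using finDD[of n] by (auto simp: finite_nat_set_iff_bounded)
    have "Sk d k \<subseteq> B n"
    proof
      fix z assume "z \<in> Sk d k"
      then obtain s where s: "\<forall>i<d. s i \<le> k i" "\<forall>m. z \<in> A m s" by (auto simp: Sk_def)
      let ?s = "\<lambda>i. if i \<in> DD n then s i else 0"
      have "\<forall>i. ?s i \<le> k i" "\<forall>m\<le>n. z \<in> A m ?s" using s depDD[of _ n s] d by auto
      then show "z \<in> B n" unfolding B_def by (intro CollectI exI[of _ ?s] conjI)
    qed
    then have "?\<mu> (Sk d k) \<le> emeasure M (B n)"
      using outer_measure_of_mono[of "Sk d k" "B n" M] BM by simp
    then show ?thesis using Pk[of d] by (meson add_right_mono order_trans)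
  qed
  have "(\<Inter>n. B n) \<subseteq> S"
  proof
    fix z assume z: "z \<in> (\<Inter>n. B n)"
    then have "\<forall>n. \<exists>s. (\<forall>i. s i \<le> k i) \<and> (\<forall>m\<le>n. z \<in> A m s)" by (auto simp: B_def)
    from this[THEN choice] obtain t where t: "\<And>n i. t n i \<le> k i" "\<And>n m. m \<le> n \<Longrightarrow> z \<in> A m (t n)"
      by blast
    from bounded_sequences_compact[of t k, OF t(1)] obtain s where
      s: "\<forall>n m. \<exists>N\<ge>m. \<forall>i<n. t N i = s i" by (elim exE conjE)
    \<comment> \<open>A single condition reads finitely many coordinates, on which the cluster point
      agrees with some \<open>t N\<close> that already satisfies stage m.\<close>
    have "z \<in> A m s" for m
    proof -
      obtain d where d: "\<And>i. i \<in> D m \<Longrightarrow> i < d" using fin[of m] by (auto simp: finite_nat_set_iff_bounded)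
      obtain N where "N \<ge> m" "\<forall>i<d. t N i = s i" using s by blast
      then have "A m (t N) = A m s" using d by (intro dep) auto
      then show ?thesis using t(2)[OF \<open>N \<ge> m\<close>] by simp
    qed
    then show "z \<in> S" unfolding S by (intro CollectI exI[of _ s] allI)
  qed
  moreover have "?\<mu> S \<le> emeasure M (\<Inter>n. B n) + ennreal e"
  proof -
    have dec: "decseq B" unfolding decseq_def B_def by (blast intro: order_trans)
    have "emeasure M (\<Inter>n. B n) = (INF n. emeasure M (B n))"
      by (rule INF_emeasure_decseq[symmetric]) (use BM dec in auto)
    moreover have "?\<mu> S \<le> (INF n. emeasure M (B n) + ennreal e)" by (rule INF_greatest) (rule BS)
    moreover have "(INF n. emeasure M (B n) + ennreal e) = (INF n. emeasure M (B n)) + ennreal e"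
      by (rule INF_ennreal_add_const)
    ultimately show ?thesis by simp
  qed
  moreover have "(\<Inter>n. B n) \<in> sets M" using BM by auto
  ultimately show ?thesis by blast
qed

text \<open>The inner approximations exhaust the outer measure of \<open>S\<close>, which is the
  measure of a measurable hull \<open>H\<close>; the finite measure of \<open>H\<close> then forces
  the gap between them to be null.\<close>

theorem suslin_measurable:
  assumes "prob_space M" and sus: "suslin (sets M) S"
  obtains B N where "B \<in> sets M" "N \<in> null_sets M" "B \<subseteq> S" "S \<subseteq> B \<union> N"
proof -
  interpret prob_space M by fact
  have SM: "S \<subseteq> space M" using sus sets.sets_into_space unfolding suslin_def by blast
  have "\<forall>n. \<exists>B\<in>sets M. B \<subseteq> S \<and> outer_measure_of M S \<le> emeasure M B + ennreal (1 / Suc n)"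
    by (intro allI suslin_approx assms) simp
  then obtain B where B: "\<And>n. B n \<in> sets M" "\<And>n. B n \<subseteq> S"
      "\<And>n. outer_measure_of M S \<le> emeasure M (B n) + ennreal (1 / Suc n)" by metis
  obtain H where H: "H \<in> sets M" "S \<subseteq> H" "outer_measure_of M S = emeasure M H"
    using outer_measure_of_attain[OF SM] by blast
  let ?B = "\<Union>n. B n"
  have BM: "?B \<in> sets M" using B by auto
  have "emeasure M H \<le> emeasure M ?B"
  proof (rule ennreal_le_epsilon)
    fix e :: real assume "e > 0"
    then obtain n where n: "1 / Suc n < e" using nat_approx_posE by blast
    have "emeasure M H \<le> emeasure M (B n) + ennreal (1 / Suc n)" using B(3) H by simp
    also have "\<dots> \<le> emeasure M ?B + ennreal e"
      using n BM by (intro add_mono emeasure_mono ennreal_leI) auto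
    finally show "emeasure M H \<le> emeasure M ?B + ennreal e" .
  qed
  then have "H - ?B \<in> null_sets M"
    using emeasure_Diff[of M ?B H] H B BM diff_eq_0_iff_ennreal[of "emeasure M H" "emeasure M ?B"]
    by (intro null_setsI) (auto simp: less_top[symmetric])
  moreover have "?B \<subseteq> S" "S \<subseteq> ?B \<union> (H - ?B)" using B H by auto
  ultimately show thesis using that BM by blast
qed


section \<open>Projections along a Polish factor\<close>

text \<open>Suslin sets are not closed under complements, so the induction over the generated
  sigma-algebra runs through \<open>G\<close>, the sets that are Suslin together with their
  complement. Closed second factors are kept for the later completeness argument; open sets enter as
  countable unions of closed ones.\<close>

lemma suslin_pair_measure:
  assumes T: "topspace T = space M" "metrizable_space T"
      "sets M = sigma_sets (space M) {U. openin T U}"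
    and N: "N \<in> sets (M \<Otimes>\<^sub>M M)"
  shows "suslin {A \<times> C |A C. A \<in> sets M \<and> closedin T C} N"
proof -
  let ?E = "{A \<times> C |A C. A \<in> sets M \<and> closedin T C}" and ?\<Omega> = "space M \<times> space M"
  define G where "G N \<longleftrightarrow> N \<subseteq> ?\<Omega> \<and> suslin ?E N \<and> suslin ?E (?\<Omega> - N)" for N
  have clsp: "closedin T (space M)" using T(1) closedin_topspace[of T] by simp
  have \<Omega>: "?\<Omega> \<in> ?E" using clsp by blast
  have E0: "suslin ?E {}" by (rule suslin_basic) auto
  have G0: "G {}" using E0 suslin_basic[OF \<Omega>] by (simp add: G_def)
  have GC: "G (?\<Omega> - N)" if "G N" for N
    using that by (auto simp: G_def double_diff)
  have GU: "G (\<Union>i. N i)" if "\<And>i::nat. G (N i)" for N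
  proof -
    have "suslin ?E (\<Union>i. N i)" by (rule suslin_UN[OF _ \<Omega>]) (use that in \<open>auto simp: G_def\<close>)
    moreover have "suslin ?E (\<Inter>i. ?\<Omega> - N i)" by (rule suslin_INT) (use that in \<open>auto simp: G_def\<close>)
    moreover have "(\<Inter>i. ?\<Omega> - N i) = ?\<Omega> - (\<Union>i. N i)" by auto
    ultimately show ?thesis using that by (auto simp: G_def)
  qed
  have GD: "G (N - N')" if "G N" "G N'" for N N'
  proof -
    have "G (\<Union>i::nat. if i = 0 then ?\<Omega> - N else N')" by (rule GU) (use that GC in auto)
    moreover have "?\<Omega> - (\<Union>i::nat. if i = 0 then ?\<Omega> - N else N') = N - N'"
      using that by (auto simp: G_def split: if_splits)
    ultimately show ?thesis using GC by fastforce
  qed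
  have rect: "G (A \<times> B)" if A: "A \<in> sets M" and B: "B \<in> sets M" for A B
    using B[unfolded T(3)]
  proof (induction rule: sigma_sets.induct)
    case (Basic U)
    then have U: "openin T U" by simp
    have AS: "A \<subseteq> space M" and US: "U \<subseteq> space M"
      using A sets.sets_into_space openin_subset[OF U] T(1) by auto
    obtain C where C: "\<And>n::nat. closedin T (C n)" "U = (\<Union>n. C n)"
      using open_imp_fsigma_in[OF T(2) U] unfolding fsigma_in_ascending by metis
    have "suslin ?E (\<Union>n. A \<times> C n)"
    proof (rule suslin_UN[OF _ \<Omega>])
      show "suslin ?E (A \<times> C n)" for n by (rule suslin_basic) (use A C in blast)
      show "A \<times> C n \<subseteq> ?\<Omega>" for n using AS US C(2) by blast
    qed
    moreover have "A \<times> U = (\<Union>n. A \<times> C n)" using C(2) by auto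
    ultimately have 1: "suslin ?E (A \<times> U)" by simp
    have "suslin ?E (((space M - A) \<times> space M) \<union> (space M \<times> (space M - U)))"
    proof (rule suslin_Un[OF suslin_basic suslin_basic \<Omega>])
      have "closedin T (space M - U)" using U T(1) by (metis openin_closedin_eq)
      then show "space M \<times> (space M - U) \<in> ?E" by blast
      show "(space M - A) \<times> space M \<in> ?E" using A clsp by blast
    qed auto
    moreover have "((space M - A) \<times> space M) \<union> (space M \<times> (space M - U)) = ?\<Omega> - A \<times> U" by auto
    ultimately show ?case using 1 AS US by (auto simp: G_def)
  next
    case Empty
    then show ?case using G0 by simp
  next
    case (Compl a)
    have "suslin ?E (A \<times> space M)" by (rule suslin_basic) (use A clsp in blast)
    moreover have "suslin ?E (?\<Omega> - A \<times> space M)"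
    proof -
      have "?\<Omega> - A \<times> space M = (space M - A) \<times> space M" by auto
      moreover have "suslin ?E ((space M - A) \<times> space M)" by (rule suslin_basic) (use A clsp in blast)
      ultimately show ?thesis by simp
    qed
    ultimately have "G (A \<times> space M)" using A[THEN sets.sets_into_space] by (auto simp: G_def)
    then have "G (A \<times> space M - A \<times> a)" using Compl GD by blast
    moreover have "A \<times> space M - A \<times> a = A \<times> (space M - a)" by auto
    ultimately show ?case by simp
  next
    case (Union a)
    then have "G (\<Union>i. A \<times> a i)" by (intro GU)
    moreover have "A \<times> (\<Union>i. a i) = (\<Union>i. A \<times> a i)" by auto
    ultimately show ?case by simp
  qed
  have "G N" using N[unfolded sets_pair_measure]
  proof (induction rule: sigma_sets.induct)
    case (Basic a) then show ?case using rect by auto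
  next
    case Empty then show ?case by (rule G0)
  next
    case (Compl a) then show ?case using GC by simp
  next
    case (Union a) then show ?case using GU by simp
  qed
  then show ?thesis by (simp add: G_def)
qed

text \<open>The second coordinate \<open>y\<close> is coded by a sequence \<open>u\<close> of points \<open>q (u m)\<close> of a dense set
  at distance at most \<open>1 / (m + 1)\<close> from \<open>y\<close>; by completeness a sequence codes a point as soon
  as all its finite stages are consistent.\<close>

lemma suslin_projection:
  assumes T: "topspace T = space M" "completely_metrizable_space T" "separable_space T"
    and ne: "space M \<noteq> {}"
    and N: "suslin {A \<times> C |A C. A \<in> sets M \<and> closedin T C} N"
  shows "suslin (sets M) (fst ` N)"
proof -
  obtain X d where "Metric_space X d" and cpl: "Metric_space.mcomplete X d"
    and TX: "T = Metric_space.mtopology X d"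
    using T(2) unfolding completely_metrizable_space_def by blast
  interpret Metric_space X d by fact
  have X: "X = space M" using T(1) TX by simp
  obtain Q where Q: "countable Q" "Q \<subseteq> X" "mtopology closure_of Q = X"
    using T(3) TX unfolding separable_space_def by auto
  have "Q \<noteq> {}" using Q(3) ne X by auto
  define q where "q = from_nat_into Q"
  have q: "\<exists>n. d (q n) y \<le> e" if y: "y \<in> X" and e: "e > 0" for y e
  proof -
    have "y \<in> mtopology closure_of Q" using Q(3) y by simp
    then obtain z where "z \<in> Q" "z \<in> mball y e" using e by (auto simp: metric_closure_of)
    moreover obtain n where "z = q n"
      using from_nat_into_surj[OF Q(1) \<open>z \<in> Q\<close>] unfolding q_def by metis
    ultimately show ?thesis by (auto simp: commute intro!: exI[of _ n])
  qed
  have qX: "q n \<in> X" for n using from_nat_into[OF \<open>Q \<noteq> {}\<close>] Q(2) by (auto simp: q_def)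
  define \<E> where "\<E> = {A \<times> C |A C. A \<in> sets M \<and> closedin T C}"
  have "\<forall>E\<in>\<E>. \<exists>P. fst P \<in> sets M \<and> closedin T (snd P) \<and> E = fst P \<times> snd P" by (auto simp: \<E>_def)
  from this[THEN bchoice] obtain P where
    "\<forall>E\<in>\<E>. fst (P E) \<in> sets M \<and> closedin T (snd (P E)) \<and> E = fst (P E) \<times> snd (P E)" ..
  note P = bspec[OF this]
  from N[folded \<E>_def] obtain A :: "nat \<Rightarrow> (nat \<Rightarrow> nat) \<Rightarrow> ('a \<times> 'a) set" and D where
      AE: "\<And>n s. A n s \<in> \<E>" and fin: "\<And>n. finite (D n)"
      and dep: "\<And>n s s'. (\<forall>j\<in>D n. s j = s' j) \<Longrightarrow> A n s = A n s'"
      and N: "N = {z. \<exists>s. \<forall>n. z \<in> A n s}" unfolding suslin_def by blast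
  define a where "a n s = fst (P (A n s))" for n s
  define c where "c n s = snd (P (A n s))" for n s
  have a: "a n s \<in> sets M" and c: "closedin mtopology (c n s)" and Aac: "A n s = a n s \<times> c n s" for n s
    using P[OF AE[of n s]] unfolding a_def c_def TX by blast+
  define K where "K n s u = (\<Inter>m\<le>n. c m s \<inter> mcball (q (u m)) (1 / Suc m))"
    for n s and u :: "nat \<Rightarrow> nat"
  \<comment> \<open>Even coordinates of \<open>v\<close> hold the code of the Suslin scheme and odd
    ones the code of the point to be projected away. Nonemptiness of \<open>K\<close> does not
    involve the first coordinate, so \<open>A' n v\<close> is a measurable set or empty.\<close>
  define A' where "A' n v = (if K n (\<lambda>j. v (2 * j)) (\<lambda>j. v (Suc (2 * j))) \<noteq> {}
      then a n (\<lambda>j. v (2 * j)) else {})" for n and v :: "nat \<Rightarrow> nat"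
  define D' where "D' n = (\<Union>m\<le>n. (\<lambda>j. 2 * j) ` D m) \<union> (\<lambda>j. Suc (2 * j)) ` {..n}" for n
  have "fst ` N = {z. \<exists>v. \<forall>n. z \<in> A' n v}" (is "?L = ?R")
  proof
    show "?L \<subseteq> ?R"
    proof clarify
      fix x y assume "(x, y) \<in> N"
      then obtain s where s: "\<And>n. x \<in> a n s" "\<And>n. y \<in> c n s" unfolding N Aac by auto
      have y: "y \<in> X" using s(2)[of 0] c[of 0 s, THEN closedin_subset] by auto
      have "\<forall>m. \<exists>n. d (q n) y \<le> 1 / Suc m" using q[OF y] by simp
      from this[THEN choice] obtain u where u: "\<And>m. d (q (u m)) y \<le> 1 / Suc m" by blast
      define v where "v i = (if even i then s (i div 2) else u (i div 2))" for i
      have v: "(\<lambda>j. v (2 * j)) = s" "(\<lambda>j. v (Suc (2 * j))) = u" by (auto simp: v_def)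
      have "y \<in> K n s u" for n using s(2) u y qX by (auto simp: K_def)
      then have "x \<in> A' n v" for n using s(1) by (auto simp: A'_def v)
      then show "\<exists>v. \<forall>n. fst (x, y) \<in> A' n v" by auto
    qed
    show "?R \<subseteq> ?L"
    proof
      fix x assume "x \<in> ?R"
      then obtain v where v: "\<And>n. x \<in> A' n v" by blast
      define s where "s = (\<lambda>j. v (2 * j))"
      define u where "u = (\<lambda>j. v (Suc (2 * j)))"
      have xa: "x \<in> a n s" and ne: "K n s u \<noteq> {}" for n
        using v[of n] by (auto simp: A'_def s_def u_def split: if_splits)
      \<comment> \<open>Cantor's intersection theorem: the sets are closed, nonempty and decreasing,
        and the balls of radius \<open>1 / Suc n\<close> shrink, so a common point exists and serves
        as second coordinate.\<close>
      have "\<Inter> (range (\<lambda>n. K n s u)) \<noteq> {}"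
      proof (rule mcomplete_nest[THEN iffD1, rule_format, OF cpl], intro conjI allI impI)
        show "closedin mtopology (K n s u)" for n
          unfolding K_def by (intro closedin_INT closedin_Int c closedin_mcball) auto
        show "K n s u \<noteq> {}" for n by (rule ne)
        show "decseq (\<lambda>n. K n s u)" unfolding decseq_def K_def by (auto intro: order_trans)
        fix e :: real assume "e > 0"
        then obtain n where n: "1 / Suc n < e" using nat_approx_posE by blast
        have "K n s u \<subseteq> mcball (q (u n)) (1 / Suc n)" by (auto simp: K_def)
        also have "\<dots> \<subseteq> mcball (q (u n)) e" using n by (intro mcball_subset_concentric) auto
        finally show "\<exists>n a. K n s u \<subseteq> mcball a e" by blast
      qed
      then obtain y where "\<And>n. y \<in> K n s u" by blast
      then have "y \<in> c n s" for n by (auto simp: K_def)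
      then have "(x, y) \<in> N" using xa unfolding N Aac by auto
      then show "x \<in> fst ` N" by force
    qed
  qed
  moreover have "\<forall>n v. A' n v \<in> sets M" "\<forall>n. finite (D' n)"
    using a by (auto simp: A'_def D'_def fin)
  moreover have "A' n v = A' n v'" if "\<forall>i\<in>D' n. v i = v' i" for n v v'
  proof -
    have A: "A m (\<lambda>j. v (2 * j)) = A m (\<lambda>j. v' (2 * j))" if "m \<le> n" for m
      by (rule dep) (use \<open>\<forall>i\<in>D' n. v i = v' i\<close> that in \<open>auto simp: D'_def\<close>)
    then have "K n (\<lambda>j. v (2 * j)) (\<lambda>j. v (Suc (2 * j))) = K n (\<lambda>j. v' (2 * j)) (\<lambda>j. v' (Suc (2 * j)))"
      unfolding K_def using that by (intro INF_cong) (auto simp: c_def D'_def)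
    then show ?thesis using A[of n] by (simp add: A'_def a_def)
  qed
  ultimately show ?thesis unfolding suslin_def by blast
qed

theorem measurable_projection:
  assumes "prob_space M" "standard_borel M" "N \<in> sets (M \<Otimes>\<^sub>M M)"
  obtains B Z where "B \<in> sets M" "Z \<in> null_sets M" "B \<subseteq> fst ` N" "fst ` N \<subseteq> B \<union> Z"
proof -
  obtain T where T: "topspace T = space M" "completely_metrizable_space T" "separable_space T"
      "sets M = sigma_sets (space M) {U. openin T U}"
    using assms(2) unfolding standard_borel_def by blast
  have "suslin (sets M) (fst ` N)"
    by (rule suslin_projection[OF T(1-3) prob_space.not_empty[OF assms(1)]
          suslin_pair_measure[OF T(1) completely_metrizable_imp_metrizable_space[OF T(2)] T(4) assms(3)]])
  then show thesis by (rule suslin_measurable[OF assms(1)]) (rule that)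
qed

text \<open>Two distinct points are separated by a ball with rational radius and centre in a
  countable dense set; so the complement of the diagonal is a countable union of rectangles.\<close>

lemma diagonal_measurable:
  assumes "standard_borel M"
  shows "Id_on (space M) \<in> sets (M \<Otimes>\<^sub>M M)"
proof -
  obtain T where T: "topspace T = space M" "completely_metrizable_space T" "separable_space T"
      "sets M = sigma_sets (space M) {U. openin T U}"
    using assms unfolding standard_borel_def by blast
  obtain X d where "Metric_space X d" and TX: "T = Metric_space.mtopology X d"
    using T(2) unfolding completely_metrizable_space_def by blast
  interpret Metric_space X d by fact
  have X: "X = space M" using T(1) TX by simp
  obtain Q where Q: "countable Q" "Q \<subseteq> X" "mtopology closure_of Q = X"
    using T(3) TX unfolding separable_space_def by auto
  have b: "mball x r \<in> sets M" for x r
    unfolding T(4) TX by (rule sigma_sets.Basic) simp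
  have "(space M \<times> space M) - Id_on (space M) =
      (\<Union>q\<in>Q. \<Union>r\<in>\<rat>. mball q r \<times> (space M - mball q r))" (is "?L = ?R")
  proof
    show "?L \<subseteq> ?R"
    proof clarify
      fix x y assume xy: "x \<in> space M" "y \<in> space M" "(x, y) \<notin> Id_on (space M)"
      then have p: "d x y > 0" using X by (auto simp: Id_on_def)
      have "x \<in> mtopology closure_of Q" using Q(3) xy X by simp
      then obtain z where z: "z \<in> Q" "z \<in> mball x (d x y / 2)" using p
        by (auto simp: metric_closure_of dest!: spec[of _ "d x y / 2"])
      then have zx: "d z x < d x y / 2" by (simp add: commute)
      obtain r where r: "r \<in> \<rat>" "d z x < r" "r < d x y / 2" using Rats_dense_in_real[OF zx] by blast
      have "d x y \<le> d z x + d z y" using triangle[of x z y] xy z Q X by (auto simp: commute)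
      then have "d z y \<ge> r" using zx r by linarith
      then have "x \<in> mball z r" "y \<notin> mball z r" using r z(2) by auto
      then show "(x, y) \<in> ?R" using r(1) z(1) xy by blast
    qed
    show "?R \<subseteq> ?L"
    proof clarify
      fix q r x y assume "x \<in> mball q r" "y \<in> space M" "y \<notin> mball q r"
      then show "(x, y) \<in> ?L" unfolding X[symmetric] by auto
    qed
  qed
  moreover have "?R \<in> sets (M \<Otimes>\<^sub>M M)"
    using Q(1) b by (intro sets.countable_UN'' countable_rat pair_measureI sets.Diff) auto
  ultimately have "(space M \<times> space M) - ((space M \<times> space M) - Id_on (space M)) \<in> sets (M \<Otimes>\<^sub>M M)"
    by (metis sets.compl_sets space_pair_measure)
  moreover have "(space M \<times> space M) - ((space M \<times> space M) - Id_on (space M)) = Id_on (space M)" by auto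
  ultimately show ?thesis by simp
qed


subsection \<open>Measurable subrelations of a countable measure-preserving relation\<close>

text \<open>These are the graphs of partial injections. Staying with relations makes restriction,
  inversion and composition plain set operations, with no bookkeeping of domains.\<close>

definition bisv :: "'a rel \<Rightarrow> bool" where
  "bisv E \<longleftrightarrow> single_valued E \<and> single_valued (E\<inverse>)"

lemma bisvI:
  assumes "\<And>x y z. (x, y) \<in> E \<Longrightarrow> (x, z) \<in> E \<Longrightarrow> y = z"
    and "\<And>x y z. (x, z) \<in> E \<Longrightarrow> (y, z) \<in> E \<Longrightarrow> x = y"
  shows "bisv E"
  using assms unfolding bisv_def single_valued_def by blast

lemma bisv_right: "bisv E \<Longrightarrow> (x, y) \<in> E \<Longrightarrow> (x, z) \<in> E \<Longrightarrow> y = z"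
  and bisv_left: "bisv E \<Longrightarrow> (x, z) \<in> E \<Longrightarrow> (y, z) \<in> E \<Longrightarrow> x = y"
  unfolding bisv_def single_valued_def by blast+

lemma bisv_subset: "bisv E \<Longrightarrow> F \<subseteq> E \<Longrightarrow> bisv F"
  unfolding bisv_def single_valued_def by blast

lemma bisv_converse: "bisv E \<Longrightarrow> bisv (E\<inverse>)"
  unfolding bisv_def by simp

lemma bisv_relcomp: "bisv E \<Longrightarrow> bisv F \<Longrightarrow> bisv (E O F)"
  unfolding bisv_def by (simp add: single_valued_relcomp converse_relcomp)

lemma bisv_UN:
  assumes "\<And>i. i \<in> I \<Longrightarrow> bisv (E i)"
    and "\<And>i j. i \<in> I \<Longrightarrow> j \<in> I \<Longrightarrow> i \<noteq> j \<Longrightarrow> Domain (E i) \<inter> Domain (E j) = {}"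
    and "\<And>i j. i \<in> I \<Longrightarrow> j \<in> I \<Longrightarrow> i \<noteq> j \<Longrightarrow> Range (E i) \<inter> Range (E j) = {}"
  shows "bisv (\<Union>i\<in>I. E i)"
proof (rule bisvI)
  fix x y z assume "(x, y) \<in> (\<Union>i\<in>I. E i)" "(x, z) \<in> (\<Union>i\<in>I. E i)"
  then obtain i j where ij: "i \<in> I" "j \<in> I" "(x, y) \<in> E i" "(x, z) \<in> E j" by blast
  then have "i = j" using assms(2)[of i j] by blast
  then show "y = z" using ij assms(1) bisv_right by metis
next
  fix x y z assume "(x, z) \<in> (\<Union>i\<in>I. E i)" "(y, z) \<in> (\<Union>i\<in>I. E i)"
  then obtain i j where ij: "i \<in> I" "j \<in> I" "(x, z) \<in> E i" "(y, z) \<in> E j" by blast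
  then have "i = j" using assms(3)[of i j] by blast
  then show "x = y" using ij assms(1) bisv_left by metis
qed

lemma single_valued_function_measurable:
  assumes sp: "E \<subseteq> space M \<times> space M" and f: "\<And>x y. (x, y) \<in> E \<Longrightarrow> f x = y"
    and pre: "\<And>C. C \<in> sets M \<Longrightarrow> E\<inverse> `` C \<in> sets M" and B: "Range E \<in> sets M"
  shows "f \<in> restrict_space M (Domain E) \<rightarrow>\<^sub>M restrict_space M (Range E)"
proof (rule measurableI)
  have "Domain E = E\<inverse> `` space M" using sp by blast
  then have A: "Domain E \<in> sets M" using pre[OF sets.top] by simp
  show "f x \<in> space (restrict_space M (Range E))" if "x \<in> space (restrict_space M (Domain E))" for x
    using that f sets.sets_into_space[OF B] by (force simp: space_restrict_space)
  fix C assume C: "C \<in> sets (restrict_space M (Range E))"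
  then have "C \<in> sets M" using B by (simp add: sets_restrict_space_iff)
  then have "E\<inverse> `` C \<in> sets M" by (rule pre)
  moreover have "f -` C \<inter> space (restrict_space M (Domain E)) = E\<inverse> `` C"
    using f sp by (auto simp: space_restrict_space)
  moreover have "E\<inverse> `` C \<subseteq> Domain E" by blast
  ultimately show "f -` C \<inter> space (restrict_space M (Domain E)) \<in> sets (restrict_space M (Domain E))"
    using A by (simp add: sets_restrict_space_iff)
qed

text \<open>This is the passage from relations back to functions: the conditions on images and
  preimages of measurable sets become measurability of the inverse map and of the map.\<close>

lemma partial_automorphismI:
  assumes b: "bisv E" and R: "E \<subseteq> R" and sp: "E \<subseteq> space M \<times> space M"
    and im: "\<And>C. C \<in> sets M \<Longrightarrow> E `` C \<in> sets M" and pre: "\<And>C. C \<in> sets M \<Longrightarrow> E\<inverse> `` C \<in> sets M"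
  shows "partial_automorphism M R E"
proof -
  have "Domain E = E\<inverse> `` space M" "Range E = E `` space M" using sp by blast+
  then have DR: "Domain E \<in> sets M" "Range E \<in> sets M" using pre[OF sets.top] im[OF sets.top] by simp_all
  define f where "f x = (THE y. (x, y) \<in> E)" for x
  have f: "f x = y" if "(x, y) \<in> E" for x y
    unfolding f_def by (rule the_equality) (use that bisv_right[OF b] in blast)+
  have fE: "(x, f x) \<in> E" if "x \<in> Domain E" for x using that f by blast
  have bij: "bij_betw f (Domain E) (Range E)"
  proof (rule bij_betw_imageI)
    show "inj_on f (Domain E)" using fE bisv_left[OF b] by (metis inj_onI)
    show "f ` Domain E = Range E" using fE f by blast
  qed
  have inv: "the_inv_into (Domain E) f y = x" if "(x, y) \<in> E" for x y
    using the_inv_into_f_f[of f "Domain E" x] bij f[OF that] that by (auto simp: bij_betw_def)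
  have "f \<in> restrict_space M (Domain E) \<rightarrow>\<^sub>M restrict_space M (Range E)"
    by (rule single_valued_function_measurable[OF sp f pre DR(2)])
  moreover have "the_inv_into (Domain E) f \<in> restrict_space M (Range E) \<rightarrow>\<^sub>M restrict_space M (Domain E)"
    using single_valued_function_measurable[of "E\<inverse>" M "the_inv_into (Domain E) f"] inv im sp DR by auto
  moreover have "E = (\<lambda>x. (x, f x)) ` Domain E" using fE f by auto
  ultimately show ?thesis
    unfolding partial_automorphism_def using DR bij R by blast
qed

section \<open>Calculus of measurable subrelations on a conull invariant set\<close>

text \<open>The maps \<open>G k\<close> enumerate each class in the invariant set \<open>X0\<close>,
  possibly with repetitions, and so do the work of the Luzin-Novikov theorem. Standardness of the
  space enters through \<open>diag\<close>.\<close>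

locale countable_pmp_relation = prob_space M for M :: "'a measure" +
  fixes R :: "'a rel" and X0 :: "'a set" and G :: "nat \<Rightarrow> 'a \<Rightarrow> 'a"
  assumes diag: "Id_on (space M) \<in> sets (M \<Otimes>\<^sub>M M)"
    and equiv: "equiv (space M) R"
    and R_meas: "R \<in> sets (M \<Otimes>\<^sub>M M)"
    and saturation_null: "\<And>N. N \<in> null_sets M \<Longrightarrow> R `` N \<in> null_sets M"
    and II1: "type_II1 M R"
    and ergodic: "ergodic M R"
    and nonatomic: "nonatomic M"
    and X0: "X0 \<in> sets M" "emeasure M X0 = 1" "R `` X0 \<subseteq> X0"
    and G_meas: "\<And>k. G k \<in> M \<rightarrow>\<^sub>M M"
    and G_class: "\<And>x. x \<in> X0 \<Longrightarrow> R `` {x} = range (\<lambda>k. G k x)"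
begin

lemma R_sym: "(x, y) \<in> R \<Longrightarrow> (y, x) \<in> R"
proof -
  have "sym R" using equiv by (rule equivE)
  then show "(x, y) \<in> R \<Longrightarrow> (y, x) \<in> R" by (rule symD)
qed

lemma R_trans: "(x, y) \<in> R \<Longrightarrow> (y, z) \<in> R \<Longrightarrow> (x, z) \<in> R"
proof -
  have "trans R" using equiv by (rule equivE)
  then show "(x, y) \<in> R \<Longrightarrow> (y, z) \<in> R \<Longrightarrow> (x, z) \<in> R" by (rule transD)
qed

lemma R_refl: "x \<in> space M \<Longrightarrow> (x, x) \<in> R"
  using equiv_class_self[OF equiv] by simp

lemma R_space: "(x, y) \<in> R \<Longrightarrow> x \<in> space M \<and> y \<in> space M"
  using equiv_type[OF equiv] by blast

lemma X0_space: "X0 \<subseteq> space M" using X0(1) sets.sets_into_space by blast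

definition R0 :: "'a rel" where "R0 = R \<inter> X0 \<times> X0"

text \<open>Everything is confined to \<open>R0\<close>, since outside \<open>X0\<close> the classes
  come without a measurable enumeration.\<close>

definition mrel :: "'a rel \<Rightarrow> bool" where
  "mrel E \<longleftrightarrow> E \<in> sets (M \<Otimes>\<^sub>M M) \<and> E \<subseteq> R0"

lemma R0_R: "(x, y) \<in> R0 \<Longrightarrow> (x, y) \<in> R"
  unfolding R0_def by simp

lemma R0_X0: "(x, y) \<in> R0 \<Longrightarrow> x \<in> X0 \<and> y \<in> X0"
  unfolding R0_def by simp

lemma R0_sym: "(x, y) \<in> R0 \<Longrightarrow> (y, x) \<in> R0"
  unfolding R0_def using R_sym by simp

lemma R0_trans: "(x, y) \<in> R0 \<Longrightarrow> (y, z) \<in> R0 \<Longrightarrow> (x, z) \<in> R0"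
  unfolding R0_def using R_trans[of x y z] by simp

lemma R0_refl: "x \<in> X0 \<Longrightarrow> (x, x) \<in> R0"
  unfolding R0_def using R_refl[of x] X0_space by auto

lemma R_R0: "(x, y) \<in> R \<Longrightarrow> x \<in> X0 \<Longrightarrow> (x, y) \<in> R0"
  using X0(3) unfolding R0_def by blast

lemma R0_G: "(x, y) \<in> R0 \<longleftrightarrow> x \<in> X0 \<and> (\<exists>k. y = G k x)"
proof -
  have "(x, y) \<in> R0 \<longleftrightarrow> x \<in> X0 \<and> y \<in> R `` {x}" using R_R0 R0_R R0_X0 by blast
  also have "\<dots> \<longleftrightarrow> x \<in> X0 \<and> (\<exists>k. y = G k x)" using G_class[of x] by auto
  finally show ?thesis .
qed

lemma mrel_sets: "mrel E \<Longrightarrow> E \<in> sets (M \<Otimes>\<^sub>M M)"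
  and mrel_R0: "mrel E \<Longrightarrow> (x, y) \<in> E \<Longrightarrow> (x, y) \<in> R0"
  and mrel_sub: "mrel E \<Longrightarrow> E \<subseteq> R0"
  unfolding mrel_def by auto

lemma mrel_X0: "mrel E \<Longrightarrow> (x, y) \<in> E \<Longrightarrow> x \<in> X0 \<and> y \<in> X0"
  using mrel_R0 R0_X0 by blast

lemma mrel_all: "mrel R0"
  unfolding mrel_def R0_def using R_meas X0 by auto

lemma mrel_empty: "mrel {}" unfolding mrel_def by simp

lemma mrel_Un: "mrel E \<Longrightarrow> mrel F \<Longrightarrow> mrel (E \<union> F)"
  and mrel_Int: "mrel E \<Longrightarrow> mrel F \<Longrightarrow> mrel (E \<inter> F)"
  and mrel_Diff: "mrel E \<Longrightarrow> mrel F \<Longrightarrow> mrel (E - F)"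
  unfolding mrel_def by auto

lemma mrel_UN: "countable I \<Longrightarrow> (\<And>i. i \<in> I \<Longrightarrow> mrel (E i)) \<Longrightarrow> mrel (\<Union>i\<in>I. E i)"
  unfolding mrel_def by (auto intro!: sets.countable_UN')

lemma mrel_rect: "mrel E \<Longrightarrow> A \<in> sets M \<Longrightarrow> B \<in> sets M \<Longrightarrow> mrel (E \<inter> A \<times> B)"
  unfolding mrel_def by auto

lemma mrel_graph:
  assumes h: "h \<in> M \<rightarrow>\<^sub>M M" shows "mrel {(x, y) \<in> R0. h x = y}"
proof -
  have f: "(\<lambda>p. (h (fst p), snd p)) \<in> M \<Otimes>\<^sub>M M \<rightarrow>\<^sub>M M \<Otimes>\<^sub>M M"
    using h by simp
  have sub: "R0 \<subseteq> space M \<times> space M" using R0_X0 X0_space by fast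
  have "{(x, y) \<in> R0. h x = y} =
    R0 \<inter> ((\<lambda>p. (h (fst p), snd p)) -` Id_on (space M) \<inter> space (M \<Otimes>\<^sub>M M))"
    using sub by (auto simp: space_pair_measure Id_on_def)
  then show ?thesis using measurable_sets[OF f diag] mrel_all unfolding mrel_def by auto
qed

lemma mrel_converse: "mrel E \<Longrightarrow> mrel (E\<inverse>)"
proof -
  assume E: "mrel E"
  have "E\<inverse> = (\<lambda>p. (snd p, fst p)) -` E \<inter> space (M \<Otimes>\<^sub>M M)"
    using mrel_X0[OF E] X0_space by (auto simp: space_pair_measure)
  also have "\<dots> \<in> sets (M \<Otimes>\<^sub>M M)"
    by (rule measurable_sets[OF _ mrel_sets[OF E]]) simp
  finally show "mrel (E\<inverse>)" using E R0_sym unfolding mrel_def by auto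
qed

text \<open>The intermediate point of a composite is \<open>G k x\<close> for some k, so the
  existential quantifier is a countable union of preimages under measurable maps.
  \<open>mrel_Domain\<close> rests on the same observation.\<close>

lemma mrel_relcomp:
  assumes E: "mrel E" and F: "mrel F"
  shows "mrel (E O F)"
proof -
  have 1: "(\<lambda>p. (fst p, G k (fst p))) \<in> M \<Otimes>\<^sub>M M \<rightarrow>\<^sub>M M \<Otimes>\<^sub>M M"
    and 2: "(\<lambda>p. (G k (fst p), snd p)) \<in> M \<Otimes>\<^sub>M M \<rightarrow>\<^sub>M M \<Otimes>\<^sub>M M" for k
    using G_meas by simp_all
  have "E O F = (\<Union>k. ((\<lambda>p. (fst p, G k (fst p))) -` E \<inter> space (M \<Otimes>\<^sub>M M))
      \<inter> ((\<lambda>p. (G k (fst p), snd p)) -` F \<inter> space (M \<Otimes>\<^sub>M M)))" (is "?L = ?R")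
  proof
    show "?L \<subseteq> ?R"
    proof clarify
      fix x y z assume xy: "(x, y) \<in> E" "(y, z) \<in> F"
      then obtain k where "y = G k x" using mrel_R0[OF E] R0_G by blast
      moreover have "x \<in> space M" "z \<in> space M"
        using xy mrel_X0[OF E] mrel_X0[OF F] X0_space by blast+
      ultimately show "(x, z) \<in> ?R" using xy by (auto simp: space_pair_measure)
    qed
  qed auto
  also have "\<dots> \<in> sets (M \<Otimes>\<^sub>M M)"
    using measurable_sets[OF 1 mrel_sets[OF E]] measurable_sets[OF 2 mrel_sets[OF F]] by blast
  finally show ?thesis
    using mrel_R0[OF E] mrel_R0[OF F] R0_trans unfolding mrel_def by blast
qed

lemma mrel_Domain:
  assumes E: "mrel E" shows "Domain E \<in> sets M"
proof -
  have 1: "(\<lambda>x. (x, G k x)) \<in> M \<rightarrow>\<^sub>M M \<Otimes>\<^sub>M M" for k using G_meas by simp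
  have "Domain E = (\<Union>k. (\<lambda>x. (x, G k x)) -` E \<inter> space M)"
  proof
    show "Domain E \<subseteq> (\<Union>k. (\<lambda>x. (x, G k x)) -` E \<inter> space M)"
    proof
      fix x assume "x \<in> Domain E"
      then obtain y where xy: "(x, y) \<in> E" by blast
      then obtain k where "y = G k x" using mrel_R0[OF E] R0_G by blast
      then show "x \<in> (\<Union>k. (\<lambda>x. (x, G k x)) -` E \<inter> space M)"
        using xy mrel_X0[OF E xy] X0_space by auto
    qed
  qed auto
  moreover have "\<dots> \<in> sets M" using measurable_sets[OF 1 mrel_sets[OF E]] by blast
  ultimately show ?thesis by (rule ssubst)
qed

lemma mrel_Range: "mrel E \<Longrightarrow> Range E \<in> sets M"
  using mrel_Domain[OF mrel_converse] by simp

lemma mrel_Image: "mrel E \<Longrightarrow> A \<in> sets M \<Longrightarrow> E `` A \<in> sets M"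
proof -
  assume E: "mrel E" and A: "A \<in> sets M"
  have "E `` A = Range (E \<inter> A \<times> space M)" using mrel_X0[OF E] X0_space by auto
  then show ?thesis using mrel_Range[OF mrel_rect[OF E A]] by simp
qed

lemma mrel_Id_on:
  assumes "A \<in> sets M" "A \<subseteq> X0" shows "mrel (Id_on A)"
proof -
  have "Id_on A = Id_on (space M) \<inter> A \<times> A" using assms X0_space by auto
  then show ?thesis using diag assms R0_refl unfolding mrel_def by auto
qed

lemma mrel_trancl:
  assumes E: "mrel E" shows "mrel (E\<^sup>+)"
proof -
  have "mrel (E ^^ Suc n)" for n
    by (induction n) (use E mrel_relcomp in auto)
  then have "mrel (\<Union>n. E ^^ Suc n)" by (intro mrel_UN) auto
  moreover have "(\<Union>n. E ^^ Suc n) = E\<^sup>+"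
    unfolding trancl_power[of _ E, symmetric] set_eq_iff
    by (auto simp: trancl_power simp del: relpow.simps) (metis Suc_pred)
  ultimately show ?thesis by simp
qed

lemma mrel_space: "mrel E \<Longrightarrow> E \<subseteq> space M \<times> space M"
  using mrel_sub[of E] R0_X0 X0_space by fast

lemma bisv_partial_automorphism:
  assumes E: "mrel E" and b: "bisv E"
  shows "partial_automorphism M R E"
proof (rule partial_automorphismI[OF b _ mrel_space[OF E]])
  show "E \<subseteq> R" using mrel_R0[OF E] R0_R by auto
qed (intro mrel_Image mrel_converse E, assumption)+

lemma bisv_measure:
  assumes E: "mrel E" and b: "bisv E"
  shows "emeasure M (Range E) = emeasure M (Domain E)"
proof -
  have "emeasure M (E `` Domain E) = emeasure M (Domain E)"
    using II1 bisv_partial_automorphism[OF assms] mrel_Domain[OF E] unfolding type_II1_def by blast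
  moreover have "E `` Domain E = Range E" by blast
  ultimately show ?thesis by simp
qed

text \<open>A Feldman-Moore decomposition: the pairs with \<open>G k x = y\<close> and
  \<open>G l y = x\<close> form a partial injection, and these sets cover \<open>R0\<close> as k and
  l vary. Disjointing them yields the pieces.\<close>

lemma mrel_decomp:
  assumes E: "mrel E"
  obtains F :: "nat \<Rightarrow> 'a rel" where "\<And>k. mrel (F k)" "\<And>k. bisv (F k)"
    "disjoint_family F" "(\<Union>k. F k) = E"
proof -
  define H where "H n = {(x, y) \<in> R0. G (fst (prod_decode n)) x = y}
      \<inter> {(x, y) \<in> R0. G (snd (prod_decode n)) x = y}\<inverse>" for n
  have mH: "mrel (H n)" for n
    unfolding H_def by (intro mrel_Int mrel_converse mrel_graph G_meas)
  have bH: "bisv (H n)" for n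
  proof (rule bisvI)
    show "y = z" if "(x, y) \<in> H n" "(x, z) \<in> H n" for x y z
      using that unfolding H_def by blast
    show "x = y" if "(x, z) \<in> H n" "(y, z) \<in> H n" for x y z
      using that unfolding H_def by blast
  qed
  have UH: "(\<Union>n. H n) = R0"
  proof
    show "R0 \<subseteq> (\<Union>n. H n)"
    proof clarify
      fix x y assume xy: "(x, y) \<in> R0"
      obtain k where "G k x = y" using R0_G[of x y] xy by metis
      moreover obtain l where "G l y = x" using R0_G[of y x] R0_sym[OF xy] by metis
      ultimately have "(x, y) \<in> H (prod_encode (k, l))" using xy R0_sym[OF xy] by (simp add: H_def)
      then show "(x, y) \<in> (\<Union>n. H n)" by blast
    qed
  qed (auto simp: H_def)
  define F where "F n = E \<inter> disjointed H n" for n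
  have "mrel (disjointed H n)" for n
    unfolding disjointed_def by (intro mrel_Diff mrel_UN mH) auto
  then have "mrel (F n)" for n unfolding F_def by (intro mrel_Int E)
  moreover have "bisv (F n)" for n
    by (rule bisv_subset[OF bH[of n]]) (auto simp: F_def disjointed_def)
  moreover have "disjoint_family F"
    using disjoint_family_disjointed[of H] unfolding disjoint_family_on_def F_def by blast
  moreover have "(\<Union>n. F n) = E"
    using UN_disjointed_eq[of H] UH mrel_sub[OF E] by (auto simp: F_def)
  ultimately show thesis by (rule that)
qed

section \<open>Mass of subrelations and its invariance\<close>

text \<open>On subrelations of \<open>R\<close> this is the value of \<open>h_measure\<close>, the
  fibre over x being identified with the image of x. On a single-valued relation it is the measure
  of the domain, which is how it relates to cost.\<close>

definition mass :: "'a rel \<Rightarrow> ennreal" where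
  "mass E = (\<integral>\<^sup>+x. emeasure (count_space UNIV) (E `` {x}) \<partial>M)"

lemma count_bisv:
  assumes "bisv E"
  shows "emeasure (count_space UNIV) (E `` {x}) = indicator (Domain E) x"
proof (cases "x \<in> Domain E")
  case True
  then obtain y where "(x, y) \<in> E" by blast
  then have "E `` {x} = {y}" using bisv_right[OF assms] by blast
  then show ?thesis using True by simp
next
  case False
  then have "E `` {x} = {}" by blast
  then show ?thesis using False by simp
qed

lemma count_disjoint_UN:
  assumes "disjoint_family E"
  shows "emeasure (count_space UNIV) ((\<Union>i::nat. E i) `` {x})
    = (\<Sum>i. emeasure (count_space UNIV) (E i `` {x}))"
proof -
  have "disjoint_family (\<lambda>i. E i `` {x})"
    using assms unfolding disjoint_family_on_def by blast
  then have "(\<Sum>i. emeasure (count_space UNIV) (E i `` {x})) = emeasure (count_space UNIV) (\<Union>i. E i `` {x})"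
    by (intro suminf_emeasure) auto
  moreover have "(\<Union>i. E i) `` {x} = (\<Union>i. E i `` {x})" by blast
  ultimately show ?thesis by simp
qed

lemma count_measurable:
  assumes E: "mrel E"
  shows "(\<lambda>x. emeasure (count_space UNIV) (E `` {x})) \<in> borel_measurable M"
proof -
  obtain F where F: "\<And>k::nat. mrel (F k)" "\<And>k. bisv (F k)" "disjoint_family F" "(\<Union>k. F k) = E"
    using mrel_decomp[OF E] by blast
  have "emeasure (count_space UNIV) (E `` {x}) = (\<Sum>k. indicator (Domain (F k)) x)" for x
    unfolding F(4)[symmetric] count_disjoint_UN[OF F(3)] count_bisv[OF F(2)] ..
  then show ?thesis using mrel_Domain[OF F(1)] by simp
qed

lemma mass_bisv: "mrel E \<Longrightarrow> bisv E \<Longrightarrow> mass E = emeasure M (Domain E)"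
  unfolding mass_def by (simp add: count_bisv mrel_Domain)

lemma mass_disjoint_UN:
  assumes "\<And>i::nat. mrel (E i)" "disjoint_family E"
  shows "mass (\<Union>i. E i) = (\<Sum>i. mass (E i))"
  unfolding mass_def count_disjoint_UN[OF assms(2)]
  by (rule nn_integral_suminf) (rule count_measurable[OF assms(1)])

lemma mass_mono: "E \<subseteq> F \<Longrightarrow> mass E \<le> mass F"
  unfolding mass_def by (intro nn_integral_mono emeasure_mono) auto

lemma mass_empty: "mass {} = 0" by (simp add: mass_def)

lemma mass_Un_disjoint:
  assumes "mrel E" "mrel F" "E \<inter> F = {}"
  shows "mass (E \<union> F) = mass E + mass F"
proof -
  have "emeasure (count_space UNIV) ((E \<union> F) `` {x}) =
      emeasure (count_space UNIV) (E `` {x}) + emeasure (count_space UNIV) (F `` {x})" for x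
  proof -
    have "(E \<union> F) `` {x} = E `` {x} \<union> F `` {x}" by blast
    then show ?thesis using assms(3) by (simp add: plus_emeasure[symmetric] disjoint_iff)
  qed
  then show ?thesis
    unfolding mass_def using count_measurable assms by (simp add: nn_integral_add)
qed

lemma mass_Un: "mrel E \<Longrightarrow> mrel F \<Longrightarrow> mass (E \<union> F) \<le> mass E + mass F"
proof -
  assume EF: "mrel E" "mrel F"
  have "mass (E \<union> F) = mass (E \<union> (F - E))" by (simp add: Un_commute)
  also have "\<dots> = mass E + mass (F - E)" using EF by (intro mass_Un_disjoint mrel_Diff) auto
  also have "\<dots> \<le> mass E + mass F" by (intro add_left_mono mass_mono) auto
  finally show ?thesis .
qed

text \<open>The mass transport principle: counting edges at their source or at their target gives
  the same total, because each injective piece has domain and range of equal measure in type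
  II1.\<close>

lemma mass_converse:
  assumes E: "mrel E" shows "mass (E\<inverse>) = mass E"
proof -
  obtain F where F: "\<And>k::nat. mrel (F k)" "\<And>k. bisv (F k)" "disjoint_family F" "(\<Union>k. F k) = E"
    using mrel_decomp[OF E] by blast
  have "mass (E\<inverse>) = mass (\<Union>k. (F k)\<inverse>)" using F(4) by (simp flip: converse_UNION)
  also have "\<dots> = (\<Sum>k. mass ((F k)\<inverse>))"
  proof (rule mass_disjoint_UN)
    show "disjoint_family (\<lambda>k. (F k)\<inverse>)" using F(3) unfolding disjoint_family_on_def by blast
  qed (rule mrel_converse[OF F(1)])
  also have "\<dots> = (\<Sum>k. mass (F k))"
    using F bisv_measure by (simp add: mass_bisv mrel_converse bisv_converse)
  also have "\<dots> = mass E" using F mass_disjoint_UN by metis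
  finally show ?thesis .
qed

lemma mass_single_valued: "mrel E \<Longrightarrow> single_valued E \<Longrightarrow> mass E = emeasure M (Domain E)"
proof -
  assume E: "mrel E" "single_valued E"
  have "emeasure (count_space UNIV) (E `` {x}) = indicator (Domain E) x" for x
  proof (cases "x \<in> Domain E")
    case True
    then obtain y where "(x, y) \<in> E" by blast
    then have "E `` {x} = {y}" using E(2) by (auto simp: single_valued_def)
    then show ?thesis using True by simp
  next
    case False
    then have "E `` {x} = {}" by blast
    then show ?thesis using False by simp
  qed
  then show ?thesis unfolding mass_def using mrel_Domain[OF E(1)] by simp
qed

lemma Domain_mass: "mrel E \<Longrightarrow> emeasure M (Domain E) \<le> mass E"
proof -
  assume E: "mrel E"
  have "indicator (Domain E) x \<le> emeasure (count_space UNIV) (E `` {x})" for x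
  proof (cases "x \<in> Domain E")
    case True
    then obtain y where "{y} \<subseteq> E `` {x}" by blast
    then have "emeasure (count_space UNIV) {y} \<le> emeasure (count_space UNIV) (E `` {x})"
      by (intro emeasure_mono) auto
    then show ?thesis using True by simp
  qed simp
  then have "(\<integral>\<^sup>+x. indicator (Domain E) x \<partial>M) \<le> mass E"
    unfolding mass_def by (intro nn_integral_mono)
  then show ?thesis using mrel_Domain[OF E] by simp
qed

lemma Range_mass: "mrel E \<Longrightarrow> emeasure M (Range E) \<le> mass E"
  using Domain_mass[OF mrel_converse] mass_converse by simp

end


subsection \<open>Comparison of sets\<close>

text \<open>When a set of positive measure is split properly, one of the two parts has at most half
  its measure; this is iterated.\<close>

lemma (in prob_space) nonatomic_small_subset:
  assumes na: "nonatomic M" and A: "A \<in> sets M" "prob A > 0" and e: "(e::real) > 0"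
  shows "\<exists>B\<in>sets M. B \<subseteq> A \<and> 0 < prob B \<and> prob B < e"
proof -
  have half: "\<exists>C\<in>sets M. C \<subseteq> B \<and> 0 < prob C \<and> prob C \<le> prob B / 2"
    if B: "B \<in> sets M" "prob B > 0" for B
  proof -
    obtain C where C: "C \<in> sets M" "C \<subseteq> B" "0 < emeasure M C" "emeasure M C < emeasure M B"
      using na B unfolding nonatomic_def by (auto simp: emeasure_eq_measure)
    then have C': "0 < prob C" "prob C < prob B" by (auto simp: emeasure_eq_measure ennreal_less_iff)
    have "prob (B - C) = prob B - prob C" using C B by (intro finite_measure_Diff) auto
    then show ?thesis
      using C C' B by (cases "prob C \<le> prob B / 2") (auto intro: bexI[of _ C] bexI[of _ "B - C"])
  qed
  have "\<exists>B\<in>sets M. B \<subseteq> A \<and> 0 < prob B \<and> prob B \<le> prob A / 2 ^ n" for n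
  proof (induction n)
    case 0
    then show ?case using A by auto
  next
    case (Suc n)
    then obtain B where B: "B \<in> sets M" "B \<subseteq> A" "0 < prob B" "prob B \<le> prob A / 2 ^ n" by blast
    obtain C where C: "C \<in> sets M" "C \<subseteq> B" "0 < prob C" "prob C \<le> prob B / 2" using half B by blast
    have "prob C \<le> prob A / 2 ^ Suc n" using C(4) B(4) by simp
    then show ?case using B C by blast
  qed
  moreover obtain n where "prob A / 2 ^ n < e"
  proof -
    obtain n where "(1/2 :: real) ^ n < e" using real_arch_pow_inv[OF e, of "1/2"] by auto
    then have "1 / 2 ^ n < e" by (simp add: power_one_over)
    moreover have "prob A / 2 ^ n \<le> 1 / 2 ^ n" by (intro divide_right_mono) auto
    ultimately show ?thesis using that[of n] by linarith
  qed
  ultimately show ?thesis by (meson le_less_trans)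
qed

text \<open>Sierpinski's theorem by greedy exhaustion. Each step adds an admissible set of at least
  half the largest possible measure. If the limit stayed below \<open>c\<close>, a small set
  disjoint from it would be admissible at every step, and the increments could not tend to
  0.\<close>

lemma (in prob_space) nonatomic_measure_value:
  assumes na: "nonatomic M" and c: "0 \<le> c" "c \<le> 1"
  shows "\<exists>A\<in>sets M. prob A = c"
proof -
  define ok where "ok B C \<longleftrightarrow> C \<in> sets M \<and> C \<subseteq> space M - B \<and> prob B + prob C \<le> c" for B C
  have ex: "\<exists>C. ok B C \<and> (\<forall>C'. ok B C' \<longrightarrow> prob C' \<le> 2 * prob C)" if B: "B \<in> sets M" "prob B \<le> c" for B
  proof -
    define s where "s = Sup {prob C |C. ok B C}"
    have ok0: "ok B {}" using B by (simp add: ok_def)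
    have bdd: "bdd_above {prob C |C. ok B C}" by (rule bdd_aboveI[of _ 1]) auto
    have le: "prob C \<le> s" if "ok B C" for C
      unfolding s_def by (rule cSup_upper[OF _ bdd]) (use that in blast)
    show ?thesis
    proof (cases "s > 0")
      case True
      then have "s / 2 < Sup {prob C |C. ok B C}" by (simp add: s_def)
      moreover have "{prob C |C. ok B C} \<noteq> {}" using ok0 by blast
      ultimately obtain C where "ok B C" "s / 2 < prob C"
        using less_cSupD[of "{prob C |C. ok B C}" "s / 2"] by blast
      then show ?thesis using le by (intro exI[of _ C]) force
    next
      case False
      then show ?thesis using ok0 le by (intro exI[of _ "{}"]) force
    qed
  qed
  have "\<exists>B. \<forall>n::nat. (B n \<in> sets M \<and> prob (B n) \<le> c) \<and>
      (\<exists>C. ok (B n) C \<and> (\<forall>C'. ok (B n) C' \<longrightarrow> prob C' \<le> 2 * prob C) \<and> B (Suc n) = B n \<union> C)"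
  proof (rule dependent_nat_choice)
    show "\<exists>x. x \<in> sets M \<and> prob x \<le> c" using c by (intro exI[of _ "{}"]) auto
  next
    fix B and n :: nat assume B: "B \<in> sets M \<and> prob B \<le> c"
    then obtain C where C: "ok B C" "\<forall>C'. ok B C' \<longrightarrow> prob C' \<le> 2 * prob C" using ex by blast
    have "prob (B \<union> C) = prob B + prob C"
      using B C(1) by (intro finite_measure_Union) (auto simp: ok_def)
    then show "\<exists>y. (y \<in> sets M \<and> prob y \<le> c) \<and>
        (\<exists>C. ok B C \<and> (\<forall>C'. ok B C' \<longrightarrow> prob C' \<le> 2 * prob C) \<and> y = B \<union> C)"
      using B C by (intro exI[of _ "B \<union> C"]) (auto simp: ok_def)
  qed
  then obtain B where B: "\<And>n::nat. B n \<in> sets M" "\<And>n. prob (B n) \<le> c"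
    and BS: "\<And>n. \<exists>C. ok (B n) C \<and> (\<forall>C'. ok (B n) C' \<longrightarrow> prob C' \<le> 2 * prob C) \<and> B (Suc n) = B n \<union> C"
    by blast
  have "incseq B" using BS by (intro incseq_SucI) blast
  then have lim: "(\<lambda>n. prob (B n)) \<longlonglongrightarrow> prob (\<Union>n. B n)"
    using B by (intro finite_Lim_measure_incseq) auto
  have UB: "(\<Union>n. B n) \<in> sets M" using B by auto
  have le: "prob (\<Union>n. B n) \<le> c" using LIMSEQ_le_const2[OF lim] B(2) by blast
  have "prob (\<Union>n. B n) = c"
  proof (rule ccontr)
    assume "prob (\<Union>n. B n) \<noteq> c"
    then have lt: "prob (\<Union>n. B n) < c" using le by simp
    then have "prob (space M - (\<Union>n. B n)) > 0" using prob_compl[OF UB] c by simp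
    then obtain C where C: "C \<in> sets M" "C \<subseteq> space M - (\<Union>n. B n)" "0 < prob C" "prob C < c - prob (\<Union>n. B n)"
      using nonatomic_small_subset[OF na, of "space M - (\<Union>n. B n)" "c - prob (\<Union>n. B n)"] UB lt by auto
    have step: "prob C \<le> 2 * (prob (B (Suc n)) - prob (B n))" for n
    proof -
      have "prob (B n) \<le> prob (\<Union>n. B n)" using UB by (intro finite_measure_mono) auto
      then have okC: "ok (B n) C" using C by (auto simp: ok_def)
      obtain D where D: "ok (B n) D" "\<forall>C'. ok (B n) C' \<longrightarrow> prob C' \<le> 2 * prob D" "B (Suc n) = B n \<union> D"
        using BS by blast
      have "prob (B n \<union> D) = prob (B n) + prob D"
        using B D(1) by (intro finite_measure_Union) (auto simp: ok_def)
      then show ?thesis using D okC by auto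
    qed
    have "(\<lambda>n. 2 * (prob (B (Suc n)) - prob (B n))) \<longlonglongrightarrow> 2 * (prob (\<Union>n. B n) - prob (\<Union>n. B n))"
      using lim LIMSEQ_Suc[OF lim] by (intro tendsto_intros)
    then have "prob C \<le> 2 * (prob (\<Union>n. B n) - prob (\<Union>n. B n))"
      using step by (intro LIMSEQ_le_const) auto
    then show False using C by simp
  qed
  then show ?thesis using UB by blast
qed

section \<open>Matchings obtained from ergodicity\<close>

context countable_pmp_relation
begin

lemma saturation_measure:
  assumes "A \<in> sets M" "A \<subseteq> X0"
  shows "R `` A \<in> sets M" "emeasure M (R `` A) = 0 \<or> emeasure M (R `` A) = 1"
proof -
  have "R `` A = R0 `` A" using assms(2) R_R0 R0_R by blast
  then show 1: "R `` A \<in> sets M" using mrel_Image[OF mrel_all assms(1)] by simp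
  have "R `` (R `` A) = R `` A" using R_trans R_refl R_space by blast
  then show "emeasure M (R `` A) = 0 \<or> emeasure M (R `` A) = 1"
    using ergodic 1 unfolding ergodic_def by blast
qed

lemma X0_null: "space M - X0 \<in> null_sets M"
  using X0 emeasure_compl[of X0 M] by (auto simp: emeasure_space_1)

text \<open>Points are matched greedily along the pieces \<open>H n\<close>. No unmatched point of
  \<open>A\<close> in \<open>X0\<close> is then related to an unmatched point of \<open>B\<close>.
  By ergodicity the saturation of the former is null or conull; in the second case the rest of
  \<open>B\<close> is null, and comparing measures makes the rest of \<open>A\<close> null
  too.\<close>

lemma comparison:
  assumes A: "A \<in> sets M" and B: "B \<in> sets M" and le: "emeasure M A \<le> emeasure M B"
  shows "\<exists>E. mrel E \<and> bisv E \<and> Domain E \<subseteq> A \<and> Range E \<subseteq> B \<and> A - Domain E \<in> null_sets M"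
proof -
  obtain H where H: "\<And>k::nat. mrel (H k)" "\<And>k. bisv (H k)" "(\<Union>k. H k) = R0"
    using mrel_decomp[OF mrel_all] by metis
  define E where "E = rec_nat {} (\<lambda>n E. E \<union> H n \<inter> (A - Domain E) \<times> (B - Range E))"
  have E0: "E 0 = {}" and ES: "E (Suc n) = E n \<union> H n \<inter> (A - Domain (E n)) \<times> (B - Range (E n))" for n
    by (simp_all add: E_def)
  have E: "mrel (E n) \<and> bisv (E n) \<and> Domain (E n) \<subseteq> A \<and> Range (E n) \<subseteq> B" for n
  proof (induction n)
    case 0 then show ?case by (simp add: E0 mrel_empty bisv_def)
  next
    case (Suc n)
    then have IH: "mrel (E n)" "bisv (E n)" "Domain (E n) \<subseteq> A" "Range (E n) \<subseteq> B" by auto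
    have "mrel (E (Suc n))"
      unfolding ES by (intro mrel_Un mrel_rect H IH sets.Diff A B mrel_Domain mrel_Range)
    moreover have "bisv (E (Suc n))"
    proof (rule bisvI)
      show "y = z" if "(x, y) \<in> E (Suc n)" "(x, z) \<in> E (Suc n)" for x y z
        using that bisv_right[OF IH(2)] bisv_right[OF H(2)] unfolding ES by blast
      show "x = y" if "(x, z) \<in> E (Suc n)" "(y, z) \<in> E (Suc n)" for x y z
        using that bisv_left[OF IH(2)] bisv_left[OF H(2)] unfolding ES by blast
    qed
    moreover have "Domain (E (Suc n)) \<subseteq> A" "Range (E (Suc n)) \<subseteq> B" using IH unfolding ES by auto
    ultimately show ?case by blast
  qed
  have mono: "E m \<subseteq> E n" if "m \<le> n" for m n
    by (rule lift_Suc_mono_le[OF _ that]) (auto simp: ES)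
  define F where "F = (\<Union>n. E n)"
  have mF: "mrel F" unfolding F_def by (intro mrel_UN) (use E in auto)
  have bF: "bisv F"
  proof (rule bisvI)
    show "y = z" if xy: "(x, y) \<in> F" "(x, z) \<in> F" for x y z
    proof -
      obtain m n where "(x, y) \<in> E m" "(x, z) \<in> E n" using xy by (auto simp: F_def)
      then have "(x, y) \<in> E (max m n)" "(x, z) \<in> E (max m n)"
        using mono[of m "max m n"] mono[of n "max m n"] by auto
      then show ?thesis using bisv_right E by metis
    qed
    show "x = y" if xy: "(x, z) \<in> F" "(y, z) \<in> F" for x y z
    proof -
      obtain m n where "(x, z) \<in> E m" "(y, z) \<in> E n" using xy by (auto simp: F_def)
      then have "(x, z) \<in> E (max m n)" "(y, z) \<in> E (max m n)"
        using mono[of m "max m n"] mono[of n "max m n"] by auto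
      then show ?thesis using bisv_left E by metis
    qed
  qed
  have DF: "Domain F \<subseteq> A" "Range F \<subseteq> B" using E unfolding F_def by blast+
  define A' where "A' = (A - Domain F) \<inter> X0"
  have A': "A' \<in> sets M" "A' \<subseteq> X0" using A mrel_Domain[OF mF] X0 by (auto simp: A'_def)
  have disj: "(B - Range F) \<inter> R `` A' = {}"
  proof (rule ccontr)
    assume "(B - Range F) \<inter> R `` A' \<noteq> {}"
    then obtain a b where ab: "b \<in> B" "b \<notin> Range F" "(a, b) \<in> R" "a \<in> A" "a \<notin> Domain F" "a \<in> X0"
      by (auto simp: A'_def)
    then obtain n where "(a, b) \<in> H n" using R_R0 H(3) by blast
    moreover have "a \<notin> Domain (E n)" "b \<notin> Range (E n)" using ab unfolding F_def by blast+
    ultimately have "(a, b) \<in> E (Suc n)" using ab unfolding ES by blast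
    then show False using ab(2) unfolding F_def by blast
  qed
  have "A - Domain F \<in> null_sets M"
  proof (cases "emeasure M (R `` A') = 0")
    case True
    then have "R `` A' \<in> null_sets M" using saturation_measure[OF A'] by auto
    moreover have "A - Domain F \<subseteq> R `` A' \<union> (space M - X0)"
      using R_refl X0_space sets.sets_into_space[OF A] unfolding A'_def by blast
    ultimately show ?thesis
      using X0_null null_sets_subset[OF null_sets.Un] A mrel_Domain[OF mF] by blast
  next
    case False
    then have one: "emeasure M (R `` A') = 1" and RM: "R `` A' \<in> sets M" using saturation_measure[OF A'] by auto
    have "space M - R `` A' \<in> null_sets M"
      using one RM emeasure_compl[OF RM] by (auto simp: emeasure_space_1)
    moreover have "B - Range F \<subseteq> space M - R `` A'" using disj sets.sets_into_space[OF B] by blast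
    ultimately have "B - Range F \<in> null_sets M"
      using null_sets_subset[OF _ sets.Diff[OF B mrel_Range[OF mF]]] by simp
    then have "emeasure M B = emeasure M (Range F)"
      using emeasure_Un_null_set[of "Range F" M "B - Range F"] mrel_Range[OF mF] DF
      by (simp add: Un_absorb1)
    then have "emeasure M A \<le> emeasure M (Domain F)" using le bisv_measure[OF mF bF] by simp
    moreover have "emeasure M (A - Domain F) = emeasure M A - emeasure M (Domain F)"
      using A DF mrel_Domain[OF mF] by (intro emeasure_Diff) (auto simp: emeasure_eq_measure)
    ultimately have "emeasure M (A - Domain F) = 0"
      by (simp add: emeasure_eq_measure ennreal_minus_if)
    then show ?thesis using A mrel_Domain[OF mF] by auto
  qed
  then show ?thesis using mF bF DF by blast
qed

text \<open>The sets are moved one after the other into the complement of what is already occupied.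
  The total being at most 1, that complement is always large enough for
  \<open>comparison\<close>.\<close>

lemma spread:
  fixes Q :: "nat \<Rightarrow> 'a set"
  assumes Q: "\<And>j. Q j \<in> sets M" and le: "(\<Sum>j. emeasure M (Q j)) \<le> 1"
  shows "\<exists>\<sigma>. (\<forall>j. mrel (\<sigma> j) \<and> bisv (\<sigma> j) \<and> Domain (\<sigma> j) \<subseteq> Q j \<and> Q j - Domain (\<sigma> j) \<in> null_sets M)
    \<and> disjoint_family (\<lambda>j. Range (\<sigma> j))"
proof -
  define good where "good j E \<longleftrightarrow> mrel E \<and> bisv E \<and> Domain E \<subseteq> Q j \<and> Q j - Domain E \<in> null_sets M" for j E
  \<comment> \<open>A state consists of the current matching and of the set of target points
    occupied so far.\<close>
  define P where "P n s \<longleftrightarrow> good n (fst s) \<and> snd s \<in> sets M \<and> Range (fst s) \<subseteq> snd s \<and>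
      emeasure M (snd s) \<le> (\<Sum>i\<le>n. emeasure M (Q i))" for n and s :: "'a rel \<times> 'a set"
  have ex: "\<exists>E. good n E \<and> Range E \<inter> U = {} \<and> E `` UNIV \<in> sets M \<and> emeasure M (Range E) \<le> emeasure M (Q n)"
    if U: "U \<in> sets M" "emeasure M U \<le> (\<Sum>i<n. emeasure M (Q i))" for n U
  proof -
    have "emeasure M (Q n) + emeasure M U \<le> (\<Sum>i\<in>{..<Suc n}. emeasure M (Q i))"
      using add_left_mono[OF U(2), of "emeasure M (Q n)"] by (simp add: add.commute)
    also have "\<dots> \<le> 1" by (rule order_trans[OF sum_le_suminf le]) auto
    finally have "emeasure M (Q n) \<le> emeasure M (space M - U)"
      using emeasure_compl[OF U(1)] by (simp add: emeasure_space_1 ennreal_le_minus_iff)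
    from comparison[OF Q _ this] U obtain E where
      E: "mrel E" "bisv E" "Domain E \<subseteq> Q n" "Range E \<subseteq> space M - U" "Q n - Domain E \<in> null_sets M" by auto
    moreover have "E `` UNIV = Range E" by blast
    moreover have "emeasure M (Range E) \<le> emeasure M (Q n)"
      using bisv_measure[OF E(1,2)] emeasure_mono[OF E(3) Q] by simp
    ultimately show ?thesis using mrel_Range[OF E(1)] unfolding good_def by (intro exI[of _ E]) auto
  qed
  have "\<exists>s. \<forall>n. P n (s n) \<and> (Range (fst (s (Suc n))) \<inter> snd (s n) = {} \<and> snd (s n) \<subseteq> snd (s (Suc n)))"
  proof (rule dependent_nat_choice)
    obtain E where "good 0 E" "E `` UNIV \<in> sets M" "emeasure M (Range E) \<le> emeasure M (Q 0)"
      using ex[of "{}" 0] by auto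
    then show "\<exists>x. P 0 x" by (intro exI[of _ "(E, Range E)"]) (auto simp: P_def good_def mrel_Range)
  next
    fix s n assume "P n s"
    then have s: "snd s \<in> sets M" "emeasure M (snd s) \<le> (\<Sum>i<Suc n. emeasure M (Q i))"
      by (auto simp: P_def lessThan_Suc_atMost)
    from ex[OF this] obtain E where E: "good (Suc n) E" "Range E \<inter> snd s = {}"
      "emeasure M (Range E) \<le> emeasure M (Q (Suc n))" by blast
    have RE: "Range E \<in> sets M" using E(1) mrel_Range by (auto simp: good_def)
    have "emeasure M (snd s \<union> Range E) \<le> emeasure M (snd s) + emeasure M (Range E)"
      using s RE by (intro emeasure_subadditive)
    also have "\<dots> \<le> (\<Sum>i<Suc n. emeasure M (Q i)) + emeasure M (Q (Suc n))"
      by (intro add_mono s E)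
    also have "\<dots> = (\<Sum>i\<le>Suc n. emeasure M (Q i))" by (simp add: lessThan_Suc_atMost)
    finally show "\<exists>y. P (Suc n) y \<and> (Range (fst y) \<inter> snd s = {} \<and> snd s \<subseteq> snd y)"
      using E RE s by (intro exI[of _ "(E, snd s \<union> Range E)"]) (auto simp: P_def)
  qed
  then obtain s where s: "\<And>n. P n (s n)" "\<And>n. Range (fst (s (Suc n))) \<inter> snd (s n) = {}"
      "\<And>n. snd (s n) \<subseteq> snd (s (Suc n))" by blast
  have mono: "snd (s m) \<subseteq> snd (s n)" if "m \<le> n" for m n
    by (rule lift_Suc_mono_le[of "\<lambda>n. snd (s n)", OF s(3) that])
  have lt: "Range (fst (s m)) \<inter> Range (fst (s n)) = {}" if mn: "m < n" for m n
  proof -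
    obtain k where k: "n = Suc k" "m \<le> k" using mn by (cases n) auto
    have "Range (fst (s m)) \<subseteq> snd (s k)" using s(1)[of m] mono[OF k(2)] by (auto simp: P_def)
    then show ?thesis using s(2)[of k] k(1) by blast
  qed
  have "disjoint_family (\<lambda>j. Range (fst (s j)))"
    unfolding disjoint_family_on_def using lt by (metis Int_commute linorder_neqE_nat)
  moreover have "\<forall>j. good j (fst (s j))" using s(1) by (simp add: P_def)
  ultimately show ?thesis unfolding good_def by (intro exI[of _ "\<lambda>j. fst (s j)"] conjI)
qed

end


subsection \<open>Bounded degree and contraction of graphings\<close>

abbreviation conn :: "'a rel \<Rightarrow> 'a rel" where "conn K \<equiv> (K \<union> K\<inverse>)\<^sup>*"

lemma conn_sym: "(x, y) \<in> conn K \<Longrightarrow> (y, x) \<in> conn K"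
  by (rule symD[OF sym_rtrancl[OF sym_Un_converse]])

lemma conn_trans: "(x, y) \<in> conn K \<Longrightarrow> (y, z) \<in> conn K \<Longrightarrow> (x, z) \<in> conn K"
  by (rule rtrancl_trans)

lemma conn_mono: "K \<subseteq> K' \<Longrightarrow> conn K \<subseteq> conn K'"
  by (intro rtrancl_mono Un_mono) auto

lemma suminf_pairs_le:
  fixes a f :: "nat \<Rightarrow> ennreal"
  assumes "\<And>k. f (2 * k) \<le> a k" "\<And>k. f (Suc (2 * k)) \<le> a k"
  shows "(\<Sum>j. f j) \<le> 2 * (\<Sum>k. a k)"
proof -
  have pairs: "(\<Sum>j<2 * n. f j) \<le> 2 * (\<Sum>k<n. a k)" for n
  proof (induction n)
    case (Suc n)
    have "(\<Sum>j<2 * Suc n. f j) = (\<Sum>j<2 * n. f j) + (f (2 * n) + f (Suc (2 * n)))"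
      by (simp add: add.assoc)
    also have "\<dots> \<le> 2 * (\<Sum>k<n. a k) + (a n + a n)" by (intro add_mono Suc assms)
    finally show ?case by (simp add: distrib_left mult_2)
  qed simp
  show ?thesis unfolding suminf_eq_SUP[of f]
  proof (rule SUP_least)
    fix n
    have "(\<Sum>j<n. f j) \<le> (\<Sum>j<2 * n. f j)" by (intro sum_mono2) auto
    also have "\<dots> \<le> 2 * (\<Sum>k<n. a k)" by (rule pairs)
    also have "\<dots> \<le> 2 * (\<Sum>k. a k)" by (intro mult_left_mono sum_le_suminf) auto
    finally show "(\<Sum>j<n. f j) \<le> 2 * (\<Sum>k. a k)" .
  qed
qed

context countable_pmp_relation
begin

text \<open>Every point \<open>x\<close> is given a private copy \<open>\<sigma> j x\<close> for each end of an edge of \<open>F\<close> at \<open>x\<close>, all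
  copies being distinct points of the space. The copies of \<open>x\<close> are chained together and the edges
  are transported to them, so that no point meets more than a bounded number of edges.\<close>

lemma bounded_degree_replacement:
  assumes F: "mrel F" and small: "2 * mass F \<le> 1"
  shows "\<exists>K1 K2 K3 Z. (\<forall>K\<in>{K1, K2, K3}. mrel K \<and> bisv K \<and> mass K \<le> 2 * mass F) \<and>
    Z \<in> null_sets M \<and> (\<forall>(x, y)\<in>F. x \<notin> Z \<longrightarrow> y \<notin> Z \<longrightarrow> (x, y) \<in> conn (K1 \<union> K2 \<union> K3))"
proof -
  obtain f where f: "\<And>k::nat. mrel (f k)" "\<And>k. bisv (f k)" "disjoint_family f" "(\<Union>k. f k) = F"
    using mrel_decomp[OF F] by metis
  \<comment> \<open>Even indices list the sources and odd indices the targets of the pieces of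
    \<open>F\<close>; the set \<open>Q j\<close> consists of the points that need a copy with index
    j.\<close>
  define Q where "Q j = (if even j then Domain (f (j div 2)) else Range (f (j div 2)))" for j
  have Q: "Q j \<in> sets M" for j by (simp add: Q_def mrel_Domain mrel_Range f(1))
  have massF: "mass F = (\<Sum>k. emeasure M (Domain (f k)))"
    using mass_disjoint_UN[OF f(1,3)] f(4) by (simp add: mass_bisv f)
  have sumQ: "(\<Sum>j. emeasure M (Q j)) \<le> 2 * mass F"
    unfolding massF by (rule suminf_pairs_le) (simp_all add: Q_def bisv_measure f)
  obtain \<sigma> where \<sigma>: "\<And>j. mrel (\<sigma> j)" "\<And>j. bisv (\<sigma> j)" "\<And>j. Domain (\<sigma> j) \<subseteq> Q j"
      "\<And>j. Q j - Domain (\<sigma> j) \<in> null_sets M" "disjoint_family (\<lambda>j. Range (\<sigma> j))"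
    using spread[OF Q order_trans[OF sumQ small]] by blast
  have uniq: "i = j" if "(x, a) \<in> \<sigma> i" "(y, a) \<in> \<sigma> j" for x y a i j
    using \<sigma>(5) that unfolding disjoint_family_on_def by blast
  define V where "V = (\<Union>j. Range (\<sigma> j))"
  have VM: "V \<in> sets M" unfolding V_def using mrel_Range[OF \<sigma>(1)] by auto
  have "emeasure M V = (\<Sum>j. emeasure M (Range (\<sigma> j)))"
    unfolding V_def using mrel_Range[OF \<sigma>(1)] \<sigma>(5) by (intro suminf_emeasure[symmetric]) auto
  also have "\<dots> \<le> (\<Sum>j. emeasure M (Q j))"
    using bisv_measure[OF \<sigma>(1,2)] emeasure_mono[OF \<sigma>(3) Q] by (intro suminf_le) auto
  finally have V: "emeasure M V \<le> 2 * mass F" using sumQ by (rule order_trans)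
  \<comment> \<open>\<open>first\<close> joins a point to its copy of least index,
    \<open>link\<close> joins copies whose indices are consecutive among the copies of one point,
    and \<open>lift\<close> is the edge set moved to the copies. A copy determines its point and its
    index, hence all three are injective.\<close>
  define first where "first = (\<Union>j. \<sigma> j \<inter> (space M - (\<Union>i\<in>{..<j}. Domain (\<sigma> i))) \<times> space M)"
  define skip where "skip i j = Domain (\<sigma> i) - (\<Union>l\<in>{i<..<j}. Domain (\<sigma> l))" for i j
  define link where "link = (\<Union>i. \<Union>j\<in>{i<..}. ((\<sigma> i)\<inverse> O Id_on (skip i j)) O \<sigma> j)"
  define lift where "lift = (\<Union>k. ((\<sigma> (2 * k))\<inverse> O f k) O \<sigma> (Suc (2 * k)))"
  have skip: "skip i j \<in> sets M" "skip i j \<subseteq> X0" for i j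
    using mrel_Domain[OF \<sigma>(1)] mrel_X0[OF \<sigma>(1)] unfolding skip_def by (auto intro!: sets.finite_UN)
  have linkD: "\<exists>x i j. i < j \<and> (x, a) \<in> \<sigma> i \<and> (x, b) \<in> \<sigma> j \<and> (\<forall>l. i < l \<longrightarrow> l < j \<longrightarrow> x \<notin> Domain (\<sigma> l))"
    if "(a, b) \<in> link" for a b
    using that unfolding link_def skip_def by fastforce
  have linkI: "(a, b) \<in> link"
    if "i < j" "(x, a) \<in> \<sigma> i" "(x, b) \<in> \<sigma> j" "\<And>l. i < l \<Longrightarrow> l < j \<Longrightarrow> x \<notin> Domain (\<sigma> l)" for a b x i j
  proof -
    have "x \<in> skip i j" using that unfolding skip_def by auto
    then have "(a, b) \<in> ((\<sigma> i)\<inverse> O Id_on (skip i j)) O \<sigma> j" using that by blast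
    then show ?thesis using \<open>i < j\<close> unfolding link_def by blast
  qed
  have m: "mrel first" "mrel link" "mrel lift"
  proof -
    show "mrel first" unfolding first_def
      using mrel_Domain[OF \<sigma>(1)] by (intro mrel_UN mrel_rect \<sigma>) auto
    show "mrel link" unfolding link_def
      by (intro mrel_UN mrel_relcomp mrel_converse \<sigma> mrel_Id_on skip) auto
    show "mrel lift" unfolding lift_def
      by (intro mrel_UN mrel_relcomp mrel_converse \<sigma> f) auto
  qed
  have bfirst: "bisv first"
  proof (rule bisvI)
    fix x y z assume "(x, y) \<in> first" "(x, z) \<in> first"
    then obtain i j where ij: "(x, y) \<in> \<sigma> i" "(x, z) \<in> \<sigma> j" "\<forall>l<i. x \<notin> Domain (\<sigma> l)" "\<forall>l<j. x \<notin> Domain (\<sigma> l)"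
      unfolding first_def by blast
    then have "i = j" by (metis DomainI linorder_neqE_nat)
    then show "y = z" using ij bisv_right[OF \<sigma>(2)] by blast
  next
    fix x y z assume "(x, z) \<in> first" "(y, z) \<in> first"
    then obtain i j where ij: "(x, z) \<in> \<sigma> i" "(y, z) \<in> \<sigma> j" unfolding first_def by blast
    then show "x = y" using uniq bisv_left[OF \<sigma>(2)] by metis
  qed
  have blink: "bisv link"
  proof (rule bisvI)
    fix a b c assume ab: "(a, b) \<in> link" and ac: "(a, c) \<in> link"
    from linkD[OF ab] obtain x i j where
      1: "i < j" "(x, a) \<in> \<sigma> i" "(x, b) \<in> \<sigma> j" "\<forall>l. i < l \<longrightarrow> l < j \<longrightarrow> x \<notin> Domain (\<sigma> l)"
      by blast
    from linkD[OF ac] obtain y i' j' where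
      2: "i' < j'" "(y, a) \<in> \<sigma> i'" "(y, c) \<in> \<sigma> j'" "\<forall>l. i' < l \<longrightarrow> l < j' \<longrightarrow> y \<notin> Domain (\<sigma> l)"
      by blast
    have ii: "i = i'" using uniq 1 2 by blast
    then have xy: "x = y" using bisv_left[OF \<sigma>(2)] 1 2 by blast
    have "j = j'" using 1 2 ii xy by (metis DomainI linorder_neqE_nat)
    then show "b = c" using 1 2 xy bisv_right[OF \<sigma>(2)] by blast
  next
    fix a b c assume ab: "(a, c) \<in> link" and ac: "(b, c) \<in> link"
    from linkD[OF ab] obtain x i j where
      1: "i < j" "(x, a) \<in> \<sigma> i" "(x, c) \<in> \<sigma> j" "\<forall>l. i < l \<longrightarrow> l < j \<longrightarrow> x \<notin> Domain (\<sigma> l)"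
      by blast
    from linkD[OF ac] obtain y i' j' where
      2: "i' < j'" "(y, b) \<in> \<sigma> i'" "(y, c) \<in> \<sigma> j'" "\<forall>l. i' < l \<longrightarrow> l < j' \<longrightarrow> y \<notin> Domain (\<sigma> l)"
      by blast
    have jj: "j = j'" using uniq 1 2 by blast
    then have xy: "x = y" using bisv_left[OF \<sigma>(2)] 1 2 by blast
    have "i = i'" using 1 2 jj xy by (metis DomainI linorder_neqE_nat)
    then show "a = b" using 1 2 xy bisv_right[OF \<sigma>(2)] by blast
  qed
  have blift: "bisv lift" unfolding lift_def
  proof (rule bisv_UN)
    show "bisv (((\<sigma> (2 * k))\<inverse> O f k) O \<sigma> (Suc (2 * k)))" for k
      by (intro bisv_relcomp bisv_converse \<sigma> f)
    show "Domain (((\<sigma> (2 * i))\<inverse> O f i) O \<sigma> (Suc (2 * i))) \<inter> Domain (((\<sigma> (2 * j))\<inverse> O f j) O \<sigma> (Suc (2 * j))) = {}"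
      if "i \<noteq> j" for i j
    proof -
      have "2 * i \<noteq> 2 * j" using that by simp
      then have "Range (\<sigma> (2 * i)) \<inter> Range (\<sigma> (2 * j)) = {}"
        using \<sigma>(5) unfolding disjoint_family_on_def by blast
      then show ?thesis by blast
    qed
    show "Range (((\<sigma> (2 * i))\<inverse> O f i) O \<sigma> (Suc (2 * i))) \<inter> Range (((\<sigma> (2 * j))\<inverse> O f j) O \<sigma> (Suc (2 * j))) = {}"
      if "i \<noteq> j" for i j
    proof -
      have "Suc (2 * i) \<noteq> Suc (2 * j)" using that by simp
      then have "Range (\<sigma> (Suc (2 * i))) \<inter> Range (\<sigma> (Suc (2 * j))) = {}"
        using \<sigma>(5) unfolding disjoint_family_on_def by blast
      then show ?thesis by blast
    qed
  qed
  \<comment> \<open>Each of the three relations has its sources or its targets among the copies,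
    which have total measure at most \<open>2 * mass F\<close>.\<close>
  have bound: "mass K \<le> 2 * mass F" if "mrel K" "bisv K" "Domain K \<subseteq> V \<or> Range K \<subseteq> V" for K
  proof -
    have "mass K = emeasure M (Domain K)" "mass K = emeasure M (Range K)"
      using mass_bisv bisv_measure that by simp_all
    then have "mass K \<le> emeasure M V" using that(3) emeasure_mono[OF _ VM] by metis
    then show ?thesis using V by (rule order_trans)
  qed
  have masses: "mass first \<le> 2 * mass F" "mass link \<le> 2 * mass F" "mass lift \<le> 2 * mass F"
  proof -
    have "Range first \<subseteq> V" unfolding first_def V_def by blast
    then show "mass first \<le> 2 * mass F" by (intro bound m bfirst disjI2)
    have "Domain link \<subseteq> V" unfolding link_def V_def by blast
    then show "mass link \<le> 2 * mass F" by (intro bound m blink disjI1)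
    have "Domain lift \<subseteq> V" unfolding lift_def V_def by blast
    then show "mass lift \<le> 2 * mass F" by (intro bound m blift disjI1)
  qed
  let ?K = "first \<union> link \<union> lift"
  \<comment> \<open>Induction on the index of the copy: \<open>link\<close> leads back to the
    preceding copy of the same point, and \<open>first\<close> ends the descent.\<close>
  have copy: "(x, y) \<in> conn ?K" if "(x, y) \<in> \<sigma> j" for x y j
    using that
  proof (induction j arbitrary: y rule: less_induct)
    case (less j)
    show ?case
    proof (cases "\<exists>i<j. x \<in> Domain (\<sigma> i)")
      case False
      have "(x, y) \<in> space M \<times> space M" using less.prems mrel_space[OF \<sigma>(1)] by blast
      then have "(x, y) \<in> first" using less.prems False unfolding first_def by blast
      then show ?thesis by blast
    next
      case True
      define i where "i = Max {i. i < j \<and> x \<in> Domain (\<sigma> i)}"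
      have "i \<in> {i. i < j \<and> x \<in> Domain (\<sigma> i)}" unfolding i_def by (rule Max_in) (use True in auto)
      then obtain a where i: "i < j" "(x, a) \<in> \<sigma> i" by blast
      have "x \<notin> Domain (\<sigma> l)" if "i < l" "l < j" for l
      proof
        assume "x \<in> Domain (\<sigma> l)"
        then have "l \<le> i" unfolding i_def by (intro Max_ge) (use that in auto)
        then show False using that by simp
      qed
      then have "(a, y) \<in> link" using linkI[OF i(1,2) less.prems] by blast
      then have "(a, y) \<in> conn ?K" by blast
      then show ?thesis using less.IH[OF i] by (meson conn_trans)
    qed
  qed
  \<comment> \<open>The points that lack one of their copies.\<close>
  define Z where "Z = (\<Union>j. Q j - Domain (\<sigma> j))"
  have Z: "Z \<in> null_sets M" unfolding Z_def by (intro null_sets_UN \<sigma>)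
  have "(x, y) \<in> conn ?K" if xy: "(x, y) \<in> F" "x \<notin> Z" "y \<notin> Z" for x y
  proof -
    obtain k where k: "(x, y) \<in> f k" using xy f(4) by blast
    have "x \<in> Q (2 * k)" "y \<in> Q (Suc (2 * k))" using k by (auto simp: Q_def)
    then have "x \<in> Domain (\<sigma> (2 * k))" "y \<in> Domain (\<sigma> (Suc (2 * k)))" using xy unfolding Z_def by blast+
    then obtain a b where ab: "(x, a) \<in> \<sigma> (2 * k)" "(y, b) \<in> \<sigma> (Suc (2 * k))" by blast
    then have "(a, b) \<in> lift" using k unfolding lift_def by blast
    then have "(a, b) \<in> conn ?K" by blast
    then show ?thesis using copy[OF ab(1)] conn_sym[OF copy[OF ab(2)]] by (meson conn_trans)
  qed
  then show ?thesis
    using m bfirst blink blift masses Z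
    by (intro exI[of _ first] exI[of _ link] exI[of _ lift] exI[of _ Z]) auto
qed

text \<open>Measurable uniformization: the partner of a point is taken from the piece of least index
  that offers one.\<close>

lemma selection:
  assumes E: "mrel E"
  shows "\<exists>S. mrel S \<and> single_valued S \<and> S \<subseteq> E \<and> Domain S = Domain E"
proof -
  obtain f where f: "\<And>k::nat. mrel (f k)" "\<And>k. bisv (f k)" "disjoint_family f" "(\<Union>k. f k) = E"
    using mrel_decomp[OF E] by metis
  define S where "S = (\<Union>k. f k \<inter> (space M - (\<Union>i\<in>{..<k}. Domain (f i))) \<times> space M)"
  have "mrel S" unfolding S_def using mrel_Domain[OF f(1)] by (intro mrel_UN mrel_rect f) auto
  moreover have "single_valued S"
  proof (rule single_valuedI)
    fix x y z assume "(x, y) \<in> S" "(x, z) \<in> S"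
    then obtain i j where ij: "(x, y) \<in> f i" "(x, z) \<in> f j" "\<forall>l<i. x \<notin> Domain (f l)" "\<forall>l<j. x \<notin> Domain (f l)"
      unfolding S_def by blast
    then have "i = j" by (metis DomainI linorder_neqE_nat)
    then show "y = z" using ij bisv_right[OF f(2)] by blast
  qed
  moreover have "S \<subseteq> E" unfolding S_def f(4)[symmetric] by blast
  moreover have "Domain E \<subseteq> Domain S"
  proof
    fix x assume "x \<in> Domain E"
    then have ex: "\<exists>k. x \<in> Domain (f k)" unfolding f(4)[symmetric] by blast
    define k where "k = (LEAST k. x \<in> Domain (f k))"
    have "x \<in> Domain (f k)" unfolding k_def by (rule LeastI_ex[OF ex])
    then obtain y where y: "(x, y) \<in> f k" by blast
    have "x \<notin> Domain (f i)" if "i < k" for i using not_less_Least that unfolding k_def by blast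
    then have "(x, y) \<in> S" using y mrel_space[OF f(1)] unfolding S_def by blast
    then show "x \<in> Domain S" by blast
  qed
  ultimately show ?thesis by blast
qed

end


section \<open>Spanning forests and their contraction\<close>

context countable_pmp_relation
begin

text \<open>Breadth-first search: \<open>B n\<close> is the ball of radius n about \<open>Y\<close>,
  and each point of a sphere chooses a neighbour one level closer to \<open>Y\<close>. As levels
  drop strictly along \<open>P\<close>, there are no two-cycles and every walk ends in
  \<open>Y\<close>.\<close>

lemma forest:
  assumes E: "mrel E" and Y: "Y \<in> sets M" "Y \<subseteq> X0"
  shows "\<exists>P. mrel P \<and> single_valued P \<and> P \<subseteq> E \<union> E\<inverse> \<and> Domain P = conn E `` Y - Y \<and>
    P \<inter> P\<inverse> = {} \<and> (\<forall>x\<in>conn E `` Y. \<exists>y\<in>Y. (x, y) \<in> P\<^sup>*)"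
proof -
  let ?E = "E \<union> E\<inverse>"
  have mE: "mrel ?E" using E by (intro mrel_Un mrel_converse)
  define B where "B = rec_nat Y (\<lambda>_ B. B \<union> ?E `` B)"
  have B0: "B 0 = Y" and BS: "B (Suc n) = B n \<union> ?E `` B n" for n by (simp_all add: B_def)
  have BM: "B n \<in> sets M" for n
    by (induction n) (use Y mrel_Image[OF mE] in \<open>auto simp: B0 BS\<close>)
  have mono: "B m \<subseteq> B n" if "m \<le> n" for m n
    by (rule lift_Suc_mono_le[of B, OF _ that]) (auto simp: BS)
  have UB: "(\<Union>n. B n) = conn E `` Y"
  proof
    have "B n \<subseteq> conn E `` Y" for n
    proof (induction n)
      case (Suc n)
      have "?E `` B n \<subseteq> conn E `` Y"
      proof
        fix z assume "z \<in> ?E `` B n"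
        then obtain x where x: "x \<in> B n" "(x, z) \<in> ?E" by blast
        then obtain y where "y \<in> Y" "(y, x) \<in> conn E" using Suc by blast
        then have "(y, z) \<in> conn E" using rtrancl_into_rtrancl[OF _ x(2)] by blast
        then show "z \<in> conn E `` Y" using \<open>y \<in> Y\<close> by blast
      qed
      then show ?case using Suc by (simp add: BS)
    qed (auto simp: B0)
    then show "(\<Union>n. B n) \<subseteq> conn E `` Y" by blast
    show "conn E `` Y \<subseteq> (\<Union>n. B n)"
    proof
      fix z assume "z \<in> conn E `` Y"
      then obtain y where "y \<in> Y" "(y, z) \<in> conn E" by blast
      from this(2,1) show "z \<in> (\<Union>n. B n)"
      proof (induction rule: rtrancl_induct)
        case base then show ?case using B0 by blast
      next
        case (step x z)
        then obtain n where "x \<in> B n" by blast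
        then have "z \<in> B (Suc n)" using step.hyps(2) by (auto simp: BS)
        then show ?case by blast
      qed
    qed
  qed
  define T where "T = (\<Union>n. ?E \<inter> (B (Suc n) - B n) \<times> B n)"
  have mT: "mrel T" unfolding T_def by (intro mrel_UN mrel_rect mE sets.Diff BM) auto
  obtain P where P: "mrel P" "single_valued P" "P \<subseteq> T" "Domain P = Domain T"
    using selection[OF mT] by blast
  have PT: "\<exists>n. x \<notin> B n \<and> x \<in> B (Suc n) \<and> y \<in> B n" if "(x, y) \<in> P" for x y
    using that P(3) unfolding T_def by blast
  have dom: "B (Suc n) - B n \<subseteq> Domain P" for n
  proof
    fix x assume x: "x \<in> B (Suc n) - B n"
    then obtain y where y: "y \<in> B n" "(y, x) \<in> ?E" by (auto simp: BS)
    then have "(x, y) \<in> T" using x unfolding T_def by blast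
    then show "x \<in> Domain P" using P(4) by blast
  qed
  have DP: "Domain P = conn E `` Y - Y"
  proof
    show "Domain P \<subseteq> conn E `` Y - Y"
      unfolding UB[symmetric] P(4) T_def using mono[of 0] B0 by auto
    show "conn E `` Y - Y \<subseteq> Domain P"
    proof
      fix x assume x: "x \<in> conn E `` Y - Y"
      then obtain n where "x \<in> B n" using UB by blast
      moreover have "x \<notin> B 0" using x B0 by simp
      ultimately obtain k where "x \<notin> B k" "x \<in> B (Suc k)" by (induction n) auto
      then show "x \<in> Domain P" using dom by blast
    qed
  qed
  have anti: "P \<inter> P\<inverse> = {}"
  proof (rule ccontr)
    assume "P \<inter> P\<inverse> \<noteq> {}"
    then obtain x y where "(x, y) \<in> P" "(y, x) \<in> P" by auto
    then obtain m n where "x \<notin> B n" "y \<in> B n" "y \<notin> B m" "x \<in> B m" using PT by metis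
    then show False using mono[of m n] mono[of n m] by (metis in_mono nat_le_linear)
  qed
  have root: "\<exists>y\<in>Y. (x, y) \<in> P\<^sup>*" if "x \<in> B n" for x n
    using that
  proof (induction n arbitrary: x rule: less_induct)
    case (less n)
    show ?case
    proof (cases "x \<in> Y")
      case False
      then have "x \<in> Domain P" using DP UB less.prems by blast
      then obtain z where z: "(x, z) \<in> P" by blast
      then obtain m where m: "x \<notin> B m" "z \<in> B m" using PT by blast
      then have "m < n" using mono[of n m] less.prems by (meson in_mono linorder_not_le)
      from less.IH[OF this m(2)] show ?thesis using z by (meson converse_rtrancl_into_rtrancl)
    qed auto
  qed
  have "P \<subseteq> E \<union> E\<inverse>" using P(3) unfolding T_def by blast
  moreover have "\<forall>x\<in>conn E `` Y. \<exists>y\<in>Y. (x, y) \<in> P\<^sup>*"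
  proof
    fix x assume "x \<in> conn E `` Y"
    then obtain n where "x \<in> B n" using UB by blast
    then show "\<exists>y\<in>Y. (x, y) \<in> P\<^sup>*" by (rule root)
  qed
  ultimately show ?thesis using P(1,2) DP anti by (intro exI[of _ P] conjI)
qed

text \<open>Forest edges may run along or against \<open>E\<close>. Turning the latter around embeds
  the whole forest in \<open>E\<close>; as \<open>P\<close> contains no edge together with its
  reverse, no edge of \<open>E\<close> is charged twice.\<close>

lemma forest_mass:
  assumes E: "mrel E" and P: "mrel P" "single_valued P" "P \<subseteq> E \<union> E\<inverse>" "P \<inter> P\<inverse> = {}"
  shows "mass (E - (P \<union> P\<inverse>)) + emeasure M (Domain P) \<le> mass E"
proof -
  have PE: "mrel (P \<inter> E)" "mrel (P - E)" "mrel ((P - E)\<inverse>)" "mrel (E - (P \<union> P\<inverse>))"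
    using E P by (auto intro: mrel_Int mrel_Diff mrel_converse mrel_Un)
  have "emeasure M (Domain P) = mass P" using P by (simp add: mass_single_valued)
  also have "\<dots> = mass ((P \<inter> E) \<union> (P - E))" by (simp add: Int_Diff_Un)
  also have "\<dots> = mass (P \<inter> E) + mass (P - E)" using PE by (intro mass_Un_disjoint) auto
  also have "\<dots> = mass (P \<inter> E) + mass ((P - E)\<inverse>)" using mass_converse[OF PE(2)] by simp
  also have "\<dots> = mass ((P \<inter> E) \<union> (P - E)\<inverse>)"
    using P(4) by (intro mass_Un_disjoint[symmetric] PE) auto
  finally have "mass (E - (P \<union> P\<inverse>)) + emeasure M (Domain P) =
      mass (E - (P \<union> P\<inverse>)) + mass ((P \<inter> E) \<union> (P - E)\<inverse>)" by simp
  also have "\<dots> = mass ((E - (P \<union> P\<inverse>)) \<union> ((P \<inter> E) \<union> (P - E)\<inverse>))"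
    by (intro mass_Un_disjoint[symmetric] PE mrel_Un) auto
  also have "\<dots> \<le> mass E" using P(3) by (intro mass_mono) auto
  finally show ?thesis .
qed

text \<open>Collapsing a spanning forest of \<open>E\<close> rooted in \<open>Y\<close> uses up \<open>emeasure M (conn E `` Y - Y)\<close>
  of the mass of \<open>E\<close>; the endpoints of the remaining edges are joined directly to their roots.\<close>

lemma contraction:
  assumes E: "mrel E" and Y: "Y \<in> sets M" "Y \<subseteq> X0"
    and c: "mass E \<le> c + emeasure M (conn E `` Y - Y)"
  shows "\<exists>F. mrel F \<and> mass F \<le> 3 * c \<and> (\<forall>y\<in>Y. \<forall>y'\<in>Y. (y, y') \<in> conn E \<longrightarrow> (y, y') \<in> conn F)"
proof -
  obtain P where P: "mrel P" "single_valued P" "P \<subseteq> E \<union> E\<inverse>" and DP: "Domain P = conn E `` Y - Y"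
    and anti: "P \<inter> P\<inverse> = {}" and root: "\<And>x. x \<in> conn E `` Y \<Longrightarrow> \<exists>y\<in>Y. (x, y) \<in> P\<^sup>*"
    using forest[OF E Y] by blast
  define E' where "E' = E - (P \<union> P\<inverse>)"
  have E': "mrel E'" unfolding E'_def using E P by (intro mrel_Diff mrel_Un mrel_converse)
  have "mass E' + emeasure M (Domain P) \<le> c + emeasure M (Domain P)"
    using forest_mass[OF E P anti] c unfolding E'_def DP by (rule order_trans)
  \<comment> \<open>The measure of the domain of \<open>P\<close> is finite and can be
    cancelled.\<close>
  then have massE': "mass E' \<le> c"
    by (simp add: add.commute[of _ "emeasure M (Domain P)"] emeasure_eq_measure)
  have YP: "Y \<inter> Domain P = {}" using DP by blast
  \<comment> \<open>Two points reached from one start under a single-valued relation lie on one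
    walk, and no walk leaves a point of \<open>Y\<close>.\<close>
  have root_unique: "y = y'" if "(x, y) \<in> P\<^sup>*" "(x, y') \<in> P\<^sup>*" "y \<in> Y" "y' \<in> Y" for x y y'
  proof -
    have "(y, y') \<in> P\<^sup>* \<or> (y', y) \<in> P\<^sup>*"
      using single_valued_confluent[OF P(2) that(1,2)] .
    then show ?thesis using that YP by (metis Domain.DomainI converse_rtranclE disjoint_iff)
  qed
  define ends where "ends = Domain E' \<union> Range E'"
  have ends: "ends \<in> sets M" unfolding ends_def using mrel_Domain[OF E'] mrel_Range[OF E'] by auto
  \<comment> \<open>Assigns to each end of a leftover edge its root; \<open>Id_on X0\<close> serves
    the ends that already lie in \<open>Y\<close>. There are at most two ends per edge, whence the
    factor 3 in the mass of \<open>F\<close>.\<close>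
  define \<rho> where "\<rho> = ((Id_on X0 \<union> P\<^sup>+) \<inter> ends \<times> Y)"
  have m\<rho>: "mrel \<rho>" unfolding \<rho>_def
    by (intro mrel_rect mrel_Un mrel_Id_on mrel_trancl P ends Y X0) simp
  have \<rho>P: "(x, y) \<in> P\<^sup>*" if "(x, y) \<in> \<rho>" for x y
    using that unfolding \<rho>_def by (auto intro: trancl_into_rtrancl)
  have P\<rho>: "(x, y) \<in> \<rho>" if "(x, y) \<in> P\<^sup>*" "x \<in> ends" "y \<in> Y" for x y
  proof -
    have "x \<in> X0" using that(2) mrel_X0[OF E'] unfolding ends_def by blast
    then show ?thesis using that unfolding \<rho>_def by (auto simp: rtrancl_eq_or_trancl)
  qed
  have "single_valued \<rho>"
  proof (rule single_valuedI)
    fix x y z assume xyz: "(x, y) \<in> \<rho>" "(x, z) \<in> \<rho>"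
    have "y \<in> Y" "z \<in> Y" using xyz unfolding \<rho>_def by blast+
    then show "y = z" using root_unique[OF \<rho>P[OF xyz(1)] \<rho>P[OF xyz(2)]] by blast
  qed
  then have "mass \<rho> = emeasure M (Domain \<rho>)" using m\<rho> by (rule mass_single_valued[rotated])
  also have "\<dots> \<le> emeasure M ends" by (intro emeasure_mono ends) (auto simp: \<rho>_def)
  also have "\<dots> \<le> emeasure M (Domain E') + emeasure M (Range E')"
    unfolding ends_def using mrel_Domain[OF E'] mrel_Range[OF E'] by (intro emeasure_subadditive)
  also have "\<dots> \<le> mass E' + mass E'" by (intro add_mono Domain_mass Range_mass E')
  finally have mass\<rho>: "mass \<rho> \<le> mass E' + mass E'" .
  define F where "F = E' \<union> \<rho>"
  have mF: "mrel F" unfolding F_def by (intro mrel_Un E' m\<rho>)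
  have "mass F \<le> mass E' + mass \<rho>" unfolding F_def by (intro mass_Un E' m\<rho>)
  also have "\<dots> \<le> c + (c + c)"
    using mass\<rho> massE' by (intro add_mono) (auto intro: order_trans add_mono)
  also have "\<dots> = 3 * c"
  proof -
    have "3 * c = (1 + (1 + 1)) * c" by simp
    then show ?thesis by (simp only: distrib_right mult_1)
  qed
  finally have massF: "mass F \<le> 3 * c" .
  \<comment> \<open>Along a path in \<open>E\<close>, a forest edge leaves the root unchanged, and a
    leftover edge changes it to a root joined to the old one by \<open>F\<close>.\<close>
  have follow: "\<exists>r\<in>Y. (z, r) \<in> P\<^sup>* \<and> (y, r) \<in> conn F" if y: "y \<in> Y" and yz: "(y, z) \<in> conn E" for y z
    using yz
  proof (induction rule: rtrancl_induct)
    case base then show ?case using y by blast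
  next
    case (step z w)
    then obtain r where r: "r \<in> Y" "(z, r) \<in> P\<^sup>*" "(y, r) \<in> conn F" by blast
    have "w \<in> conn E `` Y" using y rtrancl_into_rtrancl[OF step.hyps(1,2)] by blast
    then obtain s where s: "s \<in> Y" "(w, s) \<in> P\<^sup>*" using root by blast
    consider "(z, w) \<in> P" | "(w, z) \<in> P" | "(z, w) \<in> E' \<or> (w, z) \<in> E'"
      using step.hyps(2) unfolding E'_def by blast
    then show ?case
    proof cases
      case 1
      then have "(z, s) \<in> P\<^sup>*" using s by (meson converse_rtrancl_into_rtrancl)
      then have "r = s" using root_unique r s by blast
      then show ?thesis using r s by blast
    next
      case 2
      then have "(w, r) \<in> P\<^sup>*" using r by (meson converse_rtrancl_into_rtrancl)
      then show ?thesis using r by blast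
    next
      case 3
      then have "z \<in> ends" "w \<in> ends" unfolding ends_def by blast+
      then have "(z, r) \<in> conn F" "(w, s) \<in> conn F"
        using P\<rho> r s unfolding F_def by blast+
      moreover have "(z, w) \<in> conn F" using 3 unfolding F_def by blast
      ultimately have "(y, s) \<in> conn F" using r(3) by (meson conn_trans conn_sym)
      then show ?thesis using s by blast
    qed
  qed
  have "(y, y') \<in> conn F" if "y \<in> Y" "y' \<in> Y" "(y, y') \<in> conn E" for y y'
    using follow[OF that(1,3)] root_unique[of y' y'] that(2) by blast
  then show ?thesis using mF massF by blast
qed

end


subsection \<open>The isoperimetric estimate\<close>

lemma count_inj_le:
  assumes "inj_on f B" "f ` B \<subseteq> T"
  shows "emeasure (count_space UNIV) B \<le> emeasure (count_space UNIV) T"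
proof (cases "finite T")
  case True
  then have "finite B" using assms by (meson finite_imageD finite_subset)
  moreover have "card B \<le> card T" using card_inj_on_le[OF assms True] .
  ultimately show ?thesis using True by (simp add: emeasure_count_space)
qed (simp add: emeasure_count_space)

context countable_pmp_relation
begin

text \<open>The generating pieces may overlap, while \<open>finite_graphing\<close> asks for a
  partition. Cutting off overlaps keeps pieces injective; empty remainders are dropped, since parts
  of a partition are nonempty.\<close>

lemma finite_union_partition:
  assumes "finite \<F>" "\<And>E. E \<in> \<F> \<Longrightarrow> mrel E \<and> bisv E"
  shows "\<exists>\<P>. finite \<P> \<and> partition_on (\<Union>\<F>) \<P> \<and> (\<forall>\<phi>\<in>\<P>. partial_automorphism M R \<phi>)"
  using assms
proof (induction rule: finite_induct)
  case empty
  show ?case by (intro exI[of _ "{}"]) (simp add: partition_on_def)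
next
  case (insert E \<F>)
  then obtain \<P> where P: "finite \<P>" "partition_on (\<Union>\<F>) \<P>" "\<forall>\<phi>\<in>\<P>. partial_automorphism M R \<phi>"
    by blast
  have D: "mrel (E - \<Union>\<F>)"
  proof -
    have "mrel (\<Union>E\<in>\<F>. E)" using insert by (intro mrel_UN) (auto simp: countable_finite)
    then show ?thesis using insert.prems by (intro mrel_Diff) auto
  qed
  show ?case
  proof (cases "E \<subseteq> \<Union>\<F>")
    case True
    then have "\<Union>(insert E \<F>) = \<Union>\<F>" by blast
    then show ?thesis using P by auto
  next
    case False
    have "partition_on (\<Union>(insert E \<F>)) (insert (E - \<Union>\<F>) \<P>)"
    proof (rule partition_onI)
      show "\<Union>(insert (E - \<Union>\<F>) \<P>) = \<Union>(insert E \<F>)" using partition_onD1[OF P(2)] by blast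
      show "{} \<notin> insert (E - \<Union>\<F>) \<P>"
        using False partition_onD3[OF P(2)] by blast
      show "disjnt p q" if "p \<in> insert (E - \<Union>\<F>) \<P>" "q \<in> insert (E - \<Union>\<F>) \<P>" "p \<noteq> q" for p q
        using that partition_onD1[OF P(2)] partition_onD2[OF P(2)] unfolding pairwise_def disjnt_def by blast
    qed
    moreover have "partial_automorphism M R (E - \<Union>\<F>)"
    proof (rule bisv_partial_automorphism[OF D])
      show "bisv (E - \<Union>\<F>)" by (rule bisv_subset[of E]) (use insert.prems in auto)
    qed
    ultimately show ?thesis using P by (intro exI[of _ "insert (E - \<Union>\<F>) \<P>"]) auto
  qed
qed

text \<open>Provides the change of variables along rotations. Invariance is applied to the converse
  graph, because preimages under \<open>f\<close> are images under the converse.\<close>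

lemma full_group_function:
  assumes \<phi>: "partial_automorphism M R \<phi>" "partial_automorphism M R (\<phi>\<inverse>)" "bisv \<phi>"
    and dom: "Domain \<phi> = space M" "Range \<phi> = space M"
    and pre: "\<And>C. C \<in> sets M \<Longrightarrow> \<phi>\<inverse> `` C \<in> sets M"
    and f: "\<And>x y. (x, y) \<in> \<phi> \<Longrightarrow> f x = y"
  shows "f \<in> M \<rightarrow>\<^sub>M M" "distr M M f = M"
proof -
  have vim: "f -` C \<inter> space M = \<phi>\<inverse> `` C" if "C \<in> sets M" for C
    using dom f that by blast
  show m: "f \<in> M \<rightarrow>\<^sub>M M"
  proof (rule measurableI)
    show "f x \<in> space M" if "x \<in> space M" for x using that dom f by blast
  qed (simp add: vim pre)
  show "distr M M f = M"
  proof (rule measure_eqI)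
    fix C assume "C \<in> sets (distr M M f)"
    then have C: "C \<in> sets M" by simp
    have "C \<subseteq> Domain (\<phi>\<inverse>)" using sets.sets_into_space[OF C] dom by simp
    then have "emeasure M (\<phi>\<inverse> `` C) = emeasure M C"
      using II1 \<phi>(2) C unfolding type_II1_def by blast
    then show "emeasure (distr M M f) C = emeasure M C"
      using C m by (simp add: emeasure_distr vim)
  qed simp
qed

lemma generatesI:
  assumes N: "N \<in> null_sets M"
    and c: "\<And>x y. (x, y) \<in> R \<Longrightarrow> x \<notin> N \<Longrightarrow> (x, y) \<in> conn K"
  shows "generates M R K"
proof -
  define B where "B = R \<inter> N \<times> space M"
  have "B \<in> sets (M \<Otimes>\<^sub>M M)" unfolding B_def using R_meas N by auto
  moreover have "{p \<in> R. p \<notin> conn K} \<subseteq> B"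
  proof clarify
    fix x y assume "(x, y) \<in> R" "(x, y) \<notin> conn K"
    then show "(x, y) \<in> B" using c R_space unfolding B_def by blast
  qed
  moreover have "h_measure M R B = 0"
  proof -
    have "AE x in M. x \<notin> N" using AE_not_in[OF N] .
    then have "AE x in M. emeasure (count_space UNIV) (B \<inter> fibre R x) = 0"
    proof (rule AE_mp, intro AE_I2 impI)
      fix x assume "x \<notin> N"
      then have "B \<inter> fibre R x = {}" by (auto simp: B_def fibre_def)
      then show "emeasure (count_space UNIV) (B \<inter> fibre R x) = 0" by simp
    qed
    then show ?thesis unfolding h_measure_def by (simp add: nn_integral_0_iff_AE nn_integral_cong_AE)
  qed
  ultimately show ?thesis
    unfolding generates_def h_null_def by (intro bexI[of _ B]) (auto simp: B_def)
qed

text \<open>All rotations are made total by the identity on one common null set; this accounts for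
  their overlaps there.\<close>

lemma h_null_subset_Id:
  assumes N: "N \<in> null_sets M" and E: "E \<subseteq> Id_on N"
  shows "h_null M R E"
proof -
  have NS: "N \<in> sets M" "N \<subseteq> space M" using N sets.sets_into_space by auto
  have "Id_on N = Id_on (space M) \<inter> N \<times> N" using NS by auto
  then have "Id_on N \<in> sets (M \<Otimes>\<^sub>M M)" using diag NS by auto
  moreover have "Id_on N \<subseteq> R" using NS R_refl by auto
  moreover have "h_measure M R (Id_on N) = 0"
  proof -
    have "AE x in M. x \<notin> N" using AE_not_in[OF N] .
    then have "AE x in M. emeasure (count_space UNIV) (Id_on N \<inter> fibre R x) = 0"
    proof (rule AE_mp, intro AE_I2 impI)
      fix x assume "x \<notin> N"
      then have "Id_on N \<inter> fibre R x = {}" by (auto simp: fibre_def)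
      then show "emeasure (count_space UNIV) (Id_on N \<inter> fibre R x) = 0" by simp
    qed
    then show ?thesis unfolding h_measure_def by (simp add: nn_integral_0_iff_AE nn_integral_cong_AE)
  qed
  ultimately show ?thesis unfolding h_null_def using E by blast
qed

text \<open>Over x, a boundary edge is an edge of \<open>K'\<close> that starts or ends at some
  \<open>g m x\<close>, so out-degrees and in-degrees at these points bound the count. Since
  \<open>g m\<close> preserves the measure, each of the two degrees integrates to
  \<open>mass K'\<close>.\<close>

lemma edge_boundary_bound:
  assumes K': "mrel K'" and fin: "finite I"
    and g: "\<And>m. m \<in> I \<Longrightarrow> g m \<in> M \<rightarrow>\<^sub>M M" "\<And>m. m \<in> I \<Longrightarrow> distr M M (g m) = M"
    and N: "N \<in> null_sets M"
    and bd: "\<And>x y z. x \<notin> N \<Longrightarrow> ((x, y), (x, z)) \<in> edge_boundary M R K A \<Longrightarrow>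
        (y, z) \<in> K' \<and> (\<exists>m\<in>I. y = g m x \<or> z = g m x)"
  shows "edge_measure M R K (edge_boundary M R K A) \<le> of_nat (2 * card I) * mass K'"
proof -
  let ?c = "\<lambda>E x. emeasure (count_space UNIV) (E `` {x})"
  have "emeasure (count_space UNIV) (edge_boundary M R K A \<inter> cayley_edges_at R K x)
      \<le> (\<Sum>m\<in>I. ?c K' (g m x) + ?c (K'\<inverse>) (g m x))" if x: "x \<notin> N" for x
  proof -
    let ?B = "edge_boundary M R K A \<inter> cayley_edges_at R K x"
    let ?T = "\<lambda>m. {g m x} \<times> (K' `` {g m x}) \<union> (K'\<inverse> `` {g m x}) \<times> {g m x}"
    have form: "\<exists>y z. p = ((x, y), (x, z))" if "p \<in> ?B" for p
      using that by (cases p) (auto simp: cayley_edges_at_def fibre_def)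
    have "emeasure (count_space UNIV) ?B \<le> emeasure (count_space UNIV) (\<Union>m\<in>I. ?T m)"
    \<comment> \<open>Both vertices of an edge over x have first coordinate x, so the edge is
      determined by the pair of second coordinates.\<close>
    proof (rule count_inj_le[of "\<lambda>p. (snd (fst p), snd (snd p))"])
      show "inj_on (\<lambda>p. (snd (fst p), snd (snd p))) ?B"
      proof (rule inj_onI)
        fix p q assume "p \<in> ?B" "q \<in> ?B" "(snd (fst p), snd (snd p)) = (snd (fst q), snd (snd q))"
        then show "p = q" using form[of p] form[of q] by auto
      qed
      show "(\<lambda>p. (snd (fst p), snd (snd p))) ` ?B \<subseteq> (\<Union>m\<in>I. ?T m)"
      proof
        fix q assume "q \<in> (\<lambda>p. (snd (fst p), snd (snd p))) ` ?B"
        then obtain p where p: "p \<in> ?B" "q = (snd (fst p), snd (snd p))" by blast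
        obtain y z where yz: "p = ((x, y), (x, z))" using form[OF p(1)] by blast
        have "((x, y), (x, z)) \<in> edge_boundary M R K A" using p yz by blast
        from bd[OF x this] obtain m where "(y, z) \<in> K'" "m \<in> I" "y = g m x \<or> z = g m x" by blast
        then show "q \<in> (\<Union>m\<in>I. ?T m)" using p(2) yz by auto
      qed
    qed
    also have "\<dots> \<le> (\<Sum>m\<in>I. emeasure (count_space UNIV) (?T m))"
      by (intro emeasure_subadditive_finite fin) auto
    also have "\<dots> \<le> (\<Sum>m\<in>I. ?c K' (g m x) + ?c (K'\<inverse>) (g m x))"
    proof (rule sum_mono)
      fix m
      have "emeasure (count_space UNIV) (?T m) \<le> emeasure (count_space UNIV) ({g m x} \<times> (K' `` {g m x}))
          + emeasure (count_space UNIV) ((K'\<inverse> `` {g m x}) \<times> {g m x})"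
        by (intro emeasure_subadditive) auto
      also have "\<dots> \<le> ?c K' (g m x) + ?c (K'\<inverse>) (g m x)"
        by (intro add_mono count_inj_le[of snd] count_inj_le[of fst]) (auto simp: inj_on_def)
      finally show "emeasure (count_space UNIV) (?T m) \<le> ?c K' (g m x) + ?c (K'\<inverse>) (g m x)" .
    qed
    finally show ?thesis .
  qed
  then have "AE x in M. emeasure (count_space UNIV) (edge_boundary M R K A \<inter> cayley_edges_at R K x)
      \<le> (\<Sum>m\<in>I. ?c K' (g m x) + ?c (K'\<inverse>) (g m x))"
    using AE_not_in[OF N] by auto
  then have "edge_measure M R K (edge_boundary M R K A)
      \<le> (\<integral>\<^sup>+x. (\<Sum>m\<in>I. ?c K' (g m x) + ?c (K'\<inverse>) (g m x)) \<partial>M)"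
    unfolding edge_measure_def by (rule nn_integral_mono_AE)
  also have "\<dots> = (\<Sum>m\<in>I. \<integral>\<^sup>+x. ?c K' (g m x) + ?c (K'\<inverse>) (g m x) \<partial>M)"
    using measurable_compose[OF g(1) count_measurable[OF K']]
      measurable_compose[OF g(1) count_measurable[OF mrel_converse[OF K']]]
    by (intro nn_integral_sum) simp
  also have "\<dots> = (\<Sum>m\<in>I. mass K' + mass K')"
  proof (rule sum.cong[OF refl])
    fix m assume m: "m \<in> I"
    have *: "(\<integral>\<^sup>+x. ?c E (g m x) \<partial>M) = mass E" if "mrel E" for E
    proof -
      have "(\<integral>\<^sup>+x. ?c E x \<partial>distr M M (g m)) = (\<integral>\<^sup>+x. ?c E (g m x) \<partial>M)"
        using count_measurable[OF that] by (intro nn_integral_distr g(1)[OF m]) simp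
      then show ?thesis unfolding g(2)[OF m] mass_def by simp
    qed
    have "(\<integral>\<^sup>+x. ?c K' (g m x) + ?c (K'\<inverse>) (g m x) \<partial>M) = mass K' + mass (K'\<inverse>)"
      using measurable_compose[OF g(1)[OF m] count_measurable[OF K']]
        measurable_compose[OF g(1)[OF m] count_measurable[OF mrel_converse[OF K']]]
        *[OF K'] *[OF mrel_converse[OF K']]
      by (simp add: nn_integral_add)
    then show "(\<integral>\<^sup>+x. ?c K' (g m x) + ?c (K'\<inverse>) (g m x) \<partial>M) = mass K' + mass K'"
      using mass_converse[OF K'] by simp
  qed
  also have "\<dots> = of_nat (2 * card I) * mass K'" by (simp add: mult_2[symmetric] mult.assoc mult.left_commute)
  finally show ?thesis .
qed

end


section \<open>Finite classes and their rotations\<close>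

lemma add_mod_inj:
  fixes i j m n :: nat
  assumes "i < n" "j < n" "(i + m) mod n = (j + m) mod n"
  shows "i = j"
proof -
  have "i = j" if "i \<le> j" "j < n" "(i + m) mod n = (j + m) mod n" for i j
  proof -
    have "n dvd (j + m) - (i + m)"
      using that by (intro mod_eq_dvd_iff_nat[THEN iffD1]) auto
    then have "n dvd j - i" by simp
    then show ?thesis using that by (auto dest: dvd_imp_le)
  qed
  then show ?thesis using assms by (metis nat_le_linear)
qed

lemma add_mod_surj:
  fixes i j n :: nat
  assumes "i < n" "j < n"
  shows "\<exists>m<n. (i + m) mod n = j"
proof (intro exI[of _ "(n - i + j) mod n"] conjI)
  have "(i + (n - i + j) mod n) mod n = (i + (n - i + j)) mod n" by (rule mod_add_right_eq)
  also have "i + (n - i + j) = n + j" using assms by simp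
  finally show "(i + (n - i + j) mod n) mod n = j" using assms by simp
qed (use assms in simp)

context countable_pmp_relation
begin

text \<open>The images \<open>\<theta> j u\<close>, \<open>j < n\<close>, of the points \<open>u\<close> of a set of measure \<open>1 / n\<close> form the classes of
  a subrelation all of whose classes have \<open>n\<close> elements.\<close>

lemma uniform_columns:
  fixes n :: nat
  assumes n: "n > 0"
  shows "\<exists>\<theta> U. (\<forall>j<n. mrel (\<theta> j) \<and> bisv (\<theta> j) \<and> Domain (\<theta> j) = U \<and> emeasure M (Range (\<theta> j)) = ennreal (1 / n)) \<and>
    (\<forall>i<n. \<forall>j<n. i \<noteq> j \<longrightarrow> Range (\<theta> i) \<inter> Range (\<theta> j) = {}) \<and>
    space M - (\<Union>j<n. Range (\<theta> j)) \<in> null_sets M"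
proof -
  obtain X1 where X1: "X1 \<in> sets M" "prob X1 = 1 / n"
    using nonatomic_measure_value[OF nonatomic, of "1 / n"] n by auto
  \<comment> \<open>The same set is spread n times; the total is exactly 1, so the targets fill the
    space up to a null set.\<close>
  define Q where "Q j = (if j < n then X1 else {})" for j
  have "(\<Sum>j. emeasure M (Q j)) = (\<Sum>j<n. emeasure M (Q j))"
    by (rule suminf_finite) (auto simp: Q_def)
  also have "\<dots> = (\<Sum>j<n. ennreal (1 / n))"
    by (intro sum.cong) (auto simp: Q_def X1 emeasure_eq_measure)
  also have "\<dots> = 1"
    using n by (simp add: ennreal_of_nat_eq_real_of_nat ennreal_mult[symmetric])
  finally have sumQ: "(\<Sum>j. emeasure M (Q j)) \<le> 1" by simp
  have QM: "Q j \<in> sets M" for j using X1 by (simp add: Q_def)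
  obtain \<sigma> where \<sigma>: "\<And>j. mrel (\<sigma> j)" "\<And>j. bisv (\<sigma> j)" "\<And>j. Domain (\<sigma> j) \<subseteq> Q j"
      "\<And>j. Q j - Domain (\<sigma> j) \<in> null_sets M" "disjoint_family (\<lambda>j. Range (\<sigma> j))"
    using spread[OF QM sumQ] by blast
  \<comment> \<open>Only points with an image in every column are kept, so that all classes have
    exactly n points.\<close>
  define U where "U = (\<Inter>j\<in>{..<n}. Domain (\<sigma> j))"
  have UM: "U \<in> sets M" unfolding U_def using n mrel_Domain[OF \<sigma>(1)] by (intro sets.finite_INT) auto
  have UX: "U \<subseteq> X1" using \<sigma>(3)[of 0] n unfolding U_def Q_def by auto
  have "(\<Union>j\<in>{..<n}. Q j - Domain (\<sigma> j)) \<in> null_sets M" by (intro null_sets_UN') (auto simp: \<sigma>)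
  moreover have "X1 - U \<subseteq> (\<Union>j\<in>{..<n}. Q j - Domain (\<sigma> j))" by (auto simp: U_def Q_def)
  ultimately have "X1 - U \<in> null_sets M"
    using null_sets_subset[OF _ sets.Diff[OF X1(1) UM]] by simp
  then have "emeasure M (U \<union> (X1 - U)) = emeasure M U" using UM by (rule emeasure_Un_null_set[rotated])
  moreover have "U \<union> (X1 - U) = X1" using UX by blast
  ultimately have mU: "emeasure M U = ennreal (1 / n)" using X1 by (simp add: emeasure_eq_measure)
  define \<theta> where "\<theta> j = \<sigma> j \<inter> U \<times> space M" for j
  have m: "mrel (\<theta> j)" for j unfolding \<theta>_def by (intro mrel_rect \<sigma> UM) simp
  have b: "bisv (\<theta> j)" for j by (rule bisv_subset[OF \<sigma>(2)[of j]]) (auto simp: \<theta>_def)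
  have D: "Domain (\<theta> j) = U" if "j < n" for j
    using that mrel_space[OF \<sigma>(1)[of j]] unfolding \<theta>_def U_def by blast
  have R: "emeasure M (Range (\<theta> j)) = ennreal (1 / n)" if "j < n" for j
    using bisv_measure[OF m b] D[OF that] mU by simp
  have dj: "Range (\<theta> i) \<inter> Range (\<theta> j) = {}" if "i \<noteq> j" for i j
    using \<sigma>(5) that unfolding disjoint_family_on_def \<theta>_def by blast
  have WM: "(\<Union>j<n. Range (\<theta> j)) \<in> sets M" using mrel_Range[OF m] by auto
  have "emeasure M (\<Union>j<n. Range (\<theta> j)) = (\<Sum>j<n. emeasure M (Range (\<theta> j)))"
    using mrel_Range[OF m] dj by (intro sum_emeasure[symmetric]) (auto simp: disjoint_family_on_def)
  also have "\<dots> = (\<Sum>j<n. ennreal (1 / n))" by (intro sum.cong) (auto simp: R)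
  also have "\<dots> = 1" using n by (simp add: ennreal_of_nat_eq_real_of_nat ennreal_mult[symmetric])
  finally have "space M - (\<Union>j<n. Range (\<theta> j)) \<in> null_sets M"
    using emeasure_compl[OF WM] WM by (auto simp: emeasure_space_1)
  then show ?thesis using m b D R dj by (intro exI[of _ \<theta>] exI[of _ U]) auto
qed

text \<open>Write c for \<open>d + ennreal (1 / n)\<close>. Contraction leaves mass at most 3 c,
  each of the three replacing automorphisms at most doubles this, and together they have mass at
  most 18 c. Every rotation meets their edges at either end, which gives 36 c per symmetric vertex.
  The hypothesis \<open>small\<close> provides room for the copies of endpoints.\<close>

lemma isoperimetric_bound:
  fixes d :: ennreal and n :: nat
  assumes E: "mrel E" and gen: "\<And>x y. (x, y) \<in> R0 \<Longrightarrow> (x, y) \<in> conn E"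
    and mass: "mass E \<le> 1 + d" and n: "n > 0" and small: "6 * (d + ennreal (1 / n)) \<le> 1"
  shows "uniform_isoperimetric_constant M R \<le> 36 * (d + ennreal (1 / n))"
proof -
  define c where "c = d + ennreal (1 / n)"
  from uniform_columns[OF n] obtain \<theta> U where
    \<theta>0: "\<forall>j<n. mrel (\<theta> j) \<and> bisv (\<theta> j) \<and> Domain (\<theta> j) = U \<and> emeasure M (Range (\<theta> j)) = ennreal (1 / n)"
    and \<theta>1: "\<forall>i<n. \<forall>j<n. i \<noteq> j \<longrightarrow> Range (\<theta> i) \<inter> Range (\<theta> j) = {}"
    and N0': "space M - (\<Union>j<n. Range (\<theta> j)) \<in> null_sets M"
    by (elim exE conjE)
  have \<theta>: "mrel (\<theta> j)" "bisv (\<theta> j)" "Domain (\<theta> j) = U" "emeasure M (Range (\<theta> j)) = ennreal (1 / n)"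
    if "j < n" for j using \<theta>0 that by simp_all
  have \<theta>_disj: "Range (\<theta> i) \<inter> Range (\<theta> j) = {}" if "i < n" "j < n" "i \<noteq> j" for i j
    using \<theta>1 that by simp
  define W where "W = (\<Union>j<n. Range (\<theta> j))"
  define N0 where "N0 = space M - W"
  have N0: "N0 \<in> null_sets M" using N0' unfolding N0_def W_def .
  have WM: "W \<in> sets M" unfolding W_def using mrel_Range[OF \<theta>(1)] by auto
  have Wsp: "W \<subseteq> space M" using WM sets.sets_into_space by blast
  have idx: "i = j \<and> u = v" if "i < n" "j < n" "(u, x) \<in> \<theta> i" "(v, x) \<in> \<theta> j" for i j u v x
  proof -
    have "i = j" using \<theta>_disj[OF that(1,2)] that(3,4) by blast
    then show ?thesis using bisv_left[OF \<theta>(2)[OF that(1)] that(3)] that(4) by blast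
  qed
  \<comment> \<open>Moves within each class from column i to column j.\<close>
  define s where "s i j = (\<theta> i)\<inverse> O \<theta> j" for i j
  have sI: "(x, y) \<in> s i j" if "(u, x) \<in> \<theta> i" "(u, y) \<in> \<theta> j" for u x y i j
    using that unfolding s_def by blast
  have sD: "\<exists>u. (u, x) \<in> \<theta> i \<and> (u, y) \<in> \<theta> j" if "(x, y) \<in> s i j" for x y i j
    using that unfolding s_def by blast
  have sm: "mrel (s i j)" and sb: "bisv (s i j)" if "i < n" "j < n" for i j
    unfolding s_def using that by (auto intro: mrel_relcomp mrel_converse bisv_relcomp bisv_converse \<theta>)
  have modn: "(i + m) mod n < n" for i m using n by simp
  \<comment> \<open>Rotation by m columns, indices being taken modulo n; m = 0 gives the identity on
    \<open>W\<close>.\<close>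
  define gE where "gE m = (\<Union>i\<in>{..<n}. s i ((i + m) mod n))" for m
  have gEm: "mrel (gE m)" for m unfolding gE_def by (intro mrel_UN sm) (auto simp: modn)
  have gED: "\<exists>i u. i < n \<and> (u, x) \<in> \<theta> i \<and> (u, y) \<in> \<theta> ((i + m) mod n)" if "(x, y) \<in> gE m" for x y m
    using that sD unfolding gE_def by blast
  have gEI: "(x, y) \<in> gE m" if "i < n" "(u, x) \<in> \<theta> i" "(u, y) \<in> \<theta> ((i + m) mod n)" for x y m i u
    using that sI unfolding gE_def by blast
  have gEb: "bisv (gE m)" for m
  proof (rule bisvI)
    fix x y z assume "(x, y) \<in> gE m" and xz: "(x, z) \<in> gE m"
    then obtain i u where 1: "i < n" "(u, x) \<in> \<theta> i" "(u, y) \<in> \<theta> ((i + m) mod n)" using gED by blast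
    obtain j v where 2: "j < n" "(v, x) \<in> \<theta> j" "(v, z) \<in> \<theta> ((j + m) mod n)" using gED[OF xz] by blast
    have "i = j \<and> u = v" using idx 1 2 by blast
    then show "y = z" using 1 2 bisv_right[OF \<theta>(2)[OF modn]] by blast
  next
    fix x y z assume "(x, z) \<in> gE m" and yz: "(y, z) \<in> gE m"
    then obtain i u where 1: "i < n" "(u, x) \<in> \<theta> i" "(u, z) \<in> \<theta> ((i + m) mod n)" using gED by blast
    obtain j v where 2: "j < n" "(v, y) \<in> \<theta> j" "(v, z) \<in> \<theta> ((j + m) mod n)" using gED[OF yz] by blast
    have "(i + m) mod n = (j + m) mod n \<and> u = v" using idx[OF modn modn 1(3) 2(3)] .
    then have "i = j" "u = v" using add_mod_inj 1(1) 2(1) by blast+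
    then show "x = y" using 1 2 bisv_right[OF \<theta>(2)] by blast
  qed
  have gEdom: "Domain (gE m) = W" for m
  proof
    show "Domain (gE m) \<subseteq> W" using gED unfolding W_def by blast
    show "W \<subseteq> Domain (gE m)"
    proof
      fix x assume "x \<in> W"
      then obtain i u where i: "i < n" "(u, x) \<in> \<theta> i" unfolding W_def by blast
      then have "u \<in> Domain (\<theta> ((i + m) mod n))" using \<theta>(3)[OF i(1)] \<theta>(3)[OF modn] by blast
      then show "x \<in> Domain (gE m)" using gEI[OF i] by blast
    qed
  qed
  have gEran: "Range (gE m) = W" for m
  proof
    show "Range (gE m) \<subseteq> W"
    proof
      fix y assume "y \<in> Range (gE m)"
      then obtain x where "(x, y) \<in> gE m" by blast
      then obtain i u where "(u, y) \<in> \<theta> ((i + m) mod n)" using gED by blast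
      then show "y \<in> W" using modn[of i m] unfolding W_def by blast
    qed
    show "W \<subseteq> Range (gE m)"
    proof
      fix y assume "y \<in> W"
      then obtain j u where j: "j < n" "(u, y) \<in> \<theta> j" unfolding W_def by blast
      obtain i where i: "i < n" "(m mod n + i) mod n = j" using add_mod_surj[of "m mod n" n j] n j by auto
      then have ij: "(i + m) mod n = j" by (metis add.commute mod_add_left_eq)
      have "u \<in> Domain (\<theta> i)" using \<theta>(3)[OF i(1)] \<theta>(3)[OF j(1)] j(2) by blast
      then obtain x where "(u, x) \<in> \<theta> i" by blast
      then have "(x, y) \<in> gE m" using gEI[OF i(1)] j(2) ij by blast
      then show "y \<in> Range (gE m)" by blast
    qed
  qed
  \<comment> \<open>Elements of the full group must be defined everywhere, so the rotation is
    extended by the identity on the null set that the columns miss.\<close>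
  define g where "g m = gE m \<union> Id_on N0" for m
  have gW: "(x, y) \<in> gE m" if "(x, y) \<in> g m" "x \<in> W" for x y m
    using that unfolding g_def N0_def by blast
  have gb: "bisv (g m)" for m
  proof -
    have disj: "Domain (gE m) \<inter> N0 = {}" "Range (gE m) \<inter> N0 = {}"
      using gEdom[of m] gEran[of m] unfolding N0_def by blast+
    have 1: "y = z" if "(x, y) \<in> g m" "(x, z) \<in> g m" for x y z
      using that bisv_right[OF gEb[of m]] disj(1) unfolding g_def by blast
    have 2: "x = y" if "(x, z) \<in> g m" "(y, z) \<in> g m" for x y z
      using that bisv_left[OF gEb[of m]] disj(2) unfolding g_def by blast
    show ?thesis by (rule bisvI) (fact 1 2)+
  qed
  have gdom: "Domain (g m) = space M" and gran: "Range (g m) = space M" for m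
    using gEdom[of m] gEran[of m] Wsp unfolding g_def N0_def by blast+
  have gR: "g m \<subseteq> R" for m
  proof -
    have "gE m \<subseteq> R" using mrel_R0[OF gEm] R0_R by auto
    moreover have "Id_on N0 \<subseteq> R" using R_refl unfolding N0_def by auto
    ultimately show ?thesis unfolding g_def by blast
  qed
  have gim: "g m `` C \<in> sets M" and gpre: "(g m)\<inverse> `` C \<in> sets M" if "C \<in> sets M" for m C
  proof -
    have "g m `` C = gE m `` C \<union> (N0 \<inter> C)" "(g m)\<inverse> `` C = (gE m)\<inverse> `` C \<union> (N0 \<inter> C)"
      unfolding g_def by blast+
    then show "g m `` C \<in> sets M" "(g m)\<inverse> `` C \<in> sets M"
      using that N0 mrel_Image[OF gEm that] mrel_Image[OF mrel_converse[OF gEm] that] by auto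
  qed
  have gsp: "g m \<subseteq> space M \<times> space M" for m
  proof clarify
    fix x y assume "(x, y) \<in> g m"
    then show "x \<in> space M \<and> y \<in> space M" using gR R_space by blast
  qed
  have gpa: "partial_automorphism M R (g m)" for m
    by (rule partial_automorphismI[OF gb gR gsp]) (simp_all add: gim gpre)
  have gpa': "partial_automorphism M R ((g m)\<inverse>)" for m
  proof (rule partial_automorphismI[OF bisv_converse[OF gb]])
    show "(g m)\<inverse> \<subseteq> R"
    proof clarify
      fix x y assume "(y, x) \<in> g m"
      then show "(x, y) \<in> R" using gR R_sym by blast
    qed
    show "(g m)\<inverse> \<subseteq> space M \<times> space M" using gsp by blast
  qed (simp_all add: gim gpre)
  have gfull: "g m \<in> full_group M R" for m
    unfolding full_group_def using gpa gdom gran by simp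
  define f where "f m x = (THE y. (x, y) \<in> g m)" for m x
  have f: "f m x = y" if "(x, y) \<in> g m" for m x y
    unfolding f_def by (rule the_equality) (use that bisv_right[OF gb] in blast)+
  have fm: "f m \<in> M \<rightarrow>\<^sub>M M" "distr M M (f m) = M" for m
    by (rule full_group_function[of "g m" "f m", OF gpa gpa' gb gdom gran gpre f]; assumption)+
  define A where "A = g ` {..<n}"
  \<comment> \<open>If two rotations agree at a point of \<open>W\<close>, the shifted column
    indices agree modulo n, hence so do the shifts.\<close>
  have inter: "g m \<inter> g m' \<subseteq> Id_on N0" if m: "m < n" "m' < n" "m \<noteq> m'" for m m'
  proof clarify
    fix x y assume 0: "(x, y) \<in> g m" "(x, y) \<in> g m'"
    show "(x, y) \<in> Id_on N0"
    proof (rule ccontr)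
      assume "(x, y) \<notin> Id_on N0"
      then have 1: "(x, y) \<in> gE m" "(x, y) \<in> gE m'" using 0 unfolding g_def by blast+
      obtain i u where i: "i < n" "(u, x) \<in> \<theta> i" "(u, y) \<in> \<theta> ((i + m) mod n)" using gED[OF 1(1)] by blast
      obtain j v where j: "j < n" "(v, x) \<in> \<theta> j" "(v, y) \<in> \<theta> ((j + m') mod n)" using gED[OF 1(2)] by blast
      have "i = j" using idx i j by blast
      then have "(m + i) mod n = (m' + i) mod n" using idx[OF modn modn i(3) j(3)] by (simp add: add.commute)
      then show False using add_mod_inj m by blast
    qed
  qed
  have Wne: "W \<noteq> {}"
  proof
    assume "W = {}"
    then have "space M \<in> null_sets M" using N0 unfolding N0_def by simp
    then show False using emeasure_space_1 by auto
  qed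
  have "inj_on g {..<n}"
  proof (rule inj_onI, rule ccontr)
    fix m m' assume "m \<in> {..<n}" "m' \<in> {..<n}" "g m = g m'" "m \<noteq> m'"
    then have "g m \<subseteq> Id_on N0" using inter[of m m'] by simp
    then have "space M \<subseteq> N0" using gdom[of m] by blast
    then show False using Wne Wsp unfolding N0_def by blast
  qed
  then have cardA: "card A = n" unfolding A_def by (simp add: card_image)
  have Aok: "finite A" "A \<noteq> {}" "disjoint_symmetric_vertices M R A"
  proof -
    show "finite A" "A \<noteq> {}" using n by (auto simp: A_def)
    have "h_null M R (V \<inter> V')" if V: "V \<in> A" "V' \<in> A" "V \<noteq> V'" for V V'
    proof -
      obtain m m' where "m < n" "m' < n" "V = g m" "V' = g m'" using V unfolding A_def by blast
      then show ?thesis using V(3) h_null_subset_Id[OF N0 inter] by blast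
    qed
    then show "disjoint_symmetric_vertices M R A"
      unfolding disjoint_symmetric_vertices_def pairwise_def using gfull by (auto simp: A_def)
  qed
  have AD: "\<exists>i j u. i < n \<and> j < n \<and> (u, x) \<in> \<theta> i \<and> (u, y) \<in> \<theta> j" if xy: "(x, y) \<in> \<Union>A" "x \<in> W" for x y
  proof -
    obtain m where m: "(x, y) \<in> g m" using xy unfolding A_def by blast
    from gED[OF gW[OF m xy(2)]] show ?thesis using modn by blast
  qed
  have AI: "(x, y) \<in> \<Union>A" if "i < n" "j < n" "(u, x) \<in> \<theta> i" "(u, y) \<in> \<theta> j" for x y i j u
  proof -
    note ij = that
    obtain m where m: "m < n" "(i + m) mod n = j" using add_mod_surj[OF ij(1,2)] by blast
    have "(x, y) \<in> gE m" using gEI[OF ij(1,3), of y m] ij(4) m(2) by simp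
    then show ?thesis using m(1) unfolding A_def g_def by blast
  qed
  define Y where "Y = Range (\<theta> 0)"
  have Y: "Y \<in> sets M" "Y \<subseteq> X0" "Y \<subseteq> W"
    unfolding Y_def W_def using mrel_Range[OF \<theta>(1)[OF n]] mrel_X0[OF \<theta>(1)[OF n]] n by auto
  have toY: "\<exists>y\<in>Y. \<exists>j<n. (y, x) \<in> s 0 j" if x: "x \<in> W" for x
  proof -
    obtain j u where j: "j < n" "(u, x) \<in> \<theta> j" using x unfolding W_def by blast
    then have "u \<in> Domain (\<theta> 0)" using \<theta>(3)[OF j(1)] \<theta>(3)[OF n] by blast
    then obtain y where "(u, y) \<in> \<theta> 0" by blast
    then show ?thesis using j sI unfolding Y_def by blast
  qed
  \<comment> \<open>Every point of \<open>W\<close> outside the transversal is joined to it in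
    \<open>E\<close>, and these points have measure 1 - 1 / n. The balance is kept in additive form,
    without subtraction in \<open>ennreal\<close>.\<close>
  have mass': "mass E \<le> c + emeasure M (conn E `` Y - Y)"
  proof -
    have mE: "mrel ((E \<union> E\<inverse>)\<^sup>+)" by (intro mrel_trancl mrel_Un mrel_converse E)
    have "conn E `` Y = Y \<union> (E \<union> E\<inverse>)\<^sup>+ `` Y" unfolding rtrancl_trancl_reflcl by blast
    then have cM: "conn E `` Y - Y \<in> sets M" using Y mrel_Image[OF mE Y(1)] by auto
    have "W \<subseteq> conn E `` Y"
    proof
      fix x assume "x \<in> W"
      then obtain y j where "y \<in> Y" "j < n" "(y, x) \<in> s 0 j" using toY by blast
      then show "x \<in> conn E `` Y" using gen mrel_R0[OF sm[OF n]] by blast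
    qed
    then have "emeasure M (W - Y) \<le> emeasure M (conn E `` Y - Y)" by (intro emeasure_mono cM) auto
    moreover have "1 = ennreal (1 / n) + emeasure M (W - Y)"
    proof -
      have "emeasure M Y + emeasure M (W - Y) = emeasure M (Y \<union> (W - Y))"
        using Y WM by (intro plus_emeasure) auto
      moreover have "Y \<union> (W - Y) = W" using Y by blast
      moreover have "emeasure M (N0 \<union> W) = emeasure M W"
        using emeasure_Un_null_set[OF WM N0] by (simp add: Un_commute)
      moreover have "N0 \<union> W = space M" unfolding N0_def using Wsp by blast
      ultimately show ?thesis using \<theta>(4)[OF n] emeasure_space_1 unfolding Y_def by simp
    qed
    ultimately have "1 \<le> ennreal (1 / n) + emeasure M (conn E `` Y - Y)" by (metis add_left_mono)
    then have "1 + d \<le> ennreal (1 / n) + emeasure M (conn E `` Y - Y) + d" by (rule add_right_mono)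
    with mass have "mass E \<le> ennreal (1 / n) + emeasure M (conn E `` Y - Y) + d" by (rule order_trans)
    then show ?thesis unfolding c_def by (simp only: ac_simps)
  qed
  obtain F where F: "mrel F" "mass F \<le> 3 * c"
      "\<And>y y'. y \<in> Y \<Longrightarrow> y' \<in> Y \<Longrightarrow> (y, y') \<in> conn E \<Longrightarrow> (y, y') \<in> conn F"
    using contraction[OF E Y(1,2) mass'] by blast
  have "2 * mass F \<le> 2 * (3 * c)" by (intro mult_left_mono F) simp
  also have "\<dots> = 6 * c" by (simp add: mult.assoc[symmetric])
  finally have F6: "2 * mass F \<le> 6 * c" .
  then have "2 * mass F \<le> 1" using small unfolding c_def by (rule order_trans)
  from bounded_degree_replacement[OF F(1) this] obtain K1 K2 K3 Z where
    K: "\<forall>K\<in>{K1, K2, K3}. mrel K \<and> bisv K \<and> mass K \<le> 2 * mass F" and Z: "Z \<in> null_sets M"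
    and FK0: "\<forall>(x, y)\<in>F. x \<notin> Z \<longrightarrow> y \<notin> Z \<longrightarrow> (x, y) \<in> conn (K1 \<union> K2 \<union> K3)"
    by (elim exE conjE)
  have FK: "(x, y) \<in> conn (K1 \<union> K2 \<union> K3)" if "(x, y) \<in> F" "x \<notin> Z" "y \<notin> Z" for x y
    using FK0 that by auto
  define K' where "K' = K1 \<union> K2 \<union> K3"
  have K': "mrel K'" unfolding K'_def using K by (intro mrel_Un) auto
  have "mass K' \<le> mass (K1 \<union> K2) + mass K3" unfolding K'_def using K by (intro mass_Un mrel_Un) auto
  also have "\<dots> \<le> (mass K1 + mass K2) + mass K3" using K by (intro add_right_mono mass_Un) auto
  also have "\<dots> \<le> (6 * c + 6 * c) + 6 * c"
    using K F6 by (intro add_mono) (auto intro: order_trans)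
  also have "\<dots> = 18 * c" by (simp add: distrib_right[symmetric])
  finally have massK': "mass K' \<le> 18 * c" .
  \<comment> \<open>The subrelation is generated by the n spokes \<open>s 0 i\<close>, which form a
    star centred in \<open>Y\<close> in each of its classes.\<close>
  define \<F> where "\<F> = {K1, K2, K3} \<union> s 0 ` {..<n}"
  define KK where "KK = \<Union>\<F>"
  have KKeq: "KK = K' \<union> (\<Union>i<n. s 0 i)" unfolding KK_def \<F>_def K'_def by blast
  have \<F>: "mrel E \<and> bisv E" if "E \<in> \<F>" for E
    using that K sm[OF n] sb[OF n] unfolding \<F>_def by blast
  have fin\<F>: "finite \<F>" unfolding \<F>_def by simp
  have KKm: "mrel KK" unfolding KKeq using sm[OF n] by (intro mrel_Un mrel_UN K') auto
  \<comment> \<open>Saturating the exceptional set ensures that the whole class of a remaining point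
    lies in \<open>W\<close> and misses \<open>Z\<close>, so no path inside the class meets a bad
    point.\<close>
  define N1 where "N1 = R `` (Z \<union> N0)"
  have N1: "N1 \<in> null_sets M" unfolding N1_def by (intro saturation_null null_sets.Un Z N0)
  have gen_KK: "(x, y) \<in> conn KK" if xy: "(x, y) \<in> R" "x \<notin> N1" for x y
  proof -
    have cls: "z \<in> W \<and> z \<notin> Z" if xz: "(x, z) \<in> R" for z
      using xy(2) R_sym[OF xz] R_space[OF xz] unfolding N1_def N0_def by blast
    have "x \<in> space M" using R_space[OF xy(1)] by blast
    then have "x \<in> W" "y \<in> W" using cls R_refl xy(1) by blast+
    obtain x0 i where x0: "x0 \<in> Y" "i < n" "(x0, x) \<in> s 0 i" using toY \<open>x \<in> W\<close> by blast
    obtain y0 j where y0: "y0 \<in> Y" "j < n" "(y0, y) \<in> s 0 j" using toY \<open>y \<in> W\<close> by blast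
    have R1: "(x0, x) \<in> R" "(y0, y) \<in> R"
      using x0 y0 mrel_R0[OF sm[OF n]] R0_R by blast+
    have "(x0, y0) \<in> R" by (rule R_trans[OF R1(1) R_trans[OF xy(1) R_sym[OF R1(2)]]])
    then have "(x0, y0) \<in> conn E" using gen R_R0 x0(1) Y(2) by blast
    then have "(x0, y0) \<in> conn F" using F(3) x0 y0 by blast
    \<comment> \<open>Membership in the class of x is carried along the induction, to know that each
      vertex of the path avoids \<open>Z\<close>.\<close>
    then have "(x0, y0) \<in> conn KK \<and> (x, y0) \<in> R"
    proof (induction rule: rtrancl_induct)
      case base
      then show ?case using R1(1) R_sym by blast
    next
      case (step z w)
      have FR: "F \<subseteq> R" using mrel_R0[OF F(1)] R0_R by auto
      then have zw: "(z, w) \<in> R" using step.hyps(2) R_sym[of w z] by blast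
      have xz: "(x, z) \<in> R" using step.IH by blast
      have xw: "(x, w) \<in> R" by (rule R_trans[OF xz zw])
      have nz: "z \<notin> Z" "w \<notin> Z" using cls xz xw by blast+
      have "(z, w) \<in> conn K'"
      proof -
        have "(z, w) \<in> F \<or> (w, z) \<in> F" using step.hyps(2) by blast
        then show ?thesis
        proof
          assume "(z, w) \<in> F"
          from FK[OF this nz] show ?thesis unfolding K'_def .
        next
          assume "(w, z) \<in> F"
          from conn_sym[OF FK[OF this nz(2,1)]] show ?thesis unfolding K'_def .
        qed
      qed
      then have "(z, w) \<in> conn KK" using conn_mono[of K' KK] KKeq by blast
      then show ?case using conn_trans[of x0 z KK w] step.IH xw by blast
    qed
    moreover have "(x, x0) \<in> conn KK" "(y0, y) \<in> conn KK"
      using x0 y0 unfolding KKeq by blast+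
    ultimately show ?thesis using conn_trans[of x x0 KK y0] conn_trans[of x y0 KK y] by blast
  qed
  have fg: "finite_graphing M R KK"
    unfolding finite_graphing_def
  proof (intro conjI)
    show "KK \<in> sets (M \<Otimes>\<^sub>M M)" by (rule mrel_sets[OF KKm])
    show "KK \<subseteq> R" using mrel_R0[OF KKm] R0_R by auto
    show "generates M R KK" by (rule generatesI[OF N1 gen_KK])
    show "\<exists>\<P>. finite \<P> \<and> partition_on KK \<P> \<and> (\<forall>\<phi>\<in>\<P>. partial_automorphism M R \<phi>)"
      unfolding KK_def by (rule finite_union_partition[OF fin\<F> \<F>])
  qed
  have bd: "(y, z) \<in> K' \<and> (\<exists>m\<in>{..<n}. y = f m x \<or> z = f m x)"
    if x: "x \<notin> N0" and e: "((x, y), (x, z)) \<in> edge_boundary M R KK A" for x y z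
  proof -
    have yz: "(y, z) \<in> KK" and xy: "(x, y) \<in> R" and ne: "((x, y) \<in> \<Union>A) \<noteq> ((x, z) \<in> \<Union>A)"
      using e unfolding edge_boundary_def cayley_edges_def cayley_edges_at_def fibre_def by auto
    have xW: "x \<in> W" using x R_space[OF xy] unfolding N0_def by blast
    \<comment> \<open>Over a point of \<open>W\<close> the union of the rotations is its class in
      the subrelation, and a spoke joins two points of one class; so a spoke never crosses the
      boundary.\<close>
    have iff: "(x, y) \<in> \<Union>A \<longleftrightarrow> (x, z) \<in> \<Union>A" if i: "i < n" "(y, z) \<in> s 0 i" for i
    proof -
      obtain v where v: "(v, y) \<in> \<theta> 0" "(v, z) \<in> \<theta> i" using sD[OF i(2)] by blast
      show ?thesis
      proof
        assume "(x, y) \<in> \<Union>A"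
        then obtain a b u where "a < n" "b < n" "(u, x) \<in> \<theta> a" "(u, y) \<in> \<theta> b" using AD xW by blast
        then show "(x, z) \<in> \<Union>A" using idx[OF _ n _ v(1)] v(2) AI[OF _ i(1)] by blast
      next
        assume "(x, z) \<in> \<Union>A"
        then obtain a b u where "a < n" "b < n" "(u, x) \<in> \<theta> a" "(u, z) \<in> \<theta> b" using AD xW by blast
        then show "(x, y) \<in> \<Union>A" using idx[OF _ i(1) _ v(2)] v(1) AI[OF _ n] by blast
      qed
    qed
    then have "(y, z) \<in> K'" using yz ne unfolding KKeq by blast
    moreover have "\<exists>m\<in>{..<n}. y = f m x \<or> z = f m x"
    proof -
      have "(x, y) \<in> \<Union>A \<or> (x, z) \<in> \<Union>A" using ne by blast
      then obtain m where "m < n" "(x, y) \<in> g m \<or> (x, z) \<in> g m" unfolding A_def by blast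
      then show ?thesis using f by (metis lessThan_iff)
    qed
    ultimately show ?thesis by blast
  qed
  have "edge_measure M R KK (edge_boundary M R KK A) \<le> of_nat (2 * card {..<n}) * mass K'"
    by (rule edge_boundary_bound[OF K' _ fm(1) fm(2) N0 bd]) auto
  also have "\<dots> \<le> of_nat (2 * n) * (18 * c)" using massK' by (intro mult_mono) auto
  also have "\<dots> = of_nat n * (36 * c)"
  proof -
    have "of_nat (2 * n) * (18 * c) = of_nat n * ((2 * 18) * c)"
      by (simp only: of_nat_mult of_nat_numeral mult.assoc mult.left_commute)
    then show ?thesis by simp
  qed
  finally have "edge_measure M R KK (edge_boundary M R KK A) / of_nat (card A) \<le> 36 * c"
    using n unfolding cardA by (intro divide_le_posI_ennreal) (auto simp: mult.commute)
  moreover have "isoperimetric_constant M R KK \<le> edge_measure M R KK (edge_boundary M R KK A) / of_nat (card A)"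
    unfolding isoperimetric_constant_def using Aok by (intro INF_lower) auto
  moreover have "uniform_isoperimetric_constant M R \<le> isoperimetric_constant M R KK"
    unfolding uniform_isoperimetric_constant_def using fg by (intro INF_lower) auto
  ultimately show ?thesis unfolding c_def by (meson order_trans)
qed

end


subsection \<open>Graphings of almost optimal cost\<close>

text \<open>Extending by the identity outside the domain keeps the maps measurable and inside
  \<open>R\<close>, and lets them be composed freely into words.\<close>

lemma partial_automorphism_total_functions:
  assumes equiv: "equiv (space M) R" and \<phi>: "partial_automorphism M R \<phi>"
  shows "\<exists>h h'. h \<in> M \<rightarrow>\<^sub>M M \<and> h' \<in> M \<rightarrow>\<^sub>M M \<and>
    (\<forall>x\<in>space M. (x, h x) \<in> R \<and> (x, h' x) \<in> R) \<and> (\<forall>(x, y)\<in>\<phi>. h x = y \<and> h' y = x) \<and>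
    Domain \<phi> \<in> sets M \<and> single_valued \<phi>"
proof -
  obtain A B f where A: "A \<in> sets M" and B: "B \<in> sets M" and bij: "bij_betw f A B"
    and f: "f \<in> restrict_space M A \<rightarrow>\<^sub>M restrict_space M B"
    and i: "the_inv_into A f \<in> restrict_space M B \<rightarrow>\<^sub>M restrict_space M A"
    and eq: "\<phi> = (\<lambda>x. (x, f x)) ` A" and sub: "\<phi> \<subseteq> R"
    using \<phi> unfolding partial_automorphism_def by (elim bexE exE conjE)
  have glue: "(\<lambda>x. if x \<in> C then k x else x) \<in> M \<rightarrow>\<^sub>M M"
    if C: "C \<in> sets M" and k: "k \<in> restrict_space M C \<rightarrow>\<^sub>M restrict_space M D" for C D k
  proof -
    have "{x \<in> space M. x \<in> C} = C" using sets.sets_into_space[OF C] by blast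
    moreover have "k \<in> restrict_space M {x. x \<in> C} \<rightarrow>\<^sub>M M"
      using k by (simp add: measurable_restrict_space2_iff)
    moreover have "(\<lambda>x. x) \<in> restrict_space M {x. x \<notin> C} \<rightarrow>\<^sub>M M"
      by (rule measurable_restrict_space1) simp
    ultimately show ?thesis using C by (subst measurable_If_restrict_space_iff) auto
  qed
  have inj: "inj_on f A" and im: "f ` A = B" using bij by (auto simp: bij_betw_def)
  have inv: "the_inv_into A f (f x) = x" if "x \<in> A" for x using the_inv_into_f_f[OF inj that] .
  have fR: "(x, f x) \<in> R" if "x \<in> A" for x using sub eq that by auto
  have sy: "sym R" using equiv by (rule equivE)
  have rf: "(x, x) \<in> R" if "x \<in> space M" for x using equiv_class_self[OF equiv that] by simp
  define h where "h x = (if x \<in> A then f x else x)" for x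
  define h' where "h' x = (if x \<in> B then the_inv_into A f x else x)" for x
  have "h \<in> M \<rightarrow>\<^sub>M M" "h' \<in> M \<rightarrow>\<^sub>M M"
    unfolding h_def h'_def by (rule glue[OF A f], rule glue[OF B i])
  moreover have "(x, h x) \<in> R" if "x \<in> space M" for x
    using that rf fR by (simp add: h_def)
  moreover have "(x, h' x) \<in> R" if "x \<in> space M" for x
  proof (cases "x \<in> B")
    case True
    then obtain a where a: "a \<in> A" "x = f a" using im by blast
    then show ?thesis using symD[OF sy fR[OF a(1)]] True inv by (simp add: h'_def)
  qed (use that rf in \<open>simp add: h'_def\<close>)
  moreover have "h x = y \<and> h' y = x" if "(x, y) \<in> \<phi>" for x y
    using that inv im unfolding eq h_def h'_def by auto
  moreover have "Domain \<phi> = A" unfolding eq by force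
  moreover have "single_valued \<phi>" unfolding eq by (auto simp: single_valued_def)
  ultimately show ?thesis using A by (intro exI[of _ h] exI[of _ h']) auto
qed

context countable_pmp_relation
begin

lemma mass_UN_finite:
  assumes "finite I" "\<And>i. i \<in> I \<Longrightarrow> mrel (E i)"
  shows "mass (\<Union>i\<in>I. E i) \<le> (\<Sum>i\<in>I. mass (E i))"
  using assms
proof (induction rule: finite_induct)
  case (insert i I)
  have "mrel (\<Union>i\<in>I. E i)" using insert by (intro mrel_UN) (auto simp: countable_finite)
  then have "mass (\<Union>j\<in>insert i I. E j) \<le> mass (E i) + mass (\<Union>j\<in>I. E j)"
    using mass_Un[of "E i"] insert.prems by simp
  also have "\<dots> \<le> mass (E i) + (\<Sum>j\<in>I. mass (E j))"
    using insert by (intro add_left_mono) auto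
  finally show ?case using insert.hyps by simp
qed (simp add: mass_empty)

lemma mass_incseq:
  assumes "\<And>n::nat. mrel (E n)" "incseq E"
  shows "mass (\<Union>n. E n) = (SUP n. mass (E n))"
proof -
  have inc: "incseq (\<lambda>n. E n `` {x})" for x using assms(2) unfolding incseq_def by blast
  have "emeasure (count_space UNIV) ((\<Union>n. E n) `` {x}) = (SUP n. emeasure (count_space UNIV) (E n `` {x}))" for x
  proof -
    have "(\<Union>n. E n) `` {x} = (\<Union>n. E n `` {x})" by blast
    then show ?thesis using SUP_emeasure_incseq[of "\<lambda>n. E n `` {x}" "count_space UNIV"] inc by simp
  qed
  moreover have "incseq (\<lambda>n x. emeasure (count_space UNIV) (E n `` {x}))"
    using inc unfolding incseq_def le_fun_def by (auto intro!: emeasure_mono)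
  ultimately show ?thesis
    unfolding mass_def using nn_integral_monotone_convergence_SUP[OF _ count_measurable[OF assms(1)]] by simp
qed

text \<open>\<open>graphing_cost\<close> is an unordered sum over the graphing. The finite sets
  \<open>J n\<close> exhaust the index set, and monotone convergence passes to the union.\<close>

lemma mass_UN_countable:
  fixes f :: "'i \<Rightarrow> ennreal"
  assumes "countable I" "\<And>i. i \<in> I \<Longrightarrow> mrel (E i)" "\<And>i. i \<in> I \<Longrightarrow> mass (E i) \<le> f i"
  shows "mass (\<Union>i\<in>I. E i) \<le> infsum f I"
proof -
  define J where "J n = {i \<in> I. to_nat_on I i < n}" for n
  have fin: "finite (J n)" for n
    by (rule inj_on_finite[of "to_nat_on I" _ "{..<n}"])
      (auto simp: J_def intro: inj_on_subset[OF inj_on_to_nat_on[OF assms(1)]])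
  have UJ: "(\<Union>i\<in>I. E i) = (\<Union>n. \<Union>i\<in>J n. E i)" unfolding J_def by blast
  have m: "mrel (\<Union>i\<in>J n. E i)" for n
    using fin[of n] assms(2) by (intro mrel_UN) (auto simp: J_def countable_finite)
  have inc: "incseq (\<lambda>n. \<Union>i\<in>J n. E i)"
    unfolding incseq_def J_def by (auto intro: less_le_trans)
  have "mass (\<Union>i\<in>J n. E i) \<le> infsum f I" for n
  proof -
    have "mass (\<Union>i\<in>J n. E i) \<le> (\<Sum>i\<in>J n. mass (E i))"
      using assms(2) by (intro mass_UN_finite fin) (auto simp: J_def)
    also have "\<dots> \<le> (\<Sum>i\<in>J n. f i)" using assms(3) by (intro sum_mono) (auto simp: J_def)
    also have "\<dots> \<le> infsum f I"
      using fin by (subst nonneg_infsum_complete) (auto simp: J_def intro!: SUP_upper)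
    finally show ?thesis .
  qed
  then show ?thesis unfolding UJ mass_incseq[OF m inc] by (rule SUP_least)
qed

end

text \<open>The section count of \<open>N\<close> need not be measurable, in which case \<open>h_measure\<close> is only a lower
  integral; this is why measurability of projections is needed.\<close>

lemma h_measure_zero_projection:
  assumes M: "prob_space M" "standard_borel M" and N: "N \<in> sets (M \<Otimes>\<^sub>M M)" "N \<subseteq> R"
    and h: "h_measure M R N = 0"
  shows "\<exists>Z\<in>null_sets M. fst ` N \<subseteq> Z"
proof -
  obtain B Z where BZ: "B \<in> sets M" "Z \<in> null_sets M" "B \<subseteq> fst ` N" "fst ` N \<subseteq> B \<union> Z"
    by (rule measurable_projection[OF M N(1)])
  \<comment> \<open>The measurable kernel \<open>B\<close> of the projection has its indicator below
    the section count, so the lower integral controls its measure.\<close>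
  have "indicator B x \<le> emeasure (count_space UNIV) (N \<inter> fibre R x)" for x
  proof (cases "x \<in> B")
    case True
    then obtain p where "p \<in> N" "fst p = x" using BZ(3) by auto
    then have "{p} \<subseteq> N \<inter> fibre R x" using N(2) unfolding fibre_def by blast
    then have "emeasure (count_space UNIV) {p} \<le> emeasure (count_space UNIV) (N \<inter> fibre R x)"
      by (intro emeasure_mono) auto
    then show ?thesis using True by simp
  qed simp
  then have "(\<integral>\<^sup>+x. indicator B x \<partial>M) \<le> h_measure M R N"
    unfolding h_measure_def by (intro nn_integral_mono)
  then have "B \<in> null_sets M" using BZ(1) h by auto
  then show ?thesis using BZ by (intro bexI[of _ "B \<union> Z"]) auto
qed

text \<open>Words in the total extensions of the generators and their inverses form a countable
  family. A word may apply a letter outside its original domain, where it acts as the identity, so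
  the point never leaves its class.\<close>

lemma graphing_class_functions:
  assumes equiv: "equiv (space M) R" and \<Phi>: "countable \<Phi>" "\<forall>\<phi>\<in>\<Phi>. partial_automorphism M R \<phi>"
  shows "\<exists>G :: nat \<Rightarrow> 'a \<Rightarrow> 'a. (\<forall>k. G k \<in> M \<rightarrow>\<^sub>M M) \<and> (\<forall>k. \<forall>x\<in>space M. (x, G k x) \<in> R) \<and>
    (\<forall>(x, y)\<in>conn (\<Union>\<Phi>). \<exists>k. y = G k x)"
proof -
  have "\<forall>\<phi>\<in>\<Phi>. \<exists>hh. fst hh \<in> M \<rightarrow>\<^sub>M M \<and> snd hh \<in> M \<rightarrow>\<^sub>M M \<and>
    (\<forall>x\<in>space M. (x, fst hh x) \<in> R \<and> (x, snd hh x) \<in> R) \<and> (\<forall>(x, y)\<in>\<phi>. fst hh x = y \<and> snd hh y = x)"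
  proof
    fix \<phi> assume "\<phi> \<in> \<Phi>"
    from partial_automorphism_total_functions[OF equiv bspec[OF \<Phi>(2) this]] obtain h h' where
      "h \<in> M \<rightarrow>\<^sub>M M" "h' \<in> M \<rightarrow>\<^sub>M M" "\<forall>x\<in>space M. (x, h x) \<in> R \<and> (x, h' x) \<in> R"
      "\<forall>(x, y)\<in>\<phi>. h x = y \<and> h' y = x" by (elim exE conjE)
    then show "\<exists>hh. fst hh \<in> M \<rightarrow>\<^sub>M M \<and> snd hh \<in> M \<rightarrow>\<^sub>M M \<and>
        (\<forall>x\<in>space M. (x, fst hh x) \<in> R \<and> (x, snd hh x) \<in> R) \<and> (\<forall>(x, y)\<in>\<phi>. fst hh x = y \<and> snd hh y = x)"
      by (intro exI[of _ "(h, h')"]) simp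
  qed
  from this[THEN bchoice] obtain H where
    H: "\<forall>\<phi>\<in>\<Phi>. fst (H \<phi>) \<in> M \<rightarrow>\<^sub>M M \<and> snd (H \<phi>) \<in> M \<rightarrow>\<^sub>M M \<and>
      (\<forall>x\<in>space M. (x, fst (H \<phi>) x) \<in> R \<and> (x, snd (H \<phi>) x) \<in> R) \<and>
      (\<forall>(x, y)\<in>\<phi>. fst (H \<phi>) x = y \<and> snd (H \<phi>) y = x)" ..
  define S where "S = insert (\<lambda>x. x) ((\<lambda>\<phi>. fst (H \<phi>)) ` \<Phi> \<union> (\<lambda>\<phi>. snd (H \<phi>)) ` \<Phi>)"
  define c where "c = from_nat_into S"
  have "countable S" "S \<noteq> {}" using \<Phi>(1) unfolding S_def by auto
  then have rc: "range c = S" unfolding c_def by (simp add: range_from_nat_into)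
  have rf: "(x, x) \<in> R" if "x \<in> space M" for x using equiv_class_self[OF equiv that] by simp
  have tr: "trans R" using equiv by (rule equivE)
  have cS: "h \<in> M \<rightarrow>\<^sub>M M \<and> (\<forall>x\<in>space M. (x, h x) \<in> R)" if "h \<in> S" for h
    using that H rf unfolding S_def by auto
  have c: "c i \<in> M \<rightarrow>\<^sub>M M" "x \<in> space M \<Longrightarrow> (x, c i x) \<in> R" for i x
    using cS[of "c i"] rc by auto
  define word where "word w x = fold c w x" for w :: "nat list" and x
  have word: "word w \<in> M \<rightarrow>\<^sub>M M \<and> (\<forall>x\<in>space M. (x, word w x) \<in> R)" for w
  proof (induction w rule: rev_induct)
    case Nil
    then show ?case using rf by (simp add: word_def[abs_def])
  next
    case (snoc i w)
    have eq: "word (w @ [i]) = (\<lambda>x. c i (word w x))" by (simp add: word_def fun_eq_iff)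
    have 1: "(\<lambda>x. c i (word w x)) \<in> M \<rightarrow>\<^sub>M M" using measurable_compose[OF conjunct1[OF snoc] c(1)] .
    have "(x, c i (word w x)) \<in> R" if x: "x \<in> space M" for x
    proof -
      have "word w x \<in> space M" using measurable_space[OF conjunct1[OF snoc] x] .
      then show ?thesis using transD[OF tr] snoc x c(2) by blast
    qed
    then show ?case unfolding eq using 1 by blast
  qed
  define G where "G k = word (from_nat k)" for k
  have "\<exists>k. y = G k x" if "(x, y) \<in> conn (\<Union>\<Phi>)" for x y
  proof -
    have "\<exists>w. y = word w x" using that
    proof (induction rule: rtrancl_induct)
      case base
      show ?case by (intro exI[of _ "[]"]) (simp add: word_def)
    next
      case (step y z)
      then obtain w where w: "y = word w x" by blast
      have "\<exists>h\<in>S. h y = z"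
      proof (cases "(y, z) \<in> \<Union>\<Phi>")
        case True
        then obtain \<phi> where "\<phi> \<in> \<Phi>" "(y, z) \<in> \<phi>" by blast
        then show ?thesis using H unfolding S_def by (intro bexI[of _ "fst (H \<phi>)"]) auto
      next
        case False
        then obtain \<phi> where "\<phi> \<in> \<Phi>" "(z, y) \<in> \<phi>" using step.hyps(2) by blast
        then show ?thesis using H unfolding S_def by (intro bexI[of _ "snd (H \<phi>)"]) auto
      qed
      then obtain i where "c i y = z" using rc by (metis rangeE)
      then show ?case using w by (intro exI[of _ "w @ [i]"]) (simp add: word_def)
    qed
    then show ?thesis unfolding G_def by (metis from_nat_to_nat)
  qed
  then show ?thesis using word unfolding G_def by (intro exI[of _ "\<lambda>k. word (from_nat k)"]) auto
qed

theorem proposition14: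
  fixes M :: "'a measure" and R :: "'a rel"
  assumes "standard_nonatomic_prob_space M"
    and "measured_equivalence_relation M R"
    and "ergodic M R"
    and "type_II1 M R"
    and "cost M R = 1"
  shows "uniform_isoperimetric_constant M R = 0"
proof -
  have P: "prob_space M" and SB: "standard_borel M" and NA: "nonatomic M"
    using assms(1) unfolding standard_nonatomic_prob_space_def by simp_all
  interpret P: prob_space M by fact
  have equiv: "equiv (space M) R" and RM: "R \<in> sets (M \<Otimes>\<^sub>M M)"
    and null: "\<And>N. N \<in> null_sets M \<Longrightarrow> R `` N \<in> null_sets M"
    using assms(2) unfolding measured_equivalence_relation_def by simp_all
  have sy: "sym R" using equiv by (rule equivE)
  have tr: "trans R" using equiv by (rule equivE)
  have rf: "(x, x) \<in> R" if "x \<in> space M" for x using equiv_class_self[OF equiv that] by simp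
  have bound: "uniform_isoperimetric_constant M R \<le> 36 * (ennreal \<delta> + ennreal (1 / n))"
    if \<delta>: "\<delta> > 0" and n: "n > 0" and small: "6 * (ennreal \<delta> + ennreal (1 / n)) \<le> 1"
    for \<delta> :: real and n :: nat
  proof -
    have "ennreal 1 < ennreal (1 + \<delta>)" using \<delta> by (intro ennreal_lessI) auto
    then have "cost M R < 1 + ennreal \<delta>" using assms(5) \<delta> by (simp add: ennreal_plus)
    then obtain \<Phi> where \<Phi>: "graphing M R \<Phi>" "graphing_cost M \<Phi> < 1 + ennreal \<delta>"
      unfolding cost_def INF_less_iff by blast
    have \<Phi>c: "countable \<Phi>" and \<Phi>p: "\<forall>\<phi>\<in>\<Phi>. partial_automorphism M R \<phi>"
      and \<Phi>g: "generates M R (\<Union>\<Phi>)" using \<Phi>(1) unfolding graphing_def by simp_all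
    obtain N where N: "N \<in> sets (M \<Otimes>\<^sub>M M)" "{p \<in> R. p \<notin> conn (\<Union>\<Phi>)} \<subseteq> N" "N \<subseteq> R" "h_measure M R N = 0"
      using \<Phi>g unfolding generates_def h_null_def by blast
    obtain Z where Z: "Z \<in> null_sets M" "fst ` N \<subseteq> Z"
      using h_measure_zero_projection[OF P SB N(1,3,4)] by blast
    obtain G :: "nat \<Rightarrow> 'a \<Rightarrow> 'a" where G: "\<forall>k. G k \<in> M \<rightarrow>\<^sub>M M" "\<forall>k. \<forall>x\<in>space M. (x, G k x) \<in> R"
        "\<forall>(x, y)\<in>conn (\<Union>\<Phi>). \<exists>k. y = G k x"
      using graphing_class_functions[OF equiv \<Phi>c \<Phi>p] by (elim exE conjE)
    \<comment> \<open>Removing the whole saturation keeps the rest invariant; on it the graphing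
      generates every pair, without exception.\<close>
    define X0 where "X0 = space M - R `` Z"
    have RZ: "R `` Z \<in> null_sets M" by (rule null[OF Z(1)])
    have X0R: "y \<in> X0" if "x \<in> X0" "(x, y) \<in> R" for x y
    proof -
      have "y \<in> space M" using equiv_type[OF equiv] that(2) by blast
      moreover have "y \<notin> R `` Z"
      proof
        assume "y \<in> R `` Z"
        then have "x \<in> R `` Z" using transD[OF tr] symD[OF sy that(2)] by blast
        then show False using that(1) unfolding X0_def by blast
      qed
      ultimately show ?thesis unfolding X0_def by blast
    qed
    have X0c: "(x, y) \<in> conn (\<Union>\<Phi>)" if "x \<in> X0" "(x, y) \<in> R" for x y
    proof (rule ccontr)
      assume "(x, y) \<notin> conn (\<Union>\<Phi>)"
      then have "(x, y) \<in> N" using N(2) that(2) by blast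
      then have "x \<in> Z" using Z(2) by force
      then show False using that(1) rf unfolding X0_def by blast
    qed
    interpret countable_pmp_relation M R X0 G
    proof unfold_locales
      show "Id_on (space M) \<in> sets (M \<Otimes>\<^sub>M M)" by (rule diagonal_measurable[OF SB])
      show "X0 \<in> P.events" unfolding X0_def using RZ by auto
      show "emeasure M X0 = 1" unfolding X0_def
        using emeasure_Diff_null_set[OF RZ sets.top] P.emeasure_space_1 by simp
      show "R `` X0 \<subseteq> X0" using X0R by blast
      show "R `` {x} = range (\<lambda>k. G k x)" if x: "x \<in> X0" for x
      proof
        show "R `` {x} \<subseteq> range (\<lambda>k. G k x)" using X0c[OF x] G(3) by fastforce
        show "range (\<lambda>k. G k x) \<subseteq> R `` {x}" using x G(2) unfolding X0_def by blast
      qed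
    qed (use equiv RM null assms NA G in auto)
    define e where "e \<phi> = \<phi> \<inter> X0 \<times> X0" for \<phi> :: "'a rel"
    have e: "mrel (e \<phi>) \<and> mass (e \<phi>) \<le> emeasure M (Domain \<phi>) \<and> \<phi> \<subseteq> R" if \<phi>: "\<phi> \<in> \<Phi>" for \<phi>
    proof -
      from partial_automorphism_total_functions[OF equiv bspec[OF \<Phi>p \<phi>]] obtain h h' where
        h: "h \<in> M \<rightarrow>\<^sub>M M" "\<forall>x\<in>space M. (x, h x) \<in> R \<and> (x, h' x) \<in> R"
          "\<forall>(x, y)\<in>\<phi>. h x = y \<and> h' y = x" "Domain \<phi> \<in> sets M" "single_valued \<phi>" by (elim exE conjE)
      have \<phi>R: "\<phi> \<subseteq> R" using bspec[OF \<Phi>p \<phi>] unfolding partial_automorphism_def by blast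
      have h\<phi>: "h x = y" if "(x, y) \<in> \<phi>" for x y using bspec[OF h(3) that] by simp
      \<comment> \<open>The restricted generator is recovered from the graph of its total extension,
        which is measurable by way of the diagonal.\<close>
      have "e \<phi> = {(x, y) \<in> R0. h x = y} \<inter> Domain \<phi> \<times> space M"
      proof (intro equalityI subsetI; clarify)
        fix x y assume "(x, y) \<in> e \<phi>"
        then have xy: "(x, y) \<in> \<phi>" "x \<in> X0" "y \<in> X0" unfolding e_def by blast+
        then have "(x, y) \<in> R0" "y \<in> space M" using \<phi>R X0_space unfolding R0_def by blast+
        then show "(x, y) \<in> {(x, y) \<in> R0. h x = y} \<inter> Domain \<phi> \<times> space M" using xy h\<phi> by blast
      next
        fix x y z assume "(x, h x) \<in> R0" "(x, z) \<in> \<phi>"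
        then show "(x, h x) \<in> e \<phi>" using h\<phi>[of x z] unfolding e_def R0_def by blast
      qed
      then have m: "mrel (e \<phi>)" using mrel_rect[OF mrel_graph[OF h(1)] h(4)] by simp
      have "single_valued (e \<phi>)" using h(5) unfolding e_def single_valued_def by blast
      then have "mass (e \<phi>) = emeasure M (Domain (e \<phi>))" by (rule mass_single_valued[OF m])
      also have "\<dots> \<le> emeasure M (Domain \<phi>)" by (intro emeasure_mono h(4)) (auto simp: e_def)
      finally show ?thesis using m \<phi>R by blast
    qed
    define E where "E = (\<Union>\<phi>\<in>\<Phi>. e \<phi>)"
    have mE: "mrel E" unfolding E_def using e by (intro mrel_UN \<Phi>c) blast
    have "mass E \<le> graphing_cost M \<Phi>"
      unfolding E_def graphing_cost_def using e by (intro mass_UN_countable \<Phi>c) blast+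
    then have massE: "mass E \<le> 1 + ennreal \<delta>" using \<Phi>(2) by (meson order_trans order_less_imp_le)
    have genE: "(x, y) \<in> conn E" if xy: "(x, y) \<in> R0" for x y
    proof -
      have "x \<in> X0" using R0_X0[OF xy] by blast
      have "(x, y) \<in> conn (\<Union>\<Phi>)" using X0c R0_X0[OF xy] R0_R[OF xy] by blast
      then have "(x, y) \<in> conn E \<and> y \<in> X0"
      proof (induction rule: rtrancl_induct)
        case base
        then show ?case using \<open>x \<in> X0\<close> by blast
      next
        case (step z w)
        have "\<Union>\<Phi> \<subseteq> R" using e by blast
        then have "(z, w) \<in> R" using step.hyps(2) symD[OF sy, of w z] by blast
        then have w: "w \<in> X0" using X0R step.IH by blast
        then have "(z, w) \<in> E \<union> E\<inverse>" using step.hyps(2) step.IH unfolding E_def e_def by blast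
        then show ?case using step.IH w by (meson rtrancl_into_rtrancl)
      qed
      then show ?thesis by blast
    qed
    show ?thesis by (rule isoperimetric_bound[OF mE genE massE n small])
  qed
  have "uniform_isoperimetric_constant M R \<le> 0"
  proof (rule ennreal_le_epsilon)
    fix e :: real assume "e > 0"
    \<comment> \<open>72 is twice 36, as the two summands \<open>\<delta>\<close> and
      \<open>1 / Suc n\<close> are each at most \<open>\<delta>\<close>; the minimum with 1 secures
      the smallness condition \<open>6 * (\<delta> + t) \<le> 1\<close>.\<close>
    define \<delta> where "\<delta> = min e 1 / 72"
    have \<delta>: "\<delta> > 0" using \<open>e > 0\<close> by (simp add: \<delta>_def)
    have \<delta>_le: "\<delta> \<le> e / 72" "\<delta> \<le> 1 / 72" by (simp_all add: \<delta>_def)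
    have small: "6 * (\<delta> + t) \<le> 1" "36 * (\<delta> + t) \<le> e" if "t < \<delta>" for t
      using that \<delta>_le by (simp_all add: field_simps)
    obtain n where n: "1 / real (Suc n) < \<delta>" using nat_approx_posE[OF \<delta>] by blast
    have sum: "ennreal \<delta> + ennreal (1 / real (Suc n)) = ennreal (\<delta> + 1 / real (Suc n))"
      using \<delta> by (intro ennreal_plus[symmetric]) auto
    have "6 * (ennreal \<delta> + ennreal (1 / real (Suc n))) = ennreal (6 * (\<delta> + 1 / real (Suc n)))"
      unfolding sum using \<delta> by (subst ennreal_mult) auto
    also have "\<dots> \<le> ennreal 1" by (rule ennreal_leI[OF small(1)[OF n]])
    finally have "6 * (ennreal \<delta> + ennreal (1 / real (Suc n))) \<le> 1" by simp
    from bound[OF \<delta> _ this] have "uniform_isoperimetric_constant M R \<le> 36 * (ennreal \<delta> + ennreal (1 / real (Suc n)))"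
      by simp
    also have "\<dots> = ennreal (36 * (\<delta> + 1 / real (Suc n)))"
      unfolding sum using \<delta> by (subst ennreal_mult) auto
    also have "\<dots> \<le> ennreal e" by (rule ennreal_leI[OF small(2)[OF n]])
    finally show "uniform_isoperimetric_constant M R \<le> 0 + ennreal e" by simp
  qed
  then show ?thesis by simp
qed

end
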